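(* Let $\kappa\in\{1,-1\}$ and let $\Phi_t$ be the flow on $X_5$ of $i\partial_tq=-\frac12\partial_x^2q+\kappa|q|^2q$. For $f\in X_5$, let $$\mathcal H_{\rm loc}(f)=\overline{\{\mathcal T_yf:y\in\mathbb R\}}^{\,C^4_{\rm loc}(\mathbb R)},\qquad(\mathcal T_yf)(x)=f(x+y).$$ This is a compact subset of $\{g\in X_5:\|g\|_5\le\|f\|_5\}$ (for the topology of $C^4_{\rm loc}(\mathbb R)$). For every $t\in\mathbb R$, the flow restricts to a homeomorphism $$\Phi_t:\mathcal H_{\rm loc}(f)\longrightarrow\mathcal H_{\rm loc}(\Phi_t(f))$$ for the local $C^4$ topologies and commutes with all translations $\mathcal T_y$.
   Context: Choose a real, even $\chi\in C_c^\infty((-1,1))$ with $\sum_{k\in\mathbb Z}\chi(\xi-k)=1$. With $\widehat f(\xi)=\int e^{-ix\xi}f(x)\,dx$, put $\Box_kf=\mathcal F^{-1}(\chi(\xi-k)\widehat f(\xi))$, $\langle k\rangle=(1+k^2)^{1/2}$. For $s\ge0$, $X_s=\{f\in\mathcal S'(\mathbb R):\|f\|_s:=\sum_{k}\langle k\rangle^s\|\Box_kf\|_\infty<\infty\}$ (complex-valued). Flow: for every $q_0\in X_5$ there is a global classical solution $q\in C(\mathbb R;X_5)\cap C^1(\mathbb R;X_3)$ of the equation with $q(0)=q_0$, unique among classical solutions $v$ with $v,v_x$ bounded on every strip $[-T,T]\times\mathbb R$, $T<\infty$; $\Phi_t(q_0)=q(t)$. *)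

theory Defs
  imports "HOL-Analysis.Analysis" "HOL-Probability.Essential_Supremum"
begin

definition nderiv :: "nat \<Rightarrow> (real \<Rightarrow> 'a::real_normed_vector) \<Rightarrow> real \<Rightarrow> 'a" where
  "nderiv n f = ((\<lambda>g x. vector_derivative g (at x)) ^^ n) f"

definition Cn :: "nat \<Rightarrow> (real \<Rightarrow> 'a::real_normed_vector) set" where
  "Cn n = {f. (\<forall>j<n. \<forall>x. nderiv j f differentiable at x) \<and> continuous_on UNIV (nderiv n f)}"

definition smooth :: "(real \<Rightarrow> 'a::real_normed_vector) \<Rightarrow> bool" where
  "smooth f \<longleftrightarrow> (\<forall>n. f \<in> Cn n)"

definition Cn_loc_nhd ::
    "nat \<Rightarrow> (real \<Rightarrow> 'a::real_normed_vector) \<Rightarrow> real \<Rightarrow> real \<Rightarrow> (real \<Rightarrow> 'a) set" where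
  "Cn_loc_nhd n f R e =
     {g \<in> Cn n. \<forall>j\<le>n. \<forall>x\<in>{-R..R}. norm (nderiv j g x - nderiv j f x) < e}"

definition Cn_loc :: "nat \<Rightarrow> (real \<Rightarrow> 'a::real_normed_vector) topology" where
  "Cn_loc n = topology_generated_by {Cn_loc_nhd n f R e | f R e. f \<in> Cn n \<and> 0 < e}"

lemma topspace_Cn_loc: "topspace (Cn_loc n) = Cn n"
proof -
  have "f \<in> Cn_loc_nhd n f 0 1" if "f \<in> Cn n" for f :: "real \<Rightarrow> 'a"
    using that by (simp add: Cn_loc_nhd_def)
  moreover have "Cn_loc_nhd n f R e \<subseteq> Cn n" for f :: "real \<Rightarrow> 'a" and R e
    by (auto simp: Cn_loc_nhd_def)
  ultimately show ?thesis
    unfolding Cn_loc_def topology_generated_by_topspace by (fastforce intro: zero_less_one)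
qed

definition schwartz :: "(real \<Rightarrow> complex) set" where
  "schwartz = {\<phi>. smooth \<phi> \<and> (\<forall>m k. bounded (range (\<lambda>x. x ^ m *\<^sub>R nderiv k \<phi> x)))}"

definition schwartz_norm :: "nat \<Rightarrow> (real \<Rightarrow> complex) \<Rightarrow> real" where
  "schwartz_norm N \<phi> = (\<Sum>m\<le>N. \<Sum>k\<le>N. SUP x. \<bar>x\<bar> ^ m * norm (nderiv k \<phi> x))"

text \<open>Functionals live on all functions; being extensional outside the Schwartz space makes
  equality of two such functionals the equality of distributions.\<close>

type_synonym functional = "(real \<Rightarrow> complex) \<Rightarrow> complex"

definition tempered :: "functional set" where
  "tempered = {u \<in> extensional schwartz.
     (\<forall>\<phi>\<in>schwartz. \<forall>\<psi>\<in>schwartz. u (\<lambda>x. \<phi> x + \<psi> x) = u \<phi> + u \<psi>) \<and>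
     (\<forall>c. \<forall>\<phi>\<in>schwartz. u (\<lambda>x. c * \<phi> x) = c * u \<phi>) \<and>
     (\<exists>C N. \<forall>\<phi>\<in>schwartz. norm (u \<phi>) \<le> C * schwartz_norm N \<phi>)}"

definition dist_of :: "(real \<Rightarrow> complex) \<Rightarrow> functional" where
  "dist_of f = (\<lambda>\<phi>\<in>schwartz. LINT x|lborel. f x * \<phi> x)"

definition fourier :: "(real \<Rightarrow> complex) \<Rightarrow> real \<Rightarrow> complex" where
  "fourier \<phi> \<xi> = (LINT x|lborel. exp (- \<i> * of_real (x * \<xi>)) * \<phi> x)"

definition inv_fourier :: "(real \<Rightarrow> complex) \<Rightarrow> real \<Rightarrow> complex" where
  "inv_fourier \<phi> x =
     of_real (1 / (2 * pi)) * (LINT \<xi>|lborel. exp (\<i> * of_real (x * \<xi>)) * \<phi> \<xi>)"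

definition fourier_dist :: "functional \<Rightarrow> functional" where
  "fourier_dist u = (\<lambda>\<phi>\<in>schwartz. u (fourier \<phi>))"

definition inv_fourier_dist :: "functional \<Rightarrow> functional" where
  "inv_fourier_dist u = (\<lambda>\<phi>\<in>schwartz. u (inv_fourier \<phi>))"

definition mult_dist :: "(real \<Rightarrow> complex) \<Rightarrow> functional \<Rightarrow> functional" where
  "mult_dist a u = (\<lambda>\<phi>\<in>schwartz. u (\<lambda>x. a x * \<phi> x))"

text \<open>The norm is infinite if the distribution is not given by an essentially bounded function.
  A function \<open>g\<close> with infinite essential supremum contributes nothing to the infimum, so it does
  not matter that \<open>dist_of g\<close> is then meaningless.\<close>

definition Linf_norm :: "functional \<Rightarrow> ennreal" where
  "Linf_norm u =
     (INF g \<in> {g \<in> borel_measurable lborel. u = dist_of g}. esssup lborel (\<lambda>x. ennreal (norm (g x))))"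

definition window :: "(real \<Rightarrow> real) \<Rightarrow> bool" where
  "window chi \<longleftrightarrow> smooth chi \<and> closure {\<xi>. chi \<xi> \<noteq> 0} \<subseteq> {-1<..<1} \<and> (\<forall>\<xi>. chi (- \<xi>) = chi \<xi>) \<and>
     (\<forall>\<xi>. ((\<lambda>k::int. chi (\<xi> - of_int k)) has_sum 1) UNIV)"

definition box_op :: "(real \<Rightarrow> real) \<Rightarrow> int \<Rightarrow> functional \<Rightarrow> functional" where
  "box_op chi k u =
     inv_fourier_dist (mult_dist (\<lambda>\<xi>. of_real (chi (\<xi> - of_int k))) (fourier_dist u))"

definition Xnorm_dist :: "(real \<Rightarrow> real) \<Rightarrow> real \<Rightarrow> functional \<Rightarrow> ennreal" where
  "Xnorm_dist chi s u =
     (\<Sum>\<^sub>\<infinity>k::int. ennreal (sqrt (1 + (of_int k)\<^sup>2) powr s) * Linf_norm (box_op chi k u))"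

definition X_dist :: "(real \<Rightarrow> real) \<Rightarrow> real \<Rightarrow> functional set" where
  "X_dist chi s = {u \<in> tempered. Xnorm_dist chi s u < \<infinity>}"

text \<open>For \<open>s \<ge> 0\<close> the series \<open>\<Sum>k. \<Box>\<^sub>k u\<close> converges uniformly, so every member of \<open>X_dist chi s\<close> is
  given by exactly one bounded continuous function. Pointwise notions (translation, derivatives,
  the differential equation) refer to this representative.\<close>

abbreviation Xnorm :: "(real \<Rightarrow> real) \<Rightarrow> real \<Rightarrow> (real \<Rightarrow> complex) \<Rightarrow> ennreal" where
  "Xnorm chi s f \<equiv> Xnorm_dist chi s (dist_of f)"

definition X :: "(real \<Rightarrow> real) \<Rightarrow> real \<Rightarrow> (real \<Rightarrow> complex) set" where
  "X chi s = {f. continuous_on UNIV f \<and> bounded (range f) \<and> dist_of f \<in> X_dist chi s}"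

definition C0_X :: "(real \<Rightarrow> real) \<Rightarrow> real \<Rightarrow> (real \<Rightarrow> real \<Rightarrow> complex) set" where
  "C0_X chi s = {q. (\<forall>t. q t \<in> X chi s) \<and>
     (\<forall>t. ((\<lambda>\<tau>. Xnorm chi s (\<lambda>x. q \<tau> x - q t x)) \<longlongrightarrow> 0) (at t))}"

definition C1_X :: "(real \<Rightarrow> real) \<Rightarrow> real \<Rightarrow> (real \<Rightarrow> real \<Rightarrow> complex) set" where
  "C1_X chi s = {q. (\<forall>t. q t \<in> X chi s) \<and> (\<exists>q' \<in> C0_X chi s. \<forall>t.
     ((\<lambda>\<tau>. Xnorm chi s (\<lambda>x. (q \<tau> x - q t x) /\<^sub>R (\<tau> - t) - q' t x)) \<longlongrightarrow> 0) (at t))}"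

definition dt :: "(real \<Rightarrow> real \<Rightarrow> complex) \<Rightarrow> real \<Rightarrow> real \<Rightarrow> complex" where
  "dt v t x = vector_derivative (\<lambda>\<tau>. v \<tau> x) (at t)"

definition classical_solution :: "real \<Rightarrow> (real \<Rightarrow> real \<Rightarrow> complex) \<Rightarrow> bool" where
  "classical_solution \<kappa> v \<longleftrightarrow>
     (\<forall>t x. (\<lambda>\<tau>. v \<tau> x) differentiable at t) \<and> (\<forall>t. v t \<in> Cn 2) \<and>
     continuous_on UNIV (\<lambda>(t, x). dt v t x) \<and>
     (\<forall>j\<le>2. continuous_on UNIV (\<lambda>(t, x). nderiv j (v t) x)) \<and>
     (\<forall>t x. \<i> * dt v t x =
        - (1 / 2) * nderiv 2 (v t) x + of_real (\<kappa> * (norm (v t x))\<^sup>2) * v t x)"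

definition strip_bounded :: "(real \<Rightarrow> real \<Rightarrow> complex) \<Rightarrow> bool" where
  "strip_bounded w \<longleftrightarrow> (\<forall>T. bounded ((\<lambda>(t, x). w t x) ` ({-T..T} \<times> UNIV)))"

definition nls_flow ::
    "(real \<Rightarrow> real) \<Rightarrow> real \<Rightarrow> (real \<Rightarrow> (real \<Rightarrow> complex) \<Rightarrow> real \<Rightarrow> complex) \<Rightarrow> bool" where
  "nls_flow chi \<kappa> \<Phi> \<longleftrightarrow> (\<forall>q0 \<in> X chi 5.
     classical_solution \<kappa> (\<lambda>t. \<Phi> t q0) \<and>
     (\<lambda>t. \<Phi> t q0) \<in> C0_X chi 5 \<inter> C1_X chi 3 \<and>
     \<Phi> 0 q0 = q0 \<and>
     (\<forall>v. classical_solution \<kappa> v \<and> strip_bounded v \<and> strip_bounded (\<lambda>t. nderiv 1 (v t)) \<and>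
        v 0 = q0 \<longrightarrow> (\<forall>t. v t = \<Phi> t q0)))"

definition translate :: "real \<Rightarrow> (real \<Rightarrow> complex) \<Rightarrow> real \<Rightarrow> complex" where
  "translate y f = (\<lambda>x. f (x + y))"

definition Hloc :: "(real \<Rightarrow> complex) \<Rightarrow> (real \<Rightarrow> complex) set" where
  "Hloc f = Cn_loc 4 closure_of range (\<lambda>y. translate y f)"

end

theory Submission
  imports Defs "HOL-Probability.Sinc_Integral" "HOL-Probability.Characteristic_Functions"
    "HOL-Real_Asymp.Real_Asymp" "HOL-Complex_Analysis.Great_Picard" "HOL-Library.Diagonal_Subsequence"
begin

text \<open>
  The pieces \<open>\<box>\<^sub>k f\<close> are convolutions with Schwartz kernels. They commute with translations, so the
  norm is translation invariant and lower semicontinuous under bounded pointwise limits, and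
  Bernstein's inequality bounds five derivatives of \<open>f\<close> by the norm. No well-posedness estimate is
  needed for the continuity of the flow: the translates of a single space-time solution are
  precompact, a locally uniform limit of them is again a bounded classical solution, and by
  uniqueness it is the flow of its initial value. Hence \<open>\<T>\<^bsub>y\<^esub> f \<rightarrow> g\<close> along a sequence of \<open>y\<close>
  implies \<open>\<T>\<^bsub>y\<^esub> (\<Phi>\<^sub>t f) \<rightarrow> \<Phi>\<^sub>t g\<close> along the same sequence. This gives the continuity of \<open>\<Phi>\<^sub>t\<close> on the
  hull, and \<open>\<Phi>\<^bsub>-t\<^esub>\<close> is its inverse.
\<close>

section \<open>Iterated derivatives\<close>

text \<open>The weight 5 is spent exactly once. Bernstein's inequality costs a factor 1 + |k| per
  derivative, so five derivatives are bounded; the fifth is used up as a Lipschitz constant for the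
  fourth, which gives the equicontinuity in x behind precompactness in C^4_loc. Equicontinuity in
  time comes from applying the same embedding to a difference of two time slices: continuity in X_5
  becomes continuity of the derivatives uniformly in x, hence uniformly over all translates. Two
  obstacles shape the rest. The norm is an infimum over representatives of a distribution, and it
  has to become a supremum of continuous functions before translations and limits can act on it. And
  the hull contains points that are not translates: a sequence in it is handled by replacing each
  point, together with its image under the flow, by one and the same translation of \<open>f\<close>
  and of \<open>\<Phi> t f\<close>. Choosing such approximants with errors tending to 0 is what
  calls for a metric inducing C^4_loc.\<close>

lemma nderiv_0 [simp]: "nderiv 0 f = f"
  by (simp add: nderiv_def)

lemma nderiv_Suc: "nderiv (Suc n) f = (\<lambda>x. vector_derivative (nderiv n f) (at x))"
  by (simp add: nderiv_def)

text \<open>\<open>nderiv\<close> iterates \<open>vector_derivative\<close>, which is meaningful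
  only where a derivative exists. Derivatives are therefore computed by exhibiting a whole family
  \<open>F\<close> of candidates, which uniqueness of derivatives identifies order by order.\<close>

lemma nderiv_eqI:
  assumes "F 0 = f" and "\<And>j x. j < n \<Longrightarrow> (F j has_vector_derivative F (Suc j) x) (at x)" and "j \<le> n"
  shows "nderiv j f = F j"
  using assms(3)
proof (induction j)
  case (Suc j)
  then have "nderiv j f = F j" "j < n"
    by auto
  then show ?case
    using vector_derivative_at[OF assms(2)[of j]] by (simp add: nderiv_Suc)
qed (simp add: assms)

lemma CnI:
  assumes "F 0 = f" and "\<And>j x. j < n \<Longrightarrow> (F j has_vector_derivative F (Suc j) x) (at x)"
    and "continuous_on UNIV (F n)"
  shows "f \<in> Cn n"
proof -
  have "nderiv j f = F j" if "j \<le> n" for j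
    using nderiv_eqI[OF assms(1,2)] that by blast
  then show ?thesis
    using assms(2,3) unfolding Cn_def by (auto intro: differentiableI_vector)
qed

lemma Cn_has_vector_derivative:
  assumes "f \<in> Cn n" "j < n"
  shows "(nderiv j f has_vector_derivative nderiv (Suc j) f x) (at x)"
  using assms unfolding Cn_def nderiv_Suc by (auto simp: vector_derivative_works[symmetric])

lemma Cn_continuous_on:
  assumes "f \<in> Cn n" "j \<le> n"
  shows "continuous_on A (nderiv j f)"
proof -
  have "continuous_on UNIV (nderiv j f)"
  proof (cases "j = n")
    case False
    then show ?thesis
      using assms Cn_has_vector_derivative[OF assms(1), of j]
      by (auto intro!: continuous_at_imp_continuous_on intro: has_vector_derivative_continuous)
  qed (use assms in \<open>auto simp: Cn_def\<close>)
  then show ?thesis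
    using continuous_on_subset by blast
qed

lemma Cn_mono: "f \<in> Cn n \<Longrightarrow> m \<le> n \<Longrightarrow> f \<in> Cn m"
  using Cn_continuous_on[of f n m UNIV] by (auto simp: Cn_def)

lemma Cn_SucI:
  assumes "\<And>x. (f has_vector_derivative f' x) (at x)" "f' \<in> Cn n"
  shows "f \<in> Cn (Suc n)"
proof (rule CnI[where F = "\<lambda>j. case j of 0 \<Rightarrow> f | Suc i \<Rightarrow> nderiv i f'"])
  show "((case j of 0 \<Rightarrow> f | Suc i \<Rightarrow> nderiv i f') has_vector_derivative
      (case Suc j of 0 \<Rightarrow> f | Suc i \<Rightarrow> nderiv i f') x) (at x)" if "j < Suc n" for j x
    using that assms by (cases j) (auto intro: Cn_has_vector_derivative)
qed (use assms(2) in \<open>auto intro: Cn_continuous_on\<close>)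

lemma Cn_SucD:
  assumes "f \<in> Cn (Suc n)"
  shows "nderiv (Suc 0) f \<in> Cn n"
proof (rule CnI[where F = "\<lambda>j. nderiv (Suc j) f"])
qed (use assms in \<open>auto intro: Cn_has_vector_derivative Cn_continuous_on\<close>)

lemma smoothI:
  assumes "F 0 = f" "\<And>j x. (F j has_vector_derivative F (Suc j) x) (at x)"
  shows "smooth f" "nderiv j f = F j"
proof -
  have "continuous_on UNIV (F n)" for n
    using assms(2) by (meson continuous_at_imp_continuous_on has_vector_derivative_continuous)
  then show "smooth f"
    unfolding smooth_def using CnI[OF assms(1,2)] by blast
  show "nderiv j f = F j"
    by (rule nderiv_eqI[OF assms(1,2) order_refl])
qed

lemma smooth_has_vector_derivative:
  "smooth f \<Longrightarrow> (nderiv j f has_vector_derivative nderiv (Suc j) f x) (at x)"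
  unfolding smooth_def using Cn_has_vector_derivative by blast

lemma smooth_continuous_on: "smooth f \<Longrightarrow> continuous_on A (nderiv j f)"
  unfolding smooth_def using Cn_continuous_on by blast

lemma smooth_nderiv: "smooth f \<Longrightarrow> smooth (nderiv j f)" and
  nderiv_nderiv: "smooth f \<Longrightarrow> nderiv i (nderiv j f) = nderiv (i + j) f"
  using smoothI[of "\<lambda>i. nderiv (i + j) f" "nderiv j f"] smooth_has_vector_derivative[of f]
  by auto

lemma Cn_add:
  assumes "f \<in> Cn n" "g \<in> Cn n"
  shows "(\<lambda>x. f x + g x) \<in> Cn n"
    and "j \<le> n \<Longrightarrow> nderiv j (\<lambda>x. f x + g x) = (\<lambda>x. nderiv j f x + nderiv j g x)"
proof -
  let ?F = "\<lambda>j x. nderiv j f x + nderiv j g x"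
  have *: "(?F j has_vector_derivative ?F (Suc j) x) (at x)" if "j < n" for j x
    using assms that by (intro has_vector_derivative_add Cn_has_vector_derivative)
  show "(\<lambda>x. f x + g x) \<in> Cn n"
    by (rule CnI[where F = ?F]) (use * assms in \<open>auto intro!: continuous_intros Cn_continuous_on\<close>)
  show "nderiv j (\<lambda>x. f x + g x) = ?F j" if "j \<le> n"
    by (rule nderiv_eqI[where n = n]) (use * that in auto)
qed

lemma Cn_scaleR:
  assumes "f \<in> Cn n"
  shows "(\<lambda>x. c *\<^sub>R f x) \<in> Cn n"
    and "j \<le> n \<Longrightarrow> nderiv j (\<lambda>x. c *\<^sub>R f x) = (\<lambda>x. c *\<^sub>R nderiv j f x)"
proof -
  let ?F = "\<lambda>j x. c *\<^sub>R nderiv j f x"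
  have *: "(?F j has_vector_derivative ?F (Suc j) x) (at x)" if "j < n" for j x
    by (rule has_vector_derivative_eq_rhs)
      (use assms that in \<open>auto intro!: derivative_eq_intros Cn_has_vector_derivative\<close>)
  show "(\<lambda>x. c *\<^sub>R f x) \<in> Cn n"
    by (rule CnI[where F = ?F]) (use * assms in \<open>auto intro!: continuous_intros Cn_continuous_on\<close>)
  show "nderiv j (\<lambda>x. c *\<^sub>R f x) = ?F j" if "j \<le> n"
    by (rule nderiv_eqI[where n = n]) (use * that in auto)
qed

lemma Cn_diff:
  assumes "f \<in> Cn n" "g \<in> Cn n"
  shows "(\<lambda>x. f x - g x) \<in> Cn n"
    and "j \<le> n \<Longrightarrow> nderiv j (\<lambda>x. f x - g x) = (\<lambda>x. nderiv j f x - nderiv j g x)"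
  using Cn_add[OF assms(1) Cn_scaleR(1)[OF assms(2), of "-1"]]
    Cn_scaleR(2)[OF assms(2), where c = "-1"] by auto

lemma Cn_affine:
  assumes "f \<in> Cn n"
  shows "(\<lambda>x. f (a * x + b)) \<in> Cn n"
    and "j \<le> n \<Longrightarrow> nderiv j (\<lambda>x. f (a * x + b)) = (\<lambda>x. a ^ j *\<^sub>R nderiv j f (a * x + b))"
proof -
  let ?F = "\<lambda>j x. a ^ j *\<^sub>R nderiv j f (a * x + b)"
  have *: "(?F j has_vector_derivative ?F (Suc j) x) (at x)" if "j < n" for j x
  proof -
    have "((\<lambda>x. a * x + b) has_vector_derivative a) (at x)"
      by (auto intro!: derivative_eq_intros simp: has_real_derivative_iff_has_vector_derivative[symmetric])
    from vector_diff_chain_at[OF this Cn_has_vector_derivative[OF assms that]]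
    have "((\<lambda>x. nderiv j f (a * x + b)) has_vector_derivative a *\<^sub>R nderiv (Suc j) f (a * x + b)) (at x)"
      by (simp add: o_def)
    then have "(?F j has_vector_derivative a ^ j *\<^sub>R (a *\<^sub>R nderiv (Suc j) f (a * x + b))) (at x)"
      by (auto intro!: derivative_eq_intros)
    then show ?thesis
      by (simp add: mult.commute)
  qed
  show "(\<lambda>x. f (a * x + b)) \<in> Cn n"
    by (rule CnI[where F = ?F])
      (use * assms in \<open>auto intro!: continuous_intros continuous_on_compose2[OF Cn_continuous_on[OF assms, of _ UNIV]]\<close>)
  show "nderiv j (\<lambda>x. f (a * x + b)) = ?F j" if "j \<le> n"
    by (rule nderiv_eqI[where n = n]) (use * that in auto)
qed

lemma Cn_translate:
  assumes "f \<in> Cn n"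
  shows "translate y f \<in> Cn n" and "j \<le> n \<Longrightarrow> nderiv j (translate y f) = translate y (nderiv j f)"
  using Cn_affine(1)[OF assms, of 1 y] Cn_affine(2)[OF assms, of j 1 y] by (auto simp: translate_def)

text \<open>Induction on the order through f g' + f' g gives membership without the binomial form of
  Leibniz's rule.\<close>

lemma Cn_mult:
  fixes f g :: "real \<Rightarrow> 'a::real_normed_algebra"
  shows "f \<in> Cn n \<Longrightarrow> g \<in> Cn n \<Longrightarrow> (\<lambda>x. f x * g x) \<in> Cn n"
proof (induction n arbitrary: f g)
  case 0
  then show ?case
    by (auto simp: Cn_def intro!: continuous_intros)
next
  case (Suc n)
  show ?case
  proof (rule Cn_SucI)
    show "((\<lambda>x. f x * g x) has_vector_derivative f x * nderiv (Suc 0) g x + nderiv (Suc 0) f x * g x) (at x)" for x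
      using Suc.prems Cn_has_vector_derivative[of f "Suc n" 0 x] Cn_has_vector_derivative[of g "Suc n" 0 x]
      by (auto intro!: derivative_intros)
    show "(\<lambda>x. f x * nderiv (Suc 0) g x + nderiv (Suc 0) f x * g x) \<in> Cn n"
      using Suc.prems by (intro Cn_add(1) Suc.IH) (auto intro: Cn_SucD Cn_mono)
  qed
qed

lemma smooth_add: "smooth f \<Longrightarrow> smooth g \<Longrightarrow> smooth (\<lambda>x. f x + g x)"
  and smooth_mult: "smooth f1 \<Longrightarrow> smooth g1 \<Longrightarrow> smooth (\<lambda>x. f1 x * g1 x :: 'a::real_normed_algebra)"
  and smooth_affine: "smooth f \<Longrightarrow> smooth (\<lambda>x. f (a * x + b))"
  by (auto simp: smooth_def intro: Cn_add(1) Cn_mult Cn_affine(1))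

lemma smooth_of_real:
  fixes f :: "real \<Rightarrow> real"
  assumes "smooth f"
  shows "smooth (\<lambda>x. of_real (f x) :: 'a::{real_normed_algebra_1})"
proof (rule smoothI(1)[where F = "\<lambda>j x. of_real (nderiv j f x)"])
  show "((\<lambda>x. of_real (nderiv j f x)) has_vector_derivative (of_real (nderiv (Suc j) f x) :: 'a)) (at x)" for j x
    using smooth_has_vector_derivative[OF assms, of j x]
    by (intro has_vector_derivative_of_real)
      (simp add: has_real_derivative_iff_has_vector_derivative)
qed simp

text \<open>\<open>has_derivative_sequence\<close> yields an unnamed limit function on one compact
  interval; uniqueness of pointwise limits identifies it with \<open>g\<close> there. Uniform
  convergence is asked of the derivatives alone, on compact intervals.\<close>

lemma has_vector_derivative_sequential_limit:
  fixes f :: "nat \<Rightarrow> real \<Rightarrow> 'a::banach"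
  assumes f: "\<And>n x. (f n has_vector_derivative f' n x) (at x)"
    and g: "\<And>x. (\<lambda>n. f n x) \<longlonglongrightarrow> g x"
    and u: "\<And>r. uniform_limit {-r..r} f' g' sequentially"
  shows "(g has_vector_derivative g' x) (at x)"
proof -
  \<comment> \<open>The extra 1 puts \<open>x\<close> in the interior, so that a derivative within
    the interval can be upgraded to a derivative at \<open>x\<close>.\<close>
  define r where "r = \<bar>x\<bar> + 1"
  have "\<exists>h. \<forall>x\<in>{-r..r}. (\<lambda>n. f n x) \<longlonglongrightarrow> h x \<and>
      (h has_derivative (\<lambda>y. y *\<^sub>R g' x)) (at x within {-r..r})"
  proof (rule has_derivative_sequence)
    show "(f n has_derivative (\<lambda>y. y *\<^sub>R f' n x)) (at x within {-r..r})" for n x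
      using f[of n x] by (auto simp: has_vector_derivative_def intro: has_derivative_at_withinI)
    show "\<forall>\<^sub>F n in sequentially. \<forall>x\<in>{-r..r}. \<forall>h. norm (h *\<^sub>R f' n x - h *\<^sub>R g' x) \<le> e * norm h"
      if "e > 0" for e
      using uniform_limitD[OF u[of r] that]
    proof eventually_elim
      case (elim n)
      show ?case
      proof (intro ballI allI)
        fix x h assume "x \<in> {-r..r}"
        then have "norm (f' n x - g' x) \<le> e"
          using elim by (auto simp: dist_norm less_imp_le)
        then show "norm (h *\<^sub>R f' n x - h *\<^sub>R g' x) \<le> e * norm h"
          by (metis mult.commute mult_left_mono norm_ge_zero norm_scaleR real_norm_def scaleR_right_diff_distrib)
      qed
    qed
    show "x \<in> {-r..r}" "(\<lambda>n. f n x) \<longlonglongrightarrow> g x"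
      using g by (auto simp: r_def)
  qed auto
  then obtain h where h: "\<And>x. x \<in> {-r..r} \<Longrightarrow> (\<lambda>n. f n x) \<longlonglongrightarrow> h x"
    "\<And>x. x \<in> {-r..r} \<Longrightarrow> (h has_derivative (\<lambda>y. y *\<^sub>R g' x)) (at x within {-r..r})"
    by blast
  have x: "x \<in> {-r<..<r}"
    by (auto simp: r_def)
  have "(h has_derivative (\<lambda>y. y *\<^sub>R g' x)) (at x within {-r<..<r})"
    using h(2)[of x] x by (auto intro: has_derivative_subset)
  then have "(h has_derivative (\<lambda>y. y *\<^sub>R g' x)) (at x)"
    using x by (simp add: at_within_open[OF x])
  then have "(g has_derivative (\<lambda>y. y *\<^sub>R g' x)) (at x)"
  proof (rule has_derivative_transform_within_open[where s = "{-r<..<r}"])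
    show "h y = g y" if "y \<in> {-r<..<r}" for y
      using LIMSEQ_unique[OF h(1) g, of y] that by auto
  qed (use x in auto)
  then show ?thesis
    by (simp add: has_vector_derivative_def)
qed

text \<open>Serves twice: for the partial sums of the frequency pieces and for the translates of a
  solution. The second conclusion identifies limits found separately for each order as the
  derivatives of one function.\<close>

lemma Cn_sequential_limit:
  fixes f :: "nat \<Rightarrow> real \<Rightarrow> 'a::banach"
  assumes f: "\<And>k. f k \<in> Cn n"
    and u: "\<And>j r. j \<le> n \<Longrightarrow> uniform_limit {-r..r} (\<lambda>k. nderiv j (f k)) (G j) sequentially"
  shows "G 0 \<in> Cn n" and "j \<le> n \<Longrightarrow> nderiv j (G 0) = G j"
proof -
  have "(G j has_vector_derivative G (Suc j) x) (at x)" if "j < n" for j x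
  proof (rule has_vector_derivative_sequential_limit)
    show "(nderiv j (f k) has_vector_derivative nderiv (Suc j) (f k) x) (at x)" for k x
      using Cn_has_vector_derivative[OF f that] .
    show "(\<lambda>k. nderiv j (f k) x) \<longlonglongrightarrow> G j x" for x
      using tendsto_uniform_limitI[OF u[of j "\<bar>x\<bar>"], of x] that abs_le_iff[of x "\<bar>x\<bar>"] by auto
    show "uniform_limit {-r..r} (\<lambda>k. nderiv (Suc j) (f k)) (G (Suc j)) sequentially" for r
      using u that by auto
  qed
  moreover have "continuous_on UNIV (G n)"
  proof (rule continuous_at_imp_continuous_on, rule ballI)
    fix x
    have "continuous_on {-(\<bar>x\<bar>+1)..\<bar>x\<bar>+1} (G n)"
      by (rule uniform_limit_theorem[OF _ u]) (auto intro!: always_eventually Cn_continuous_on[OF f])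
    then show "isCont (G n) x"
      by (rule continuous_on_interior) auto
  qed
  ultimately show "G 0 \<in> Cn n" "j \<le> n \<Longrightarrow> nderiv j (G 0) = G j"
    using CnI[of G "G 0" n] nderiv_eqI[of G "G 0" n] by auto
qed

section \<open>Schwartz functions\<close>

lemma schwartz_smooth: "\<phi> \<in> schwartz \<Longrightarrow> smooth \<phi>"
  by (simp add: schwartz_def)

lemma schwartz_bounded:
  assumes "\<phi> \<in> schwartz"
  obtains B where "\<And>x. \<bar>x\<bar> ^ m * norm (nderiv k \<phi> x) \<le> B" "0 \<le> B"
proof -
  have "bounded (range (\<lambda>x. x ^ m *\<^sub>R nderiv k \<phi> x))"
    using assms by (auto simp: schwartz_def)
  then obtain B where "\<And>x. norm (x ^ m *\<^sub>R nderiv k \<phi> x) \<le> B" "0 < B"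
    by (auto simp: bounded_pos)
  then show ?thesis
    using that[of B] by (auto simp: norm_mult norm_power power_abs less_imp_le)
qed

lemma schwartzI:
  assumes "smooth \<phi>" "\<And>m k. \<exists>B. \<forall>x. \<bar>x\<bar> ^ m * norm (nderiv k \<phi> x) \<le> B"
  shows "\<phi> \<in> schwartz"
  using assms unfolding schwartz_def bounded_iff by (simp add: power_abs)

lemma schwartz_nderiv:
  assumes "\<phi> \<in> schwartz"
  shows "nderiv j \<phi> \<in> schwartz"
proof (rule schwartzI)
  have s: "smooth \<phi>"
    using assms by (rule schwartz_smooth)
  then show "smooth (nderiv j \<phi>)"
    by (rule smooth_nderiv)
  fix m k
  obtain B where "\<And>x. \<bar>x\<bar> ^ m * norm (nderiv (k + j) \<phi> x) \<le> B" "0 \<le> B"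
    by (rule schwartz_bounded[OF assms, of m "k + j"]) blast
  then show "\<exists>B. \<forall>x. \<bar>x\<bar> ^ m * norm (nderiv k (nderiv j \<phi>) x) \<le> B"
    by (auto simp: nderiv_nderiv s)
qed

lemma schwartz_add:
  assumes "\<phi> \<in> schwartz" "\<psi> \<in> schwartz"
  shows "(\<lambda>x. \<phi> x + \<psi> x) \<in> schwartz"
proof (rule schwartzI)
  have s: "smooth \<phi>" "smooth \<psi>"
    using assms by (auto intro: schwartz_smooth)
  then show "smooth (\<lambda>x. \<phi> x + \<psi> x)"
    by (rule smooth_add)
  fix m k
  have k: "nderiv k (\<lambda>x. \<phi> x + \<psi> x) = (\<lambda>x. nderiv k \<phi> x + nderiv k \<psi> x)"
    by (rule Cn_add(2)[where n = k]) (use s in \<open>auto simp: smooth_def\<close>)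
  obtain A where A: "\<And>x. \<bar>x\<bar> ^ m * norm (nderiv k \<phi> x) \<le> A"
    by (rule schwartz_bounded[OF assms(1), of m k]) blast
  obtain B where B: "\<And>x. \<bar>x\<bar> ^ m * norm (nderiv k \<psi> x) \<le> B"
    by (rule schwartz_bounded[OF assms(2), of m k]) blast
  have "\<bar>x\<bar> ^ m * norm (nderiv k (\<lambda>x. \<phi> x + \<psi> x) x) \<le> A + B" for x
  proof -
    have "\<bar>x\<bar> ^ m * norm (nderiv k \<phi> x + nderiv k \<psi> x)
        \<le> \<bar>x\<bar> ^ m * norm (nderiv k \<phi> x) + \<bar>x\<bar> ^ m * norm (nderiv k \<psi> x)"
      by (metis abs_ge_zero distrib_left mult_left_mono norm_triangle_ineq zero_le_power)
    then show ?thesis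
      using A[of x] B[of x] by (simp add: k)
  qed
  then show "\<exists>B. \<forall>x. \<bar>x\<bar> ^ m * norm (nderiv k (\<lambda>x. \<phi> x + \<psi> x) x) \<le> B"
    by blast
qed

lemma schwartz_cmult:
  assumes "\<phi> \<in> schwartz"
  shows "(\<lambda>x. c * \<phi> x) \<in> schwartz"
proof -
  have s: "smooth \<phi>"
    using assms by (rule schwartz_smooth)
  have d: "((\<lambda>x. c * nderiv j \<phi> x) has_vector_derivative c * nderiv (Suc j) \<phi> x) (at x)" for j x
    using smooth_has_vector_derivative[OF s] by (intro derivative_intros)
  show ?thesis
  proof (rule schwartzI)
    show "smooth (\<lambda>x. c * \<phi> x)"
      using smoothI(1)[of "\<lambda>j x. c * nderiv j \<phi> x" "\<lambda>x. c * \<phi> x"] d by simp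
    fix m k
    have k: "nderiv k (\<lambda>x. c * \<phi> x) = (\<lambda>x. c * nderiv k \<phi> x)"
      using smoothI(2)[of "\<lambda>j x. c * nderiv j \<phi> x" "\<lambda>x. c * \<phi> x"] d by simp
    obtain A where A: "\<And>x. \<bar>x\<bar> ^ m * norm (nderiv k \<phi> x) \<le> A"
      by (rule schwartz_bounded[OF assms, of m k]) blast
    have "\<bar>x\<bar> ^ m * norm (nderiv k (\<lambda>x. c * \<phi> x) x) \<le> norm c * A" for x
      using mult_left_mono[OF A[of x], of "norm c"] by (simp add: k norm_mult mult.left_commute)
    then show "\<exists>B. \<forall>x. \<bar>x\<bar> ^ m * norm (nderiv k (\<lambda>x. c * \<phi> x) x) \<le> B"
      by blast
  qed
qed

lemma schwartz_mult_ident: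
  assumes "\<phi> \<in> schwartz"
  shows "(\<lambda>x. of_real x * \<phi> x) \<in> schwartz"
proof -
  have s: "smooth \<phi>"
    using assms by (rule schwartz_smooth)
  \<comment> \<open>Leibniz's rule stops after two terms because the second derivative of x
    vanishes. For j = 0 the truncated index \<open>j - 1\<close> is harmless, its coefficient being
    0.\<close>
  let ?F = "\<lambda>j x. of_real x * nderiv j \<phi> x + of_nat j * nderiv (j - 1) \<phi> x"
  have d: "(?F j has_vector_derivative ?F (Suc j) x) (at x)" for j x
  proof -
    have 1: "((\<lambda>x. of_real x * nderiv j \<phi> x) has_vector_derivative
        of_real x * nderiv (Suc j) \<phi> x + of_real 1 * nderiv j \<phi> x) (at x)"
      by (intro has_vector_derivative_mult smooth_has_vector_derivative[OF s]
          has_vector_derivative_of_real derivative_intros)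
    have 2: "((\<lambda>x. of_nat j * nderiv (j - 1) \<phi> x) has_vector_derivative
        of_nat j * nderiv (Suc (j - 1)) \<phi> x) (at x)"
      by (intro derivative_intros smooth_has_vector_derivative[OF s])
    from has_vector_derivative_add[OF 1 2]
    show ?thesis
      by (cases j) (auto simp: algebra_simps)
  qed
  show ?thesis
  proof (rule schwartzI)
    show "smooth (\<lambda>x. of_real x * \<phi> x)"
      using smoothI(1)[of ?F "\<lambda>x. of_real x * \<phi> x"] d by simp
    fix m k
    have k: "nderiv k (\<lambda>x. of_real x * \<phi> x) = ?F k"
      using smoothI(2)[of ?F "\<lambda>x. of_real x * \<phi> x"] d by simp
    obtain A where A: "\<And>x. \<bar>x\<bar> ^ Suc m * norm (nderiv k \<phi> x) \<le> A"
      by (rule schwartz_bounded[OF assms, of "Suc m" k]) blast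
    obtain B where B: "\<And>x. \<bar>x\<bar> ^ m * norm (nderiv (k - 1) \<phi> x) \<le> B"
      by (rule schwartz_bounded[OF assms, of m "k - 1"]) blast
    have "\<bar>x\<bar> ^ m * norm (?F k x) \<le> A + real k * B" for x
    proof -
      have "\<bar>x\<bar> ^ m * norm (?F k x)
          \<le> \<bar>x\<bar> ^ m * (norm (of_real x * nderiv k \<phi> x) + norm (of_nat k * nderiv (k - 1) \<phi> x))"
        by (intro mult_left_mono norm_triangle_ineq) auto
      also have "\<dots> = \<bar>x\<bar> ^ Suc m * norm (nderiv k \<phi> x) + real k * (\<bar>x\<bar> ^ m * norm (nderiv (k - 1) \<phi> x))"
        by (simp add: norm_mult algebra_simps)
      also have "\<dots> \<le> A + real k * B"
        using A[of x] B[of x] by (intro add_mono mult_left_mono) auto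
      finally show ?thesis .
    qed
    then show "\<exists>B. \<forall>x. \<bar>x\<bar> ^ m * norm (nderiv k (\<lambda>x. of_real x * \<phi> x) x) \<le> B"
      unfolding k by blast
  qed
qed

lemma schwartz_mult_power:
  "\<phi> \<in> schwartz \<Longrightarrow> (\<lambda>x. (c * of_real x) ^ n * \<phi> x) \<in> schwartz"
proof (induction n)
  case (Suc n)
  then have "(\<lambda>x. c * (of_real x * ((c * of_real x) ^ n * \<phi> x))) \<in> schwartz"
    by (intro schwartz_cmult schwartz_mult_ident) auto
  then show ?case
    by (simp add: mult.assoc)
qed simp

lemma nderiv_zero_outside:
  assumes "\<And>x. x \<notin> {-r..r} \<Longrightarrow> f x = 0" and "x \<notin> {-r..r}"
  shows "nderiv k f x = 0"
  using assms(2)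
proof (induction k arbitrary: x)
  case (Suc k)
  have "open (- {-r..r})"
    by auto
  then have "((nderiv k f) has_vector_derivative 0) (at x)"
    using Suc has_vector_derivative_transform_within_open[of "\<lambda>_. 0" 0 x "- {-r..r}" "nderiv k f"]
    by auto
  then show ?case
    by (simp add: nderiv_Suc vector_derivative_at)
qed (use assms in auto)

lemma schwartz_compact_support:
  assumes "smooth \<phi>" and supp: "\<And>x. x \<notin> {-r..r} \<Longrightarrow> \<phi> x = 0"
  shows "\<phi> \<in> schwartz"
proof (rule schwartzI)
  fix m k
  have "compact ((\<lambda>x. \<bar>x\<bar> ^ m * norm (nderiv k \<phi> x)) ` {-r..r})"
  proof (rule compact_continuous_image)
    have "continuous_on {-r..r} (nderiv k \<phi>)"
      using assms(1) by (rule smooth_continuous_on)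
    then show "continuous_on {-r..r} (\<lambda>x. \<bar>x\<bar> ^ m * norm (nderiv k \<phi> x))"
      by (intro continuous_intros)
  qed simp
  then have "bounded ((\<lambda>x. \<bar>x\<bar> ^ m * norm (nderiv k \<phi> x)) ` {-r..r})"
    by (rule compact_imp_bounded)
  then obtain B where "\<forall>x\<in>{-r..r}. norm (\<bar>x\<bar> ^ m * norm (nderiv k \<phi> x)) \<le> B" "0 < B"
    unfolding bounded_pos ball_simps by blast
  then have B: "\<And>x. x \<in> {-r..r} \<Longrightarrow> norm (\<bar>x\<bar> ^ m * norm (nderiv k \<phi> x)) \<le> B" "0 < B"
    by blast+
  have "\<bar>x\<bar> ^ m * norm (nderiv k \<phi> x) \<le> B" for x
  proof (cases "x \<in> {-r..r}")
    case True
    then show ?thesis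
      using B(1)[OF True] by auto
  next
    case False
    then show ?thesis
      using nderiv_zero_outside[OF supp, where r = r] B(2) by simp
  qed
  then show "\<exists>B. \<forall>x. \<bar>x\<bar> ^ m * norm (nderiv k \<phi> x) \<le> B"
    by blast
qed fact

text \<open>The function 1 / (1 + x^2) is the standard integrable majorant below, for integrability,
  for vanishing at infinity and for differentiating convolutions.\<close>

lemma schwartz_decay:
  assumes "\<phi> \<in> schwartz"
  shows "\<exists>C\<ge>0. \<forall>x. norm (\<phi> x) \<le> C / (1 + x\<^sup>2)"
proof -
  obtain A where A: "\<And>x. \<bar>x\<bar> ^ 0 * norm (nderiv 0 \<phi> x) \<le> A" "0 \<le> A"
    by (rule schwartz_bounded[OF assms, of 0 0]) blast
  obtain B where B: "\<And>x. \<bar>x\<bar> ^ 2 * norm (nderiv 0 \<phi> x) \<le> B" "0 \<le> B"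
    by (rule schwartz_bounded[OF assms, of 2 0]) blast
  have "norm (\<phi> x) \<le> (A + B) / (1 + x\<^sup>2)" for x
  proof -
    have "norm (\<phi> x) * (1 + x\<^sup>2) \<le> A + B"
      using A(1)[of x] B(1)[of x] by (simp add: algebra_simps)
    moreover have "1 + x\<^sup>2 > 0"
      by (rule add_pos_nonneg) auto
    ultimately show ?thesis
      by (simp add: pos_le_divide_eq)
  qed
  then show ?thesis
    using A(2) B(2) by (intro exI[of _ "A + B"]) auto
qed

lemma integrable_1_over_1_plus_square: "integrable lborel (\<lambda>x::real. 1 / (1 + x\<^sup>2))"
  using Sinc_Integral.integrable_inverse_1_plus_square
  by (simp add: set_integrable_def einterval_def inverse_eq_divide)

lemma schwartz_continuous_on: "\<phi> \<in> schwartz \<Longrightarrow> continuous_on A \<phi>"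
  using smooth_continuous_on[of \<phi> A 0] by (simp add: schwartz_smooth)

lemma schwartz_measurable [measurable_dest]: "\<phi> \<in> schwartz \<Longrightarrow> \<phi> \<in> borel_measurable borel"
  by (intro borel_measurable_continuous_onI schwartz_continuous_on)

lemma schwartz_integrable:
  assumes "\<phi> \<in> schwartz"
  shows "integrable lborel \<phi>"
proof -
  obtain C where C: "\<And>x. norm (\<phi> x) \<le> C / (1 + x\<^sup>2)" "0 \<le> C"
    using schwartz_decay[OF assms] by auto
  show ?thesis
  proof (rule Bochner_Integration.integrable_bound)
    show "integrable lborel (\<lambda>x. C * (1 / (1 + x\<^sup>2)))"
      by (intro integrable_mult_right integrable_1_over_1_plus_square)
    show "AE x in lborel. norm (\<phi> x) \<le> norm (C * (1 / (1 + x\<^sup>2)))"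
    proof (rule AE_I2)
      fix x :: real
      have "norm (\<phi> x) \<le> C * (1 / (1 + x\<^sup>2))"
        using C(1)[of x] by simp
      also have "\<dots> \<le> norm (C * (1 / (1 + x\<^sup>2)))"
        unfolding real_norm_def by (rule abs_ge_self)
      finally show "norm (\<phi> x) \<le> norm (C * (1 / (1 + x\<^sup>2)))" .
    qed
    show "\<phi> \<in> borel_measurable lborel"
      using schwartz_measurable[OF assms] by simp
  qed
qed

section \<open>The Fourier transform\<close>

text \<open>Dominated convergence for difference quotients: the mean value inequality bounds each
  quotient \<open>q h\<close> by the bound \<open>w\<close> on the derivative in t, which for this
  reason has to hold on a whole neighbourhood of \<open>t0\<close>.\<close>

lemma has_vector_derivative_integral:
  fixes f :: "real \<Rightarrow> 'a \<Rightarrow> 'b::{banach, second_countable_topology}"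
  assumes "0 < r"
    and f': "\<And>t x. dist t t0 < r \<Longrightarrow> ((\<lambda>t. f t x) has_vector_derivative f' t x) (at t)"
    and f: "\<And>t. dist t t0 < r \<Longrightarrow> integrable M (f t)"
    and w: "\<And>t x. dist t t0 < r \<Longrightarrow> norm (f' t x) \<le> w x" "integrable M w"
    and m: "f' t0 \<in> borel_measurable M"
  shows "((\<lambda>t. LINT x|M. f t x) has_vector_derivative (LINT x|M. f' t0 x)) (at t0)"
proof -
  define q where "q h x = (f (t0 + h) x - f t0 x) /\<^sub>R h" for h x
  let ?F = "\<lambda>t. LINT x|M. f t x"
  let ?D = "LINT x|M. f' t0 x"
  have f0: "integrable M (f t0)"
    using f[of t0] \<open>0 < r\<close> by simp
  have q_integral: "(LINT x|M. q h x) = (?F (t0 + h) - ?F t0) /\<^sub>R h" if "\<bar>h\<bar> < r" for h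
    unfolding q_def using f[of "t0 + h"] f0 that
    by (simp add: dist_real_def)
  have q_bound: "norm (q h x) \<le> w x" if "h \<noteq> 0" "\<bar>h\<bar> < r" for h x
  proof -
    have "norm (f (t0 + h) x - f t0 x) \<le> w x * norm (t0 + h - t0)"
    proof (rule differentiable_bound[where S = "ball t0 r" and f = "\<lambda>t. f t x" and f' = "\<lambda>t y. y *\<^sub>R f' t x"])
      fix t assume t: "t \<in> ball t0 r"
      then have t': "dist t t0 < r"
        by (simp add: dist_commute)
      show "((\<lambda>t. f t x) has_derivative (\<lambda>y. y *\<^sub>R f' t x)) (at t within ball t0 r)"
        using f'[OF t'] unfolding has_vector_derivative_def by (rule has_derivative_at_withinI)
      have "onorm (\<lambda>y. y *\<^sub>R f' t x) = norm (f' t x)"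
        using onorm_scaleR_left[of "\<lambda>y. y" "f' t x"] by (simp add: onorm_id)
      then show "onorm (\<lambda>y. y *\<^sub>R f' t x) \<le> w x"
        using w(1)[OF t'] by simp
    qed (use that \<open>0 < r\<close> in \<open>auto simp: dist_real_def\<close>)
    moreover have "norm (q h x) = norm (f (t0 + h) x - f t0 x) / \<bar>h\<bar>"
      by (simp add: q_def divide_inverse mult.commute)
    ultimately show ?thesis
      using that by (simp add: pos_divide_le_eq)
  qed
  have q_lim: "((\<lambda>h. q h x) \<longlongrightarrow> f' t0 x) (at 0)" for x
  proof -
    have "((\<lambda>h. norm ((f (t0 + h) x - f t0 x) - h *\<^sub>R f' t0 x) / norm h) \<longlongrightarrow> 0) (at 0)"
      using f'[of t0 x] \<open>0 < r\<close> by (simp add: has_vector_derivative_def has_derivative_at)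
    then have "((\<lambda>h. norm (q h x - f' t0 x)) \<longlongrightarrow> 0) (at 0)"
    proof (rule Lim_transform_eventually)
      show "\<forall>\<^sub>F h in at 0. norm ((f (t0 + h) x - f t0 x) - h *\<^sub>R f' t0 x) / norm h = norm (q h x - f' t0 x)"
      proof (rule eventually_at_filter[THEN iffD2], rule always_eventually, safe)
        fix h :: real assume "h \<noteq> 0"
        then have "(f (t0 + h) x - f t0 x) - h *\<^sub>R f' t0 x = h *\<^sub>R (q h x - f' t0 x)"
          by (simp add: q_def scaleR_right_diff_distrib)
        then show "norm ((f (t0 + h) x - f t0 x) - h *\<^sub>R f' t0 x) / norm h = norm (q h x - f' t0 x)"
          using \<open>h \<noteq> 0\<close> by simp
      qed
    qed
    then show ?thesis
      using Lim_null tendsto_norm_zero_iff by blast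
  qed
  have "((\<lambda>h. (?F (t0 + h) - ?F t0) /\<^sub>R h) \<longlongrightarrow> ?D) (at 0)"
    unfolding tendsto_at_iff_sequentially comp_def
  proof (intro allI impI)
    fix X :: "nat \<Rightarrow> real" assume X: "\<forall>i. X i \<in> UNIV - {0}" "X \<longlonglongrightarrow> 0"
    \<comment> \<open>Only steps shorter than \<open>r\<close> are controlled, so a finite initial
      part of the sequence is discarded.\<close>
    obtain N where N: "\<bar>X n\<bar> < r" if "n \<ge> N" for n
      using LIMSEQ_D[OF X(2) \<open>0 < r\<close>] by auto
    have "(\<lambda>n. LINT x|M. q (X (n + N)) x) \<longlonglongrightarrow> ?D"
    proof (rule integral_dominated_convergence[where w = w])
      show "q (X (n + N)) \<in> borel_measurable M" for n
        unfolding q_def using f[of "t0 + X (n + N)"] f0 N[of "n + N"]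
        by (auto simp: dist_real_def intro!: borel_measurable_scaleR borel_measurable_diff)
      show "AE x in M. (\<lambda>n. q (X (n + N)) x) \<longlonglongrightarrow> f' t0 x"
      proof (rule AE_I2)
        fix x
        have "(\<lambda>n. q (X n) x) \<longlonglongrightarrow> f' t0 x"
          using q_lim[of x] X unfolding tendsto_at_iff_sequentially comp_def by blast
        then show "(\<lambda>n. q (X (n + N)) x) \<longlonglongrightarrow> f' t0 x"
          by (rule LIMSEQ_ignore_initial_segment)
      qed
      show "AE x in M. norm (q (X (n + N)) x) \<le> w x" for n
        using q_bound[of "X (n + N)"] X(1) N[of "n + N"] by auto
    qed (use w m in auto)
    then have "(\<lambda>n. (?F (t0 + X (n + N)) - ?F t0) /\<^sub>R X (n + N)) \<longlonglongrightarrow> ?D"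
      using q_integral N by simp
    then show "(\<lambda>n. (?F (t0 + X n) - ?F t0) /\<^sub>R X n) \<longlonglongrightarrow> ?D"
      by (rule LIMSEQ_offset)
  qed
  then have "((\<lambda>h. norm ((?F (t0 + h) - ?F t0) /\<^sub>R h - ?D)) \<longlongrightarrow> 0) (at 0)"
    using Lim_null tendsto_norm_zero by blast
  then have "((\<lambda>h. norm ((?F (t0 + h) - ?F t0) - h *\<^sub>R ?D) / norm h) \<longlongrightarrow> 0) (at 0)"
  proof (rule Lim_transform_eventually)
    show "\<forall>\<^sub>F h in at 0. norm ((?F (t0 + h) - ?F t0) /\<^sub>R h - ?D) = norm ((?F (t0 + h) - ?F t0) - h *\<^sub>R ?D) / norm h"
    proof (rule eventually_at_filter[THEN iffD2], rule always_eventually, safe)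
      fix h :: real assume "h \<noteq> 0"
      then have "(?F (t0 + h) - ?F t0) - h *\<^sub>R ?D = h *\<^sub>R ((?F (t0 + h) - ?F t0) /\<^sub>R h - ?D)"
        by (simp add: scaleR_right_diff_distrib)
      then show "norm ((?F (t0 + h) - ?F t0) /\<^sub>R h - ?D) = norm ((?F (t0 + h) - ?F t0) - h *\<^sub>R ?D) / norm h"
        using \<open>h \<noteq> 0\<close> by simp
    qed
  qed
  then show ?thesis
    unfolding has_vector_derivative_def has_derivative_at
    by (auto intro: bounded_linear_scaleR_left)
qed

text \<open>Integration by parts on the line, stated without a product. It will be applied to an
  exponential times a Schwartz function, whose boundary values vanish.\<close>

lemma integral_derivative_eq_0:
  fixes F f :: "real \<Rightarrow> complex"
  assumes F: "\<And>x. (F has_vector_derivative f x) (at x)" and f: "continuous_on UNIV f" "integrable lborel f"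
    and lim: "(F \<longlongrightarrow> 0) at_top" "(F \<longlongrightarrow> 0) at_bot"
  shows "(LINT x|lborel. f x) = 0"
proof -
  have U: "einterval (-\<infinity>) \<infinity> = UNIV"
    by (auto simp: einterval_def)
  have "(LBINT x=-\<infinity>..\<infinity>. f x) = 0 - 0"
  proof (rule interval_integral_FTC_integrable)
    show "isCont f x" for x
      using f(1) by (simp add: continuous_on_eq_continuous_at)
    show "set_integrable lborel (einterval (-\<infinity>) \<infinity>) f"
      using f(2) by (simp add: U set_integrable_def)
    show "((F \<circ> real_of_ereal) \<longlongrightarrow> 0) (at_right (-\<infinity>))"
      using lim(2) unfolding ereal_tendsto_simps .
    show "((F \<circ> real_of_ereal) \<longlongrightarrow> 0) (at_left \<infinity>)"
      using lim(1) unfolding ereal_tendsto_simps .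
  qed (use F in auto)
  then show ?thesis
    by (simp add: interval_lebesgue_integral_def set_lebesgue_integral_def U)
qed

lemma schwartz_tendsto_0:
  assumes "\<phi> \<in> schwartz"
  shows "(\<phi> \<longlongrightarrow> 0) at_top" "(\<phi> \<longlongrightarrow> 0) at_bot"
proof -
  obtain C where C: "\<And>x. norm (\<phi> x) \<le> C / (1 + x\<^sup>2)"
    using schwartz_decay[OF assms] by auto
  have "((\<lambda>x::real. C / (1 + x\<^sup>2)) \<longlongrightarrow> 0) at_top"
    by real_asymp
  then show "(\<phi> \<longlongrightarrow> 0) at_top"
    by (rule Lim_null_comparison[rotated]) (use C in auto)
  have "((\<lambda>x::real. C / (1 + x\<^sup>2)) \<longlongrightarrow> 0) at_bot"
    by real_asymp
  then show "(\<phi> \<longlongrightarrow> 0) at_bot"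
    by (rule Lim_null_comparison[rotated]) (use C in auto)
qed

text \<open>The sign parameter treats both transforms at once: \<open>s = -1\<close> is
  \<open>fourier\<close>, and \<open>s = 1\<close> is \<open>inv_fourier\<close> up to the factor 1
  / (2 pi).\<close>

definition FT :: "real \<Rightarrow> (real \<Rightarrow> complex) \<Rightarrow> real \<Rightarrow> complex" where
  "FT s \<phi> \<xi> = (LINT x|lborel. exp (\<i> * of_real (s * x * \<xi>)) * \<phi> x)"

lemma fourier_eq_FT: "fourier \<phi> = FT (-1) \<phi>"
  by (simp add: fourier_def FT_def fun_eq_iff)

lemma inv_fourier_eq_FT: "inv_fourier \<phi> = (\<lambda>x. of_real (1 / (2 * pi)) * FT 1 \<phi> x)"
  by (simp add: inv_fourier_def FT_def fun_eq_iff mult.commute)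

lemma integrable_exp_mult:
  fixes \<phi> :: "real \<Rightarrow> complex"
  assumes "integrable lborel \<phi>"
  shows "integrable lborel (\<lambda>x. exp (\<i> * of_real (s * x * \<xi>)) * \<phi> x)"
proof (rule Bochner_Integration.integrable_bound[OF assms])
  show "(\<lambda>x. exp (\<i> * of_real (s * x * \<xi>)) * \<phi> x) \<in> borel_measurable lborel"
    using assms by measurable
qed (simp add: norm_mult)

lemma FT_bound: "norm (FT s \<phi> \<xi>) \<le> (LINT x|lborel. norm (\<phi> x))"
proof -
  have "norm (FT s \<phi> \<xi>) \<le> (LINT x|lborel. norm (exp (\<i> * of_real (s * x * \<xi>)) * \<phi> x))"
    unfolding FT_def by (rule integral_norm_bound)
  then show ?thesis
    by (simp add: norm_mult)
qed

lemma FT_has_vector_derivative: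
  assumes \<phi>: "\<phi> \<in> schwartz"
  shows "(FT s \<phi> has_vector_derivative FT s (\<lambda>x. \<i> * of_real s * of_real x * \<phi> x) \<xi>) (at \<xi>)"
  unfolding FT_def
proof (rule has_vector_derivative_integral[where r = 1])
  have x\<phi>: "(\<lambda>x. \<i> * of_real s * of_real x * \<phi> x) \<in> schwartz"
    using schwartz_mult_power[OF \<phi>, of "\<i> * of_real s" 1] by simp
  show "((\<lambda>t. exp (\<i> * of_real (s * x * t)) * \<phi> x) has_vector_derivative
      exp (\<i> * of_real (s * x * t)) * (\<i> * of_real s * of_real x * \<phi> x)) (at t)" for t x
    by (auto intro!: derivative_eq_intros has_vector_derivative_real_field simp: algebra_simps)
  show "integrable lborel (\<lambda>x. exp (\<i> * of_real (s * x * t)) * \<phi> x)" for t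
    by (rule integrable_exp_mult[OF schwartz_integrable[OF \<phi>]])
  show "norm (exp (\<i> * of_real (s * x * t)) * (\<i> * of_real s * of_real x * \<phi> x))
      \<le> norm (\<i> * of_real s * of_real x * \<phi> x)" for t x
    by (simp add: norm_mult)
  show "integrable lborel (\<lambda>x. norm (\<i> * of_real s * of_real x * \<phi> x))"
    by (rule integrable_norm[OF schwartz_integrable[OF x\<phi>]])
  show "(\<lambda>x. exp (\<i> * of_real (s * x * \<xi>)) * (\<i> * of_real s * of_real x * \<phi> x)) \<in> borel_measurable lborel"
    by (rule borel_measurable_integrable[OF integrable_exp_mult[OF schwartz_integrable[OF x\<phi>]]])
qed simp

lemma FT_nderiv:
  assumes \<phi>: "\<phi> \<in> schwartz"
  shows "FT s (nderiv (Suc 0) \<phi>) \<xi> = - (\<i> * of_real (s * \<xi>)) * FT s \<phi> \<xi>"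
proof -
  let ?e = "\<lambda>x. exp (\<i> * of_real (s * x * \<xi>))"
  have d: "nderiv (Suc 0) \<phi> \<in> schwartz"
    using \<phi> by (rule schwartz_nderiv)
  have i: "integrable lborel (\<lambda>x. ?e x * \<phi> x)" "integrable lborel (\<lambda>x. ?e x * nderiv (Suc 0) \<phi> x)"
    by (rule integrable_exp_mult[OF schwartz_integrable], rule \<phi> d)+
  have lim: "((\<lambda>x. ?e x * \<phi> x) \<longlongrightarrow> 0) F" if "(\<phi> \<longlongrightarrow> 0) F" for F
    using tendsto_norm_zero[OF that] by (intro tendsto_norm_zero_cancel[of "\<lambda>x. ?e x * \<phi> x"]) (simp add: norm_mult)
  have "(LINT x|lborel. (\<i> * of_real (s * \<xi>)) * (?e x * \<phi> x) + ?e x * nderiv (Suc 0) \<phi> x) = 0"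
  proof (rule integral_derivative_eq_0)
    fix x
    have "(?e has_vector_derivative (\<i> * of_real (s * \<xi>)) * ?e x) (at x)"
      by (auto intro!: derivative_eq_intros has_vector_derivative_real_field simp: algebra_simps)
    from has_vector_derivative_mult[OF this smooth_has_vector_derivative[OF schwartz_smooth[OF \<phi>], of 0]]
    show "((\<lambda>x. ?e x * \<phi> x) has_vector_derivative
        (\<i> * of_real (s * \<xi>)) * (?e x * \<phi> x) + ?e x * nderiv (Suc 0) \<phi> x) (at x)"
      by (simp add: algebra_simps)
  next
    show "continuous_on UNIV (\<lambda>x. (\<i> * of_real (s * \<xi>)) * (?e x * \<phi> x) + ?e x * nderiv (Suc 0) \<phi> x)"
      by (intro continuous_intros schwartz_continuous_on \<phi> d)
    show "integrable lborel (\<lambda>x. (\<i> * of_real (s * \<xi>)) * (?e x * \<phi> x) + ?e x * nderiv (Suc 0) \<phi> x)"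
      by (intro Bochner_Integration.integrable_add integrable_mult_right i)
  qed (use schwartz_tendsto_0[OF \<phi>] lim in auto)
  then have "(\<i> * of_real (s * \<xi>)) * FT s \<phi> \<xi> + FT s (nderiv (Suc 0) \<phi>) \<xi> = 0"
    using i by (simp add: FT_def)
  then show ?thesis
    by (simp add: eq_neg_iff_add_eq_0 add.commute)
qed

lemma FT_schwartz:
  assumes \<phi>: "\<phi> \<in> schwartz" and "s \<noteq> 0"
  shows "FT s \<phi> \<in> schwartz"
proof (rule schwartzI)
  let ?p = "\<lambda>k x. (\<i> * of_real s * of_real x) ^ k * \<phi> x"
  have p: "?p k \<in> schwartz" for k
    using schwartz_mult_power[OF \<phi>, of "\<i> * of_real s" k] by simp
  have d: "(FT s (?p k) has_vector_derivative FT s (?p (Suc k)) \<xi>) (at \<xi>)" for k \<xi>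
    using FT_has_vector_derivative[OF p[of k], of s \<xi>] by (simp add: mult.assoc)
  show "smooth (FT s \<phi>)"
    using smoothI(1)[of "\<lambda>k. FT s (?p k)" "FT s \<phi>"] d by simp
  fix m k
  have k: "nderiv k (FT s \<phi>) = FT s (?p k)"
    using smoothI(2)[of "\<lambda>k. FT s (?p k)" "FT s \<phi>"] d by simp
  \<comment> \<open>Each factor \<open>s * \<xi>\<close> is absorbed by differentiating the function
    under the transform. Comparing moduli only avoids tracking the powers of -i.\<close>
  have "\<exists>\<psi>\<in>schwartz. \<forall>\<xi>. norm (of_real (s * \<xi>) ^ m * FT s (?p k) \<xi>) = norm (FT s \<psi> \<xi>)"
  proof (induction m)
    case 0
    then show ?case
      using p[of k] by auto
  next
    case (Suc m)
    then obtain \<psi> where \<psi>: "\<psi> \<in> schwartz"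
      "\<And>\<xi>. norm (of_real (s * \<xi>) ^ m * FT s (?p k) \<xi>) = norm (FT s \<psi> \<xi>)"
      by blast
    show ?case
    proof (intro bexI[of _ "nderiv (Suc 0) \<psi>"] allI)
      fix \<xi>
      have "norm (of_real (s * \<xi>) ^ Suc m * FT s (?p k) \<xi>) = norm (s * \<xi>) * norm (of_real (s * \<xi>) ^ m * FT s (?p k) \<xi>)"
        by (simp add: norm_mult norm_power power_mult_distrib abs_mult)
      then show "norm (of_real (s * \<xi>) ^ Suc m * FT s (?p k) \<xi>) = norm (FT s (nderiv (Suc 0) \<psi>) \<xi>)"
        unfolding \<psi>(2) FT_nderiv[OF \<psi>(1)] by (simp add: norm_mult abs_mult)
    qed (rule schwartz_nderiv[OF \<psi>(1)])
  qed
  then obtain \<psi> where \<psi>: "\<And>\<xi>. norm (of_real (s * \<xi>) ^ m * FT s (?p k) \<xi>) = norm (FT s \<psi> \<xi>)"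
    by blast
  have "\<bar>\<xi>\<bar> ^ m * norm (nderiv k (FT s \<phi>) \<xi>) \<le> (LINT x|lborel. norm (\<psi> x)) / \<bar>s\<bar> ^ m" for \<xi>
  proof -
    have "\<bar>s\<bar> ^ m * (\<bar>\<xi>\<bar> ^ m * norm (FT s (?p k) \<xi>)) = norm (FT s \<psi> \<xi>)"
      using \<psi>[of \<xi>] by (simp add: norm_mult norm_power power_mult_distrib abs_mult mult.assoc)
    also have "\<dots> \<le> (LINT x|lborel. norm (\<psi> x))"
      by (rule FT_bound)
    finally show ?thesis
      using \<open>s \<noteq> 0\<close> by (simp add: k field_simps)
  qed
  then show "\<exists>B. \<forall>\<xi>. \<bar>\<xi>\<bar> ^ m * norm (nderiv k (FT s \<phi>) \<xi>) \<le> B"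
    by blast
qed

lemma fourier_schwartz: "\<phi> \<in> schwartz \<Longrightarrow> fourier \<phi> \<in> schwartz"
  and inv_fourier_schwartz: "\<phi> \<in> schwartz \<Longrightarrow> inv_fourier \<phi> \<in> schwartz"
  unfolding fourier_eq_FT inv_fourier_eq_FT
  by (rule FT_schwartz schwartz_cmult; simp add: FT_schwartz)+

section \<open>Convolution and Fourier inversion\<close>

text \<open>An integrable bound on the inner L1 norms gives integrability on the product, which
  Fubini's theorem asks for. In the applications \<open>w\<close> is a constant times the modulus of
  one integrable function.\<close>

lemma lborel_Fubini_dominated:
  fixes F :: "real \<Rightarrow> real \<Rightarrow> complex"
  assumes [measurable]: "case_prod F \<in> borel_measurable (lborel \<Otimes>\<^sub>M lborel)"
    and i: "\<And>y. integrable lborel (\<lambda>x. F x y)"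
    and w: "\<And>y. (LINT x|lborel. norm (F x y)) \<le> w y" "integrable lborel w"
  shows "(LINT x|lborel. LINT y|lborel. F x y) = (LINT y|lborel. LINT x|lborel. F x y)"
proof -
  have "integrable (lborel \<Otimes>\<^sub>M lborel) (\<lambda>(y, x). F x y)"
  proof (rule lborel_pair.Fubini_integrable)
    show "(\<lambda>(y, x). F x y) \<in> borel_measurable (lborel \<Otimes>\<^sub>M lborel)"
      by measurable
    show "integrable lborel (\<lambda>y. LINT x|lborel. norm (case (y, x) of (y, x) \<Rightarrow> F x y))"
    proof (rule Bochner_Integration.integrable_bound[OF w(2)])
      show "(\<lambda>y. LINT x|lborel. norm (case (y, x) of (y, x) \<Rightarrow> F x y)) \<in> borel_measurable lborel"
        by measurable
      show "AE y in lborel. norm (LINT x|lborel. norm (case (y, x) of (y, x) \<Rightarrow> F x y)) \<le> norm (w y)"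
      proof (rule AE_I2)
        fix y
        have "0 \<le> (LINT x|lborel. norm (F x y))"
          by (rule integral_nonneg_AE) simp
        then show "norm (LINT x|lborel. norm (case (y, x) of (y, x) \<Rightarrow> F x y)) \<le> norm (w y)"
          using w(1)[of y] by simp
      qed
    qed
    show "AE y in lborel. integrable lborel (\<lambda>x. case (y, x) of (y, x) \<Rightarrow> F x y)"
      using i by simp
  qed
  from lborel_pair.Fubini_integral[OF this] show ?thesis
    by simp
qed

lemma lborel_integrable_affine:
  fixes f :: "real \<Rightarrow> 'a::{banach, second_countable_topology}"
  assumes "integrable lborel f" "c \<noteq> 0"
  shows "integrable lborel (\<lambda>x. f (t + c * x))"
  using lborel_integrable_real_affine_iff[of c f t] assms by simp

lemma lborel_integral_reflect:
  fixes f :: "real \<Rightarrow> 'a::{banach, second_countable_topology}"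
  shows "(LINT x|lborel. f (t - x)) = (LINT x|lborel. f x)"
  using lborel_integral_real_affine[of "-1" f t] by simp

lemma lborel_integrable_reflect:
  fixes f :: "real \<Rightarrow> 'a::{banach, second_countable_topology}"
  shows "integrable lborel f \<Longrightarrow> integrable lborel (\<lambda>x. f (t - x))"
  using lborel_integrable_affine[of f "-1" t] by simp

lemma lborel_integral_shift:
  fixes f :: "real \<Rightarrow> 'a::{banach, second_countable_topology}"
  shows "(LINT x|lborel. f (x - t)) = (LINT x|lborel. f x)"
  using lborel_integral_real_affine[of 1 f "-t"] by simp

lemma lborel_integrable_shift:
  fixes f :: "real \<Rightarrow> 'a::{banach, second_countable_topology}"
  shows "integrable lborel f \<Longrightarrow> integrable lborel (\<lambda>x. f (x - t))"
  using lborel_integrable_affine[of f 1 "-t"] by simp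

lemma integrable_bounded_mult:
  fixes f K :: "real \<Rightarrow> complex"
  assumes "f \<in> borel_measurable borel" "\<And>x. norm (f x) \<le> M" "integrable lborel K"
  shows "integrable lborel (\<lambda>x. f x * K x)"
proof (rule Bochner_Integration.integrable_bound)
  show "integrable lborel (\<lambda>x. M * norm (K x))"
    using assms by auto
  show "(\<lambda>x. f x * K x) \<in> borel_measurable lborel"
    using assms by auto
  show "AE x in lborel. norm (f x * K x) \<le> norm (M * norm (K x))"
  proof (rule AE_I2)
    fix x
    have "norm (f x * K x) \<le> M * norm (K x)"
      using assms(2)[of x] by (simp add: norm_mult mult_right_mono)
    then show "norm (f x * K x) \<le> norm (M * norm (K x))"
      by (simp only: real_norm_def)
  qed
qed

lemma norm_integral_bounded_mult_le:
  fixes f K :: "real \<Rightarrow> complex"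
  assumes "f \<in> borel_measurable borel" "\<And>x. norm (f x) \<le> M" "integrable lborel K"
  shows "norm (LINT x|lborel. f x * K x) \<le> M * (LINT x|lborel. norm (K x))"
proof -
  have "norm (LINT x|lborel. f x * K x) \<le> (LINT x|lborel. norm (f x * K x))"
    by (rule integral_norm_bound)
  also have "\<dots> \<le> (LINT x|lborel. M * norm (K x))"
    using integrable_norm[OF integrable_bounded_mult[OF assms]] assms(2,3)
    by (intro integral_mono) (auto simp: norm_mult intro!: mult_right_mono)
  finally show ?thesis
    by simp
qed

section \<open>Convolution of a bounded function with an integrable kernel\<close>

definition conv :: "(real \<Rightarrow> complex) \<Rightarrow> (real \<Rightarrow> complex) \<Rightarrow> real \<Rightarrow> complex" where
  "conv f K x = (LINT y|lborel. f (x - y) * K y)"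

text \<open>The two forms have different uses: with the shift on \<open>f\<close>, translations and
  limits of \<open>f\<close> are visible; with the shift on \<open>K\<close>, derivatives fall on
  the smooth kernel.\<close>

lemma conv_commute: "conv f K x = (LINT y|lborel. f y * K (x - y))"
  unfolding conv_def using lborel_integral_reflect[of "\<lambda>y. f y * K (x - y)" x] by simp

lemma conv_translate: "conv (translate y f) K = translate y (conv f K)"
  by (simp add: conv_def translate_def fun_eq_iff algebra_simps)

lemma norm_conv_le:
  assumes "f \<in> borel_measurable borel" "\<And>x. norm (f x) \<le> M" "integrable lborel K"
  shows "norm (conv f K x) \<le> M * (LINT x|lborel. norm (K x))"
  unfolding conv_def by (rule norm_integral_bounded_mult_le) (use assms in auto)

lemma conv_sum_right:
  assumes "f \<in> borel_measurable borel" "\<And>x. norm (f x) \<le> M" "finite A" "\<And>a. a \<in> A \<Longrightarrow> integrable lborel (K a)"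
  shows "conv f (\<lambda>y. \<Sum>a\<in>A. K a y) x = (\<Sum>a\<in>A. conv f (K a) x)"
  unfolding conv_def sum_distrib_left
  by (rule Bochner_Integration.integral_sum; rule integrable_bounded_mult) (use assms in auto)

lemma conv_tendsto:
  assumes "\<And>n. f n \<in> borel_measurable borel" "\<And>n x. norm (f n x) \<le> M" "integrable lborel K"
    and "\<And>x. (\<lambda>n. f n x) \<longlonglongrightarrow> g x"
  shows "(\<lambda>n. conv (f n) K x) \<longlonglongrightarrow> conv g K x"
  unfolding conv_def
proof (rule integral_dominated_convergence[where w = "\<lambda>y. M * norm (K y)"])
  have [measurable]: "f n \<in> borel_measurable borel" "K \<in> borel_measurable borel" for n
    using assms by auto
  have [measurable]: "g \<in> borel_measurable borel"
    by (rule borel_measurable_LIMSEQ_metric[OF assms(1,4)])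
  show "(\<lambda>y. f n (x - y) * K y) \<in> borel_measurable lborel" "(\<lambda>y. g (x - y) * K y) \<in> borel_measurable lborel" for n
    by measurable
qed (use assms in \<open>auto simp: norm_mult intro!: tendsto_intros mult_right_mono\<close>)

text \<open>Substituting y / (n + 1) for y moves the dilation into the argument of \<open>h\<close>,
  which tends to \<open>x\<close> under the fixed majorant M |K|. The mass of \<open>K\<close> stays
  as a factor because the lemma serves both the square of the window and
  \<open>box_kernel chi 0\<close>.\<close>

lemma conv_dilation_tendsto:
  assumes h: "continuous_on UNIV h" "\<And>x. norm (h x) \<le> M" and K: "integrable lborel K"
  shows "(\<lambda>n. conv h (\<lambda>y. of_nat (Suc n) * K (real (Suc n) * y)) x) \<longlonglongrightarrow> h x * (LINT y|lborel. K y)"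
proof -
  have [measurable]: "h \<in> borel_measurable borel" "K \<in> borel_measurable borel"
    using h K by (auto intro: borel_measurable_continuous_onI)
  have "conv h (\<lambda>y. of_nat (Suc n) * K (real (Suc n) * y)) x = (LINT y|lborel. h (x - y / real (Suc n)) * K y)" for n
    unfolding conv_def
    using lborel_integral_real_affine[of "1 / real (Suc n)"
        "\<lambda>y. h (x - y) * (of_nat (Suc n) * K (real (Suc n) * y))" 0]
    by (simp add: mult.left_commute scaleR_conv_of_real del: of_nat_Suc)
  moreover have "(\<lambda>n. LINT y|lborel. h (x - y / real (Suc n)) * K y) \<longlonglongrightarrow> (LINT y|lborel. h x * K y)"
  proof (rule integral_dominated_convergence[where w = "\<lambda>y. M * norm (K y)"])
    show "AE y in lborel. (\<lambda>n. h (x - y / real (Suc n)) * K y) \<longlonglongrightarrow> h x * K y"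
    proof (rule AE_I2)
      fix y
      have "(\<lambda>n. x - y / real (Suc n)) \<longlonglongrightarrow> x"
        by real_asymp
      moreover have "isCont h x"
        using h(1) by (simp add: continuous_on_eq_continuous_at)
      ultimately have "(\<lambda>n. h (x - y / real (Suc n))) \<longlonglongrightarrow> h x"
        by (rule isCont_tendsto_compose[rotated])
      then show "(\<lambda>n. h (x - y / real (Suc n)) * K y) \<longlonglongrightarrow> h x * K y"
        by (intro tendsto_intros)
    qed
    show "(\<lambda>y. h (x - y / real (Suc n)) * K y) \<in> borel_measurable lborel" "(\<lambda>y. h x * K y) \<in> borel_measurable lborel" for n
      by measurable
  qed (use h K in \<open>auto simp: norm_mult intro!: mult_right_mono\<close>)
  ultimately show ?thesis
    by simp
qed

lemma conv_has_vector_derivative: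
  assumes f: "f \<in> borel_measurable borel" "\<And>x. norm (f x) \<le> M" and K: "K \<in> schwartz"
  shows "(conv f K has_vector_derivative conv f (nderiv (Suc 0) K) x) (at x)"
proof -
  let ?K' = "nderiv (Suc 0) K"
  have K': "?K' \<in> schwartz"
    using K by (rule schwartz_nderiv)
  obtain C where C: "C \<ge> 0" "\<And>x. norm (?K' x) \<le> C / (1 + x\<^sup>2)"
    using schwartz_decay[OF K'] by auto
  have M: "0 \<le> M"
    using f(2)[of 0] norm_ge_zero order_trans by blast
  have [measurable]: "?K' \<in> borel_measurable borel" "f \<in> borel_measurable borel"
    using K' f by (auto intro: schwartz_measurable)
  have "((\<lambda>x. LINT y|lborel. f y * K (x - y)) has_vector_derivative (LINT y|lborel. f y * ?K' (x - y))) (at x)"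
  proof (rule has_vector_derivative_integral[where r = 1 and w = "\<lambda>y. M * (3 * C * (1 / (1 + (x - y)\<^sup>2)))"])
    fix t y :: real
    have "((\<lambda>t. t - y) has_vector_derivative 1) (at t)"
      by (auto intro!: derivative_eq_intros)
    from vector_diff_chain_at[OF this smooth_has_vector_derivative[OF schwartz_smooth[OF K], of 0]]
    show "((\<lambda>t. f y * K (t - y)) has_vector_derivative f y * ?K' (t - y)) (at t)"
      by (intro derivative_intros) (simp add: o_def)
    assume t: "dist t x < 1"
    show "norm (f y * ?K' (t - y)) \<le> M * (3 * C * (1 / (1 + (x - y)\<^sup>2)))"
      unfolding norm_mult
    proof (intro mult_mono f(2) M)
      \<comment> \<open>Origin of the factor 3: for |t - x| < 1 the decay of \<open>?K'\<close> at
        \<open>t - y\<close> is at least a third of that at \<open>x - y\<close>, by (x - y)^2 <= 2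
        (x - t)^2 + 2 (t - y)^2. This makes the majorant independent of \<open>t\<close>.\<close>
      have aux: "q \<le> 1 \<Longrightarrow> p \<le> 2 * q + 2 * s \<Longrightarrow> 0 \<le> s \<Longrightarrow> 1 + p \<le> 3 * (1 + s)" for p q s :: real
        by simp
      have "(x - t)\<^sup>2 \<le> 1"
        using t by (simp add: dist_real_def abs_square_le_1 abs_minus_commute)
      moreover have "(x - y)\<^sup>2 \<le> 2 * (x - t)\<^sup>2 + 2 * (t - y)\<^sup>2"
        using zero_le_power2[of "(x - t) - (t - y)"] by (simp add: power2_eq_square algebra_simps)
      ultimately have "1 + (x - y)\<^sup>2 \<le> 3 * (1 + (t - y)\<^sup>2)"
        by (rule aux) simp
      moreover have "0 < 1 + (x - y)\<^sup>2" "0 < 1 + (t - y)\<^sup>2"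
        using zero_le_power2[of "t - y"] zero_le_power2[of "x - y"] by linarith+
      ultimately have "1 / (1 + (t - y)\<^sup>2) \<le> 3 / (1 + (x - y)\<^sup>2)"
        by (simp add: divide_simps)
      from mult_left_mono[OF this C(1)]
      show "norm (?K' (t - y)) \<le> 3 * C * (1 / (1 + (x - y)\<^sup>2))"
        using C(2)[of "t - y"] by (simp add: mult.commute)
    qed auto
  next
    fix t
    show "integrable lborel (\<lambda>y. f y * K (t - y))"
      by (rule integrable_bounded_mult[OF f lborel_integrable_reflect[OF schwartz_integrable[OF K]]])
  next
    show "integrable lborel (\<lambda>y. M * (3 * C * (1 / (1 + (x - y)\<^sup>2))))"
      by (intro integrable_mult_right lborel_integrable_reflect[OF integrable_1_over_1_plus_square])
    show "(\<lambda>y. f y * ?K' (x - y)) \<in> borel_measurable lborel"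
      by measurable
  qed simp
  then show ?thesis
    by (simp add: conv_commute[abs_def])
qed

lemma conv_continuous_on:
  assumes "f \<in> borel_measurable borel" "\<And>x. norm (f x) \<le> M" "K \<in> schwartz"
  shows "continuous_on A (conv f K)"
  using conv_has_vector_derivative[OF assms]
  by (meson continuous_at_imp_continuous_on has_vector_derivative_continuous)

text \<open>The Gaussian is the one Fourier transform that has to be evaluated explicitly; it is the
  characteristic function of the standard normal distribution.\<close>

lemma std_normal_char:
  "(LINT x|lborel. of_real (std_normal_density x) * exp (\<i> * of_real (t * x))) = complex_of_real (exp (- t\<^sup>2 / 2))"
proof -
  have "char std_normal_distribution t = complex_of_real (exp (- t\<^sup>2 / 2))"
    by (simp add: char_std_normal_distribution)
  moreover have "char std_normal_distribution t = (LINT x|lborel. std_normal_density x *\<^sub>R exp (\<i> * of_real (t * x)))"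
    unfolding char_def by (rule integral_density) (auto intro: normal_density_nonneg)
  ultimately show ?thesis
    by (simp add: scaleR_conv_of_real)
qed

text \<open>Gaussian regularization: multiply the outer integrand by the normal density at scale
  \<open>1 / \<epsilon>\<close>, swap the integrals, and let \<open>\<epsilon>\<close> tend to zero on both sides.\<close>

theorem fourier_inv_fourier:
  assumes b: "b \<in> schwartz"
  shows "fourier (inv_fourier b) = b"
proof
  fix \<xi>
  let ?N = "\<lambda>x. complex_of_real (std_normal_density x)"
  let ?K = "inv_fourier b"
  let ?I = "\<lambda>\<epsilon>. LINT x|lborel. ?N (\<epsilon> * x) * (exp (- \<i> * of_real (x * \<xi>)) * ?K x)"
  have K: "?K \<in> schwartz"
    using b by (rule inv_fourier_schwartz)
  have [measurable]: "b \<in> borel_measurable borel" "?K \<in> borel_measurable borel"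
    using b K by (auto intro: schwartz_measurable)
  have N_bound: "norm (?N x) \<le> 1" for x
  proof -
    have "std_normal_density x \<le> 1 * 1"
      unfolding std_normal_density_def using pi_ge_two
      by (intro mult_mono) (auto simp: real_le_lsqrt)
    then show ?thesis
      using normal_density_nonneg[of 0 1 x] by simp
  qed
  have N_int: "integrable lborel ?N"
    by (intro integrable_of_real integrable_normal_density) simp
  have eI: "integrable lborel (\<lambda>x. exp (- \<i> * of_real (x * \<xi>)) * ?K x)"
    using integrable_exp_mult[OF schwartz_integrable[OF K], of "-1" \<xi>] by simp
  define \<epsilon> where "\<epsilon> n = 1 / real (Suc n)" for n
  have \<epsilon>: "\<epsilon> n > 0" "\<epsilon> \<longlonglongrightarrow> 0" for n
    unfolding \<epsilon>_def by (simp, real_asymp)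
  have lim1: "(\<lambda>n. ?I (\<epsilon> n)) \<longlonglongrightarrow> (LINT x|lborel. ?N 0 * (exp (- \<i> * of_real (x * \<xi>)) * ?K x))"
  proof (rule integral_dominated_convergence[where w = "\<lambda>x. norm (exp (- \<i> * of_real (x * \<xi>)) * ?K x)"])
    show "AE x in lborel. (\<lambda>n. ?N (\<epsilon> n * x) * (exp (- \<i> * of_real (x * \<xi>)) * ?K x))
        \<longlonglongrightarrow> ?N 0 * (exp (- \<i> * of_real (x * \<xi>)) * ?K x)"
    proof (rule AE_I2)
      fix x :: real
      have "(\<lambda>n. std_normal_density (\<epsilon> n * x)) \<longlonglongrightarrow> std_normal_density (0 * x)"
        unfolding std_normal_density_def by (intro tendsto_intros \<epsilon>) simp_all
      then show "(\<lambda>n. ?N (\<epsilon> n * x) * (exp (- \<i> * of_real (x * \<xi>)) * ?K x))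
        \<longlonglongrightarrow> ?N 0 * (exp (- \<i> * of_real (x * \<xi>)) * ?K x)"
        by (intro tendsto_intros) simp
    qed
    show "AE x in lborel. norm (?N (\<epsilon> n * x) * (exp (- \<i> * of_real (x * \<xi>)) * ?K x))
        \<le> norm (exp (- \<i> * of_real (x * \<xi>)) * ?K x)" for n
      using N_bound by (auto simp: norm_mult intro!: mult_left_le_one_le)
  qed (use eI in auto)
  \<comment> \<open>After the swap the inner integral is again a Gaussian, concentrated at
    \<open>\<xi>\<close> on the scale \<open>e\<close>. The substitution \<eta> = \<xi> + e s then
    moves the scale into the argument of \<open>b\<close>.\<close>
  have swap: "?I e = ?N 0 * (LINT s|lborel. b (\<xi> + e * s) * ?N s)" if "e > 0" for e
  proof -
    let ?F = "\<lambda>x \<eta>. ?N (e * x) * exp (\<i> * of_real (x * (\<eta> - \<xi>))) * b \<eta>"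
    have Ne: "integrable lborel (\<lambda>x. ?N (e * x))"
      using lborel_integrable_affine[OF N_int, of e 0] that by simp
    have "?I e = (LINT x|lborel. of_real (1 / (2 * pi)) * (LINT \<eta>|lborel. ?F x \<eta>))"
      unfolding inv_fourier_def
      by (intro Bochner_Integration.integral_cong refl)
        (simp add: mult.left_commute mult.assoc exp_add[symmetric] algebra_simps flip: integral_mult_right_zero)
    also have "\<dots> = of_real (1 / (2 * pi)) * (LINT x|lborel. LINT \<eta>|lborel. ?F x \<eta>)"
      by simp
    also have "(LINT x|lborel. LINT \<eta>|lborel. ?F x \<eta>) = (LINT \<eta>|lborel. LINT x|lborel. ?F x \<eta>)"
    proof (rule lborel_Fubini_dominated)
      show "integrable lborel (\<lambda>\<eta>. (LINT x|lborel. norm (?N (e * x))) * norm (b \<eta>))"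
        using schwartz_integrable[OF b] by simp
      show "(LINT x|lborel. norm (?F x \<eta>)) \<le> (LINT x|lborel. norm (?N (e * x))) * norm (b \<eta>)" for \<eta>
        by (simp add: norm_mult)
      show "integrable lborel (\<lambda>x. ?F x \<eta>)" for \<eta>
        using integrable_exp_mult[OF Ne, of 1 "\<eta> - \<xi>"] by (simp add: mult.commute)
    qed measurable
    also have "(LINT \<eta>|lborel. LINT x|lborel. ?F x \<eta>)
        = (LINT \<eta>|lborel. b \<eta> * of_real (exp (- ((\<eta> - \<xi>) / e)\<^sup>2 / 2) / e))"
    proof (intro Bochner_Integration.integral_cong refl)
      fix \<eta>
      have "(LINT x|lborel. ?N (e * x) * exp (\<i> * of_real (x * (\<eta> - \<xi>))))
          = \<bar>1 / e\<bar> *\<^sub>R (LINT x|lborel. ?N x * exp (\<i> * of_real ((\<eta> - \<xi>) / e * x)))"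
        using lborel_integral_real_affine[of "1 / e" "\<lambda>x. ?N (e * x) * exp (\<i> * of_real (x * (\<eta> - \<xi>)))" 0] that
        by (simp add: mult.commute)
      also have "\<dots> = of_real (exp (- ((\<eta> - \<xi>) / e)\<^sup>2 / 2) / e)"
        unfolding std_normal_char using that by (simp add: scaleR_conv_of_real)
      finally show "(LINT x|lborel. ?F x \<eta>) = b \<eta> * of_real (exp (- ((\<eta> - \<xi>) / e)\<^sup>2 / 2) / e)"
        by (simp add: mult.commute)
    qed
    also have "\<dots> = (LINT s|lborel. b (\<xi> + e * s) * of_real (exp (- s\<^sup>2 / 2)))"
      using lborel_integral_real_affine[of e "\<lambda>\<eta>. b \<eta> * of_real (exp (- ((\<eta> - \<xi>) / e)\<^sup>2 / 2) / e)" \<xi>] that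
      by (simp add: scaleR_conv_of_real)
    \<comment> \<open>With N the normal density, exp (- s^2 / 2) = sqrt (2 pi) N(s) and sqrt (2 pi)
      / (2 pi) = N(0). The factor N(0) thus appears in both limits and cancels at the end.\<close>
    also have "of_real (1 / (2 * pi)) * \<dots> = ?N 0 * (LINT s|lborel. b (\<xi> + e * s) * ?N s)"
    proof -
      have "exp (- s\<^sup>2 / 2) = sqrt (2 * pi) * std_normal_density s" for s :: real
        by (simp add: std_normal_density_def)
      then have "b (\<xi> + e * s) * of_real (exp (- s\<^sup>2 / 2)) = of_real (sqrt (2 * pi)) * (b (\<xi> + e * s) * ?N s)" for s
        by (simp only: of_real_mult mult.left_commute)
      then have "(LINT s|lborel. b (\<xi> + e * s) * of_real (exp (- s\<^sup>2 / 2)))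
          = of_real (sqrt (2 * pi)) * (LINT s|lborel. b (\<xi> + e * s) * ?N s)"
        by (simp only: integral_mult_right_zero)
      moreover have "of_real (1 / (2 * pi)) * complex_of_real (sqrt (2 * pi)) = ?N 0"
        unfolding std_normal_density_def of_real_mult[symmetric] of_real_eq_iff
        by (simp add: field_simps flip: real_sqrt_mult)
      ultimately show ?thesis
        by (simp only: mult.assoc[symmetric])
    qed
    finally show ?thesis .
  qed
  obtain C where b_bound: "\<And>x. norm (b x) \<le> C"
    using schwartz_bounded[OF b, of 0 0] by auto
  have "(\<lambda>n. LINT s|lborel. b (\<xi> + \<epsilon> n * s) * ?N s) \<longlonglongrightarrow> (LINT s|lborel. b \<xi> * ?N s)"
  proof (rule integral_dominated_convergence[where w = "\<lambda>s. C * norm (?N s)"])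
    show "AE s in lborel. (\<lambda>n. b (\<xi> + \<epsilon> n * s) * ?N s) \<longlonglongrightarrow> b \<xi> * ?N s"
    proof (rule AE_I2)
      fix s :: real
      have "(\<lambda>n. \<xi> + \<epsilon> n * s) \<longlonglongrightarrow> \<xi> + 0 * s"
        by (intro tendsto_intros \<epsilon>)
      moreover have "isCont b \<xi>"
        using schwartz_continuous_on[OF b, of UNIV] by (simp add: continuous_on_eq_continuous_at)
      ultimately show "(\<lambda>n. b (\<xi> + \<epsilon> n * s) * ?N s) \<longlonglongrightarrow> b \<xi> * ?N s"
        by (intro tendsto_intros isCont_tendsto_compose[of _ b]) auto
    qed
    show "integrable lborel (\<lambda>s. C * norm (?N s))"
      using N_int by (intro integrable_mult_right integrable_norm)
    show "AE s in lborel. norm (b (\<xi> + \<epsilon> n * s) * ?N s) \<le> C * norm (?N s)" for n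
      using b_bound by (auto simp: norm_mult intro!: mult_right_mono)
  qed measurable
  moreover have "(LINT s|lborel. b \<xi> * ?N s) = b \<xi>"
  proof -
    have "(LINT s|lborel. ?N s) = 1"
      using integral_normal_density[of 1 0] by simp
    then show ?thesis
      by simp
  qed
  ultimately have "(\<lambda>n. ?I (\<epsilon> n)) \<longlonglongrightarrow> ?N 0 * b \<xi>"
    unfolding swap[OF \<epsilon>(1)] by (intro tendsto_mult_left) simp
  then have "?N 0 * b \<xi> = (LINT x|lborel. ?N 0 * (exp (- \<i> * of_real (x * \<xi>)) * ?K x))"
    using lim1 LIMSEQ_unique by blast
  also have "\<dots> = ?N 0 * fourier ?K \<xi>"
    unfolding fourier_def by simp
  finally show "fourier ?K \<xi> = b \<xi>"
    using normal_density_pos[of 1 0 0] by simp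
qed

text \<open>The exponential splits over x - y, and the inner integral over y is
  \<open>fourier (inv_fourier b)\<close>, which inversion turns into \<open>b\<close>.\<close>

lemma conv_inv_fourier:
  assumes a: "a \<in> schwartz" and b: "b \<in> schwartz"
  shows "conv (inv_fourier a) (inv_fourier b) = inv_fourier (\<lambda>\<xi>. a \<xi> * b \<xi>)"
proof
  fix x
  let ?K = "inv_fourier b"
  let ?F = "\<lambda>y \<xi>. exp (\<i> * of_real ((x - y) * \<xi>)) * a \<xi> * ?K y"
  have K: "?K \<in> schwartz"
    using b by (rule inv_fourier_schwartz)
  have [measurable]: "a \<in> borel_measurable borel" "?K \<in> borel_measurable borel"
    using a K by (auto intro: schwartz_measurable)
  have "conv (inv_fourier a) ?K x = (LINT y|lborel. of_real (1 / (2 * pi)) * (LINT \<xi>|lborel. ?F y \<xi>))"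
    unfolding conv_def
    by (intro Bochner_Integration.integral_cong refl) (simp add: inv_fourier_def[of a])
  also have "\<dots> = of_real (1 / (2 * pi)) * (LINT y|lborel. LINT \<xi>|lborel. ?F y \<xi>)"
    by simp
  also have "(LINT y|lborel. LINT \<xi>|lborel. ?F y \<xi>) = (LINT \<xi>|lborel. LINT y|lborel. ?F y \<xi>)"
  proof (rule lborel_Fubini_dominated)
    show "integrable lborel (\<lambda>\<xi>. norm (a \<xi>) * (LINT y|lborel. norm (?K y)))"
      using schwartz_integrable[OF a] by simp
    show "(LINT y|lborel. norm (?F y \<xi>)) \<le> norm (a \<xi>) * (LINT y|lborel. norm (?K y))" for \<xi>
      by (simp add: norm_mult)
    show "integrable lborel (\<lambda>y. ?F y \<xi>)" for \<xi>
      by (rule integrable_bounded_mult[where M = "norm (a \<xi>)"])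
        (use schwartz_integrable[OF K] in \<open>auto simp: norm_mult\<close>)
  qed measurable
  also have "(LINT \<xi>|lborel. LINT y|lborel. ?F y \<xi>) = (LINT \<xi>|lborel. exp (\<i> * of_real (x * \<xi>)) * (a \<xi> * b \<xi>))"
  proof (intro Bochner_Integration.integral_cong refl)
    fix \<xi>
    have "exp (\<i> * of_real ((x - y) * \<xi>)) = exp (\<i> * of_real (x * \<xi>)) * exp (- \<i> * of_real (y * \<xi>))" for y
      by (simp add: exp_add[symmetric] algebra_simps)
    then have "(LINT y|lborel. ?F y \<xi>) = (LINT y|lborel. exp (\<i> * of_real (x * \<xi>)) * a \<xi> * (exp (- \<i> * of_real (y * \<xi>)) * ?K y))"
      by (simp only: mult_ac)
    also have "\<dots> = exp (\<i> * of_real (x * \<xi>)) * a \<xi> * fourier ?K \<xi>"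
      by (simp only: integral_mult_right_zero fourier_def)
    finally show "(LINT y|lborel. ?F y \<xi>) = exp (\<i> * of_real (x * \<xi>)) * (a \<xi> * b \<xi>)"
      by (simp add: fourier_inv_fourier[OF b] mult.assoc)
  qed
  finally show "conv (inv_fourier a) ?K x = inv_fourier (\<lambda>\<xi>. a \<xi> * b \<xi>) x"
    by (simp add: inv_fourier_def[of "\<lambda>\<xi>. a \<xi> * b \<xi>"])
qed

text \<open>The shape shared by associativity of convolution and by the transposition of
  \<open>box_op\<close>: \<open>f\<close> is merely bounded, and all integrability comes from the
  two kernels.\<close>

lemma lborel_Fubini_conv:
  fixes f A B :: "real \<Rightarrow> complex"
  assumes f: "f \<in> borel_measurable borel" "\<And>x. norm (f x) \<le> M"
    and A: "integrable lborel A" and B: "integrable lborel B"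
  shows "(LINT w|lborel. LINT v|lborel. f w * A (w - v) * B v) = (LINT v|lborel. LINT w|lborel. f w * A (w - v) * B v)"
proof (rule lborel_Fubini_dominated)
  have [measurable]: "A \<in> borel_measurable borel" "B \<in> borel_measurable borel" "f \<in> borel_measurable borel"
    using A B f by auto
  show "(\<lambda>(w, v). f w * A (w - v) * B v) \<in> borel_measurable (lborel \<Otimes>\<^sub>M lborel)"
    by measurable
  have i: "integrable lborel (\<lambda>w. f w * A (w - v))" for v
    using integrable_bounded_mult[OF f lborel_integrable_shift[OF A]] .
  then show "integrable lborel (\<lambda>w. f w * A (w - v) * B v)" for v
    by simp
  show "integrable lborel (\<lambda>v. M * (LINT w|lborel. norm (A w)) * norm (B v))"
    using B by simp
  show "(LINT w|lborel. norm (f w * A (w - v) * B v)) \<le> M * (LINT w|lborel. norm (A w)) * norm (B v)" for v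
  proof -
    have "(LINT w|lborel. norm (f w * A (w - v))) \<le> (LINT w|lborel. M * norm (A (w - v)))"
      using integrable_norm[OF i[of v]] f(2) lborel_integrable_shift[OF A]
      by (intro integral_mono) (auto simp: norm_mult intro!: mult_right_mono)
    also have "\<dots> = M * (LINT w|lborel. norm (A w))"
      by (simp add: lborel_integral_shift[of "\<lambda>w. norm (A w)"])
    finally show ?thesis
      by (simp add: norm_mult[of "_ * _"] mult_right_mono)
  qed
qed

text \<open>Associativity of convolution joined with the convolution theorem. A bounded
  \<open>f\<close> need not have a Fourier transform that is a function, so the multiplier calculus
  is carried out on the kernels.\<close>

lemma conv_conv_inv_fourier:
  assumes f: "f \<in> borel_measurable borel" "\<And>x. norm (f x) \<le> M"
    and a: "a \<in> schwartz" and b: "b \<in> schwartz"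
  shows "conv (conv f (inv_fourier a)) (inv_fourier b) = conv f (inv_fourier (\<lambda>\<xi>. a \<xi> * b \<xi>))"
proof
  fix x
  let ?A = "inv_fourier a" and ?B = "inv_fourier b"
  have AB: "integrable lborel ?A" "integrable lborel ?B"
    using a b by (auto intro: schwartz_integrable inv_fourier_schwartz)
  have "conv f (inv_fourier (\<lambda>\<xi>. a \<xi> * b \<xi>)) x = (LINT w|lborel. LINT v|lborel. f (x - w) * ?A (w - v) * ?B v)"
    unfolding conv_inv_fourier[OF a b, symmetric] conv_def by (simp add: mult.assoc)
  also have "\<dots> = (LINT v|lborel. LINT w|lborel. f (x - w) * ?A (w - v) * ?B v)"
    by (rule lborel_Fubini_conv) (use f AB in auto)
  also have "\<dots> = conv (conv f ?A) ?B x"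
    unfolding conv_def
  proof (intro Bochner_Integration.integral_cong refl)
    fix v
    show "(LINT w|lborel. f (x - w) * ?A (w - v) * ?B v) = (LINT w|lborel. f (x - v - w) * ?A w) * ?B v"
      using lborel_integral_shift[of "\<lambda>w. f (x - v - w) * ?A w" v] by simp
  qed
  finally show "conv (conv f ?A) ?B x = conv f (inv_fourier (\<lambda>\<xi>. a \<xi> * b \<xi>)) x" ..
qed

section \<open>The norm of the modulation space\<close>

definition freq_cutoff :: "(real \<Rightarrow> real) \<Rightarrow> int \<Rightarrow> real \<Rightarrow> complex" where
  "freq_cutoff chi k = (\<lambda>\<xi>. of_real (chi (\<xi> - of_int k)))"

definition box_kernel :: "(real \<Rightarrow> real) \<Rightarrow> int \<Rightarrow> real \<Rightarrow> complex" where
  "box_kernel chi k = inv_fourier (freq_cutoff chi k)"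

section \<open>The partition of unity given by the window\<close>

lemma window_eq_0:
  assumes "window chi" "1 \<le> \<bar>\<xi>\<bar>"
  shows "chi \<xi> = 0"
proof (rule ccontr)
  assume "chi \<xi> \<noteq> 0"
  then have "\<xi> \<in> {\<xi>. chi \<xi> \<noteq> 0}"
    by simp
  then have "\<xi> \<in> closure {\<xi>. chi \<xi> \<noteq> 0}"
    by (rule subsetD[OF closure_subset])
  moreover have "closure {\<xi>. chi \<xi> \<noteq> 0} \<subseteq> {-1<..<1}"
    using assms(1) by (simp add: window_def)
  ultimately have "\<xi> \<in> {-1<..<1}"
    by (rule rev_subsetD)
  then show False
    using assms(2) by auto
qed

text \<open>Cutoffs with |\<xi> - k| >= 1 vanish at \<xi>, so the infinite partition of unity may be
  evaluated over any finite index set that contains the remaining k.\<close>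

lemma window_sum:
  assumes W: "window chi" and "finite B" "\<And>k. \<bar>\<xi> - of_int k\<bar> < 1 \<Longrightarrow> k \<in> B"
  shows "(\<Sum>k\<in>B. chi (\<xi> - of_int k)) = 1"
proof -
  have "((\<lambda>k. chi (\<xi> - of_int k)) has_sum (\<Sum>k\<in>B. chi (\<xi> - of_int k))) UNIV"
  proof (rule has_sum_finite_neutralI)
    show "chi (\<xi> - of_int k) = 0" if "k \<in> UNIV - B" for k
      using window_eq_0[OF W, of "\<xi> - of_int k"] assms(3)[of k] that by force
  qed (use assms in auto)
  moreover have "((\<lambda>k::int. chi (\<xi> - of_int k)) has_sum 1) UNIV"
    using W by (simp add: window_def)
  ultimately show ?thesis
    by (rule has_sum_unique)
qed

text \<open>At frequency 0 all shifts by k with |k| >= 1 vanish. This value normalises the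
  approximate identity and makes the mass of the squared window positive.\<close>

lemma window_0: "window chi \<Longrightarrow> chi 0 = 1"
  using window_sum[of chi "{0}" 0] by simp

lemma window_affine_schwartz:
  assumes W: "window chi" and "a \<noteq> 0"
  shows "(\<lambda>\<xi>. complex_of_real (chi (a * \<xi> + b))) \<in> schwartz"
proof (rule schwartz_compact_support)
  show "smooth (\<lambda>\<xi>. complex_of_real (chi (a * \<xi> + b)))"
    using W by (intro smooth_of_real smooth_affine) (auto simp: window_def)
  fix \<xi> assume "\<xi> \<notin> {- ((1 + \<bar>b\<bar>) / \<bar>a\<bar>)..(1 + \<bar>b\<bar>) / \<bar>a\<bar>}"
  then have "(1 + \<bar>b\<bar>) / \<bar>a\<bar> \<le> \<bar>\<xi>\<bar>"
    by auto
  then have "1 + \<bar>b\<bar> \<le> \<bar>a * \<xi>\<bar>"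
    using \<open>a \<noteq> 0\<close> by (simp add: pos_divide_le_eq abs_mult mult.commute)
  then have "1 \<le> \<bar>a * \<xi> + b\<bar>"
    by linarith
  then show "complex_of_real (chi (a * \<xi> + b)) = 0"
    using window_eq_0[OF W] by simp
qed

lemma freq_cutoff_schwartz: "window chi \<Longrightarrow> freq_cutoff chi k \<in> schwartz"
  using window_affine_schwartz[of chi 1 "- of_int k"] by (simp add: freq_cutoff_def)

lemma freq_cutoff_mult_schwartz:
  assumes W: "window chi" and \<phi>: "\<phi> \<in> schwartz"
  shows "(\<lambda>\<xi>. freq_cutoff chi k \<xi> * \<phi> \<xi>) \<in> schwartz"
proof (rule schwartz_compact_support)
  show "smooth (\<lambda>\<xi>. freq_cutoff chi k \<xi> * \<phi> \<xi>)"
    using freq_cutoff_schwartz[OF W] \<phi> by (intro smooth_mult schwartz_smooth)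
  fix \<xi> :: real assume "\<xi> \<notin> {- (1 + \<bar>of_int k\<bar>)..1 + \<bar>of_int k\<bar>}"
  then have "1 \<le> \<bar>\<xi> - of_int k\<bar>"
    by auto
  then show "freq_cutoff chi k \<xi> * \<phi> \<xi> = 0"
    using window_eq_0[OF W] by (simp add: freq_cutoff_def)
qed

lemma box_kernel_schwartz: "window chi \<Longrightarrow> box_kernel chi k \<in> schwartz"
  unfolding box_kernel_def by (intro inv_fourier_schwartz freq_cutoff_schwartz)

text \<open>This is the multiplier as seen by test functions: the dualities in \<open>box_op\<close>
  put the inverse transform inside and the transform outside, and the outcome is integration against
  the reflected kernel.\<close>

lemma fourier_mult_inv_fourier:
  assumes a: "a \<in> schwartz" and \<phi>: "\<phi> \<in> schwartz"
  shows "fourier (\<lambda>\<xi>. a \<xi> * inv_fourier \<phi> \<xi>) x = (LINT y|lborel. inv_fourier a (y - x) * \<phi> y)"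
proof -
  let ?F = "\<lambda>\<xi> y. exp (\<i> * of_real ((y - x) * \<xi>)) * a \<xi> * \<phi> y"
  have [measurable]: "a \<in> borel_measurable borel" "\<phi> \<in> borel_measurable borel"
    using a \<phi> by (auto intro: schwartz_measurable)
  have e: "exp (- \<i> * of_real (\<xi> * x)) * exp (\<i> * of_real (\<xi> * y)) = exp (\<i> * of_real ((y - x) * \<xi>))" for \<xi> y
    by (simp add: exp_add[symmetric] algebra_simps)
  have "fourier (\<lambda>\<xi>. a \<xi> * inv_fourier \<phi> \<xi>) x
      = (LINT \<xi>|lborel. of_real (1 / (2 * pi)) * (LINT y|lborel. ?F \<xi> y))"
    unfolding fourier_def
  proof (rule Bochner_Integration.integral_cong[OF refl])
    fix \<xi>
    have "(LINT y|lborel. ?F \<xi> y) = exp (- \<i> * of_real (\<xi> * x)) * a \<xi> * (LINT y|lborel. exp (\<i> * of_real (\<xi> * y)) * \<phi> y)"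
      unfolding integral_mult_right_zero[symmetric] e[symmetric] by (simp only: mult_ac)
    then show "exp (- \<i> * of_real (\<xi> * x)) * (a \<xi> * inv_fourier \<phi> \<xi>)
        = of_real (1 / (2 * pi)) * (LINT y|lborel. ?F \<xi> y)"
      by (simp only: inv_fourier_def mult_ac)
  qed
  also have "\<dots> = of_real (1 / (2 * pi)) * (LINT \<xi>|lborel. LINT y|lborel. ?F \<xi> y)"
    by simp
  also have "(LINT \<xi>|lborel. LINT y|lborel. ?F \<xi> y) = (LINT y|lborel. LINT \<xi>|lborel. ?F \<xi> y)"
  proof (rule lborel_Fubini_dominated)
    show "integrable lborel (\<lambda>y. (LINT \<xi>|lborel. norm (a \<xi>)) * norm (\<phi> y))"
      using schwartz_integrable[OF \<phi>] by simp
    show "(LINT \<xi>|lborel. norm (?F \<xi> y)) \<le> (LINT \<xi>|lborel. norm (a \<xi>)) * norm (\<phi> y)" for y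
      by (simp add: norm_mult)
    show "integrable lborel (\<lambda>\<xi>. ?F \<xi> y)" for y
      using integrable_exp_mult[OF schwartz_integrable[OF a], of 1 "y - x"] by (simp add: mult.commute)
  qed measurable
  also have "of_real (1 / (2 * pi)) * (LINT y|lborel. LINT \<xi>|lborel. ?F \<xi> y) = (LINT y|lborel. inv_fourier a (y - x) * \<phi> y)"
    by (simp add: inv_fourier_def flip: integral_mult_right_zero)
  finally show ?thesis .
qed

text \<open>Fubini's theorem moves the reflected kernel from the test function back to
  \<open>f\<close>, which undoes the reflection.\<close>

lemma box_op_dist_of:
  assumes W: "window chi" and f: "f \<in> borel_measurable borel" "\<And>x. norm (f x) \<le> M"
  shows "box_op chi k (dist_of f) = dist_of (conv f (box_kernel chi k))"
proof
  fix \<phi>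
  show "box_op chi k (dist_of f) \<phi> = dist_of (conv f (box_kernel chi k)) \<phi>"
  proof (cases "\<phi> \<in> schwartz")
    case True
    let ?a = "freq_cutoff chi k" and ?K = "box_kernel chi k"
    have 1: "inv_fourier \<phi> \<in> schwartz" "(\<lambda>\<xi>. ?a \<xi> * inv_fourier \<phi> \<xi>) \<in> schwartz"
      "fourier (\<lambda>\<xi>. ?a \<xi> * inv_fourier \<phi> \<xi>) \<in> schwartz"
      using True by (auto intro!: inv_fourier_schwartz fourier_schwartz freq_cutoff_mult_schwartz W)
    have K: "integrable lborel (\<lambda>x. ?K (- x))"
      using lborel_integrable_reflect[OF schwartz_integrable[OF box_kernel_schwartz[OF W, of k]], where t = 0] by simp
    have "box_op chi k (dist_of f) \<phi> = (LINT x|lborel. f x * fourier (\<lambda>\<xi>. ?a \<xi> * inv_fourier \<phi> \<xi>) x)"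
      using 1 True
      by (simp add: box_op_def inv_fourier_dist_def mult_dist_def fourier_dist_def dist_of_def freq_cutoff_def)
    also have "\<dots> = (LINT x|lborel. LINT y|lborel. f x * ?K (- (x - y)) * \<phi> y)"
      unfolding fourier_mult_inv_fourier[OF freq_cutoff_schwartz[OF W] True] box_kernel_def
      by (simp add: mult.assoc)
    also have "\<dots> = (LINT y|lborel. LINT x|lborel. f x * ?K (- (x - y)) * \<phi> y)"
      by (rule lborel_Fubini_conv[OF f K schwartz_integrable[OF True]])
    also have "\<dots> = dist_of (conv f ?K) \<phi>"
      using True by (simp add: dist_of_def conv_commute)
    finally show ?thesis .
  next
    case False
    then show ?thesis
      by (simp add: box_op_def inv_fourier_dist_def dist_of_def)
  qed
qed

section \<open>The norm of a distribution given by a continuous function\<close>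

lemma Linf_norm_dist_of_le:
  assumes "h \<in> borel_measurable borel"
  shows "Linf_norm (dist_of h) \<le> (SUP x. ennreal (norm (h x)))"
  unfolding Linf_norm_def
proof (rule INF_lower2)
  show "h \<in> {g \<in> borel_measurable lborel. dist_of h = dist_of g}"
    using assms by simp
  show "esssup lborel (\<lambda>x. ennreal (norm (h x))) \<le> (SUP x. ennreal (norm (h x)))"
    using assms by (intro esssup_I AE_I2) (auto intro: SUP_upper)
qed

lemma window_square_integral_pos:
  assumes "window chi"
  shows "integrable lborel (\<lambda>x. (chi x)\<^sup>2)" "0 < (LINT x|lborel. (chi x)\<^sup>2)"
proof -
  have S: "(\<lambda>x. complex_of_real (chi x)) \<in> schwartz"
    using window_affine_schwartz[OF assms, of 1 0] by simp
  have cont: "continuous_on UNIV chi"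
    using smooth_continuous_on[of chi UNIV 0] assms by (simp add: window_def)
  obtain C where C: "\<And>x. \<bar>chi x\<bar> \<le> C"
    using schwartz_bounded[OF S, of 0 0] by auto
  have "integrable lborel (\<lambda>x. complex_of_real (chi x) * complex_of_real (chi x))"
    by (rule integrable_bounded_mult[OF schwartz_measurable[OF S] _ schwartz_integrable[OF S]]) (use C in simp)
  from integrable_Re[OF this] show i: "integrable lborel (\<lambda>x. (chi x)\<^sup>2)"
    by (simp add: power2_eq_square)
  have "isCont chi 0"
    using cont by (simp add: continuous_on_eq_continuous_at)
  then obtain d where d: "d > 0" "\<And>x. \<bar>x\<bar> < d \<Longrightarrow> \<bar>chi x - 1\<bar> < 1/2"
    unfolding continuous_at_eps_delta window_0[OF assms]
    by (metis dist_real_def diff_zero half_gt_zero zero_less_one)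
  \<comment> \<open>For |x| <= d / 2 the window is at least 1/2 by continuity at 0, so its square is
    at least 1/4.\<close>
  have "0 < (LINT x|lborel. (1/4) * indicator {-d/2..d/2} x :: real)"
    using d(1) by simp
  also have "\<dots> \<le> (LINT x|lborel. (chi x)\<^sup>2)"
  proof (rule integral_mono[OF _ i])
    show "integrable lborel (\<lambda>x. 1 / 4 * indicat_real {- d / 2..d / 2} x)"
      by (intro integrable_mult_right integrable_real_indicator emeasure_bounded_finite) auto
    fix x
    show "1 / 4 * indicator {-d/2..d/2} x \<le> (chi x)\<^sup>2"
    proof (cases "x \<in> {-d/2..d/2}")
      case True
      then have "\<bar>chi x - 1\<bar> < 1/2"
        using d by (intro d(2)) auto
      then have "1/2 \<le> chi x"
        by linarith
      then have "(1/2)\<^sup>2 \<le> (chi x)\<^sup>2"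
        by (intro power_mono) auto
      then show ?thesis
        using True by (simp add: power2_eq_square)
    qed simp
  qed
  finally show "0 < (LINT x|lborel. (chi x)\<^sup>2)" .
qed

text \<open>A representative \<open>g\<close> of the same distribution has the same averages against
  test functions, and averages against dilations of the squared window recover \<open>h x\<close> by
  continuity. The square is taken because the window may change sign: the L1 norm of a nonnegative
  kernel equals its mass c, so the bound \<open>B\<close> carries over without loss.\<close>

lemma Linf_norm_dist_of_ge:
  assumes W: "window chi" and h: "continuous_on UNIV h" "\<And>x. norm (h x) \<le> M"
  shows "(SUP x. ennreal (norm (h x))) \<le> Linf_norm (dist_of h)"
  unfolding Linf_norm_def
proof (intro INF_greatest SUP_least)
  fix g x assume "g \<in> {g \<in> borel_measurable lborel. dist_of h = dist_of g}"
  then have g [measurable]: "g \<in> borel_measurable borel" and eq: "dist_of h = dist_of g"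
    by auto
  let ?E = "esssup lborel (\<lambda>x. ennreal (norm (g x)))"
  show "ennreal (norm (h x)) \<le> ?E"
  proof (cases "?E")
    case (real B)
    have "AE x in lborel. ennreal (norm (g x)) \<le> ennreal B"
      using esssup_AE[of "\<lambda>x. ennreal (norm (g x))" lborel] unfolding real .
    then have B: "AE x in lborel. norm (g x) \<le> B"
      using \<open>0 \<le> B\<close> by simp
    let ?K = "\<lambda>x. complex_of_real (chi x) * complex_of_real (chi x)"
    let ?Kn = "\<lambda>n y. of_nat (Suc n) * ?K (real (Suc n) * y)"
    define c where "c = (LINT x|lborel. (chi x)\<^sup>2)"
    have c: "c > 0" "integrable lborel (\<lambda>x. (chi x)\<^sup>2)"
      unfolding c_def using window_square_integral_pos[OF W] by auto
    have Ki: "integrable lborel ?K" "(LINT y|lborel. ?K y) = of_real c"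
    proof -
      have "?K = (\<lambda>x. complex_of_real ((chi x)\<^sup>2))"
        by (simp only: power2_eq_square of_real_mult)
      then show "integrable lborel ?K" "(LINT y|lborel. ?K y) = of_real c"
        unfolding c_def by (simp_all only: integrable_of_real[OF c(2)] integral_complex_of_real)
    qed
    have "norm (conv h (?Kn n) x) \<le> B * c" for n
    proof -
      let ?\<phi> = "\<lambda>y. ?Kn n (x - y)"
      have S: "?\<phi> \<in> schwartz"
      proof (rule schwartz_cmult, rule schwartz_compact_support)
        let ?c = "\<lambda>y. complex_of_real (chi (- real (Suc n) * y + real (Suc n) * x))"
        have "?c \<in> schwartz"
          by (rule window_affine_schwartz[OF W]) simp
        then have "smooth (\<lambda>y. ?c y * ?c y)"
          by (intro smooth_mult schwartz_smooth)
        moreover have "- real (Suc n) * y + real (Suc n) * x = real (Suc n) * (x - y)" for y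
          by (simp only: right_diff_distrib mult_minus_left)
        ultimately show "smooth (\<lambda>y. ?K (real (Suc n) * (x - y)))"
          by (simp only:)
        fix y assume "y \<notin> {- (\<bar>x\<bar> + 1)..\<bar>x\<bar> + 1}"
        then have "1 \<le> \<bar>x - y\<bar>"
          by auto
        then have "1 * 1 \<le> real (Suc n) * \<bar>x - y\<bar>"
          by (intro mult_mono) auto
        then have "1 \<le> \<bar>real (Suc n) * (x - y)\<bar>"
          by (simp only: abs_mult abs_of_nat)
        then show "?K (real (Suc n) * (x - y)) = 0"
          using window_eq_0[OF W] by simp
      qed
      have "conv h (?Kn n) x = dist_of h ?\<phi>"
        using S by (simp add: conv_commute dist_of_def)
      also have "\<dots> = (LINT y|lborel. g y * ?\<phi> y)"
        unfolding eq using S by (simp add: dist_of_def)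
      also have "norm \<dots> \<le> (LINT y|lborel. norm (g y * ?\<phi> y))"
        by (rule integral_norm_bound)
      also have "\<dots> \<le> (LINT y|lborel. B * norm (?\<phi> y))"
      proof (rule integral_mono_AE')
        show "integrable lborel (\<lambda>y. B * norm (?\<phi> y))"
          by (intro integrable_mult_right integrable_norm schwartz_integrable S)
        show "AE y in lborel. norm (g y * ?\<phi> y) \<le> B * norm (?\<phi> y)"
          using B by eventually_elim (simp add: norm_mult mult_right_mono)
        show "AE y in lborel. 0 \<le> B * norm (?\<phi> y)"
          using \<open>0 \<le> B\<close> by (intro AE_I2 mult_nonneg_nonneg norm_ge_zero)
      qed
      also have "\<dots> = B * (LINT y|lborel. norm (?Kn n y))"
        using lborel_integral_reflect[of "\<lambda>y. norm (?Kn n y)" x] by simp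
      also have "(LINT y|lborel. norm (?Kn n y)) = c"
      proof -
        have "norm (?Kn n y) = real (Suc n) * (chi (real (Suc n) * y))\<^sup>2" for y
          by (simp only: norm_mult norm_of_nat norm_of_real power2_eq_square abs_mult_self_eq)
        then show ?thesis
          unfolding c_def using lborel_integral_real_affine[of "real (Suc n)" "\<lambda>y. (chi y)\<^sup>2" 0]
          by (simp del: of_nat_Suc)
      qed
      finally show ?thesis .
    qed
    moreover have "(\<lambda>n. norm (conv h (?Kn n) x)) \<longlonglongrightarrow> norm (h x * (LINT y|lborel. ?K y))"
      by (intro tendsto_norm conv_dilation_tendsto[OF h Ki(1)])
    ultimately have "norm (h x * of_real c) \<le> B * c"
      unfolding Ki(2) by (intro LIMSEQ_le_const2) auto
    then have "norm (h x) \<le> B"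
      using c(1) by (simp add: norm_mult)
    then show ?thesis
      unfolding real by (rule ennreal_leI)
  qed simp
qed

text \<open>Removes distributions from the norm: the boxes are convolutions, and since these are
  continuous and bounded, the infimum over representatives is a plain supremum.\<close>

lemma Xnorm_eq:
  assumes W: "window chi" and f: "f \<in> borel_measurable borel" "\<And>x. norm (f x) \<le> M"
  shows "Xnorm chi s f = (\<Sum>\<^sub>\<infinity>k::int. ennreal (sqrt (1 + (of_int k)\<^sup>2) powr s) *
    (SUP x. ennreal (norm (conv f (box_kernel chi k) x))))"
proof -
  have "Linf_norm (box_op chi k (dist_of f)) = (SUP x. ennreal (norm (conv f (box_kernel chi k) x)))" for k
  proof -
    have K: "box_kernel chi k \<in> schwartz"
      using W by (rule box_kernel_schwartz)
    have h: "continuous_on UNIV (conv f (box_kernel chi k))"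
      by (rule conv_continuous_on[OF f K])
    show ?thesis
      unfolding box_op_dist_of[OF W f]
      using Linf_norm_dist_of_le[OF borel_measurable_continuous_onI[OF h]]
        Linf_norm_dist_of_ge[OF W h norm_conv_le[OF f schwartz_integrable[OF K]]]
      by (rule antisym)
  qed
  then show ?thesis
    unfolding Xnorm_dist_def by simp
qed

text \<open>At every point the k-th piece of \<open>g\<close> is a limit of values that the k-th
  piece of \<open>f\<close> takes elsewhere, because convolution commutes with translation. The
  comparison is thus termwise in k, with no limit theorem for the sum.\<close>

lemma Xnorm_translate_limit_le:
  assumes W: "window chi" and f: "f \<in> borel_measurable borel" "\<And>x. norm (f x) \<le> M"
    and lim: "\<And>x. (\<lambda>n. translate (y n) f x) \<longlonglongrightarrow> g x"
  shows "Xnorm chi s g \<le> Xnorm chi s f"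
proof -
  have [measurable]: "f \<in> borel_measurable borel"
    by fact
  have t: "translate z f \<in> borel_measurable borel" for z
    unfolding translate_def by measurable
  have g: "g \<in> borel_measurable borel"
    by (rule borel_measurable_LIMSEQ_metric[OF t lim])
  have gM: "norm (g x) \<le> M" for x
    using tendsto_norm[OF lim[of x]] by (rule LIMSEQ_le_const2) (use f in \<open>auto simp: translate_def\<close>)
  have "ennreal (norm (conv g (box_kernel chi k) x)) \<le> (SUP x. ennreal (norm (conv f (box_kernel chi k) x)))" for k x
  proof (rule LIMSEQ_le_const2)
    have "(\<lambda>n. conv (translate (y n) f) (box_kernel chi k) x) \<longlonglongrightarrow> conv g (box_kernel chi k) x"
      by (rule conv_tendsto[OF t _ _ lim])
        (use f schwartz_integrable[OF box_kernel_schwartz[OF W]] in \<open>auto simp: translate_def\<close>)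
    then show "(\<lambda>n. ennreal (norm (conv (translate (y n) f) (box_kernel chi k) x)))
        \<longlonglongrightarrow> ennreal (norm (conv g (box_kernel chi k) x))"
      by (intro tendsto_ennrealI tendsto_norm)
    show "\<exists>N. \<forall>n\<ge>N. ennreal (norm (conv (translate (y n) f) (box_kernel chi k) x))
        \<le> (SUP x. ennreal (norm (conv f (box_kernel chi k) x)))"
      unfolding conv_translate unfolding translate_def
      using SUP_upper[of "x + y _" UNIV "\<lambda>x. ennreal (norm (conv f (box_kernel chi k) x))"] by blast
  qed
  then show ?thesis
    unfolding Xnorm_eq[OF W f] Xnorm_eq[OF W g gM]
    by (intro infsum_mono mult_left_mono SUP_least) (auto intro: nonneg_summable_on_complete)
qed

text \<open>The seminorms of weight 0 and 2 and derivative order 0 dominate (1 + x^2) |\<phi>|, and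
  so the L1 norm of \<phi> up to the integral \<open>?J\<close>. Hence the order 2.\<close>

lemma tempered_dist_of:
  assumes f: "f \<in> borel_measurable borel" "\<And>x. norm (f x) \<le> M"
  shows "dist_of f \<in> tempered"
proof -
  have i: "integrable lborel (\<lambda>x. f x * \<phi> x)" if "\<phi> \<in> schwartz" for \<phi>
    by (rule integrable_bounded_mult[OF f schwartz_integrable[OF that]])
  have M: "0 \<le> M"
    using f(2)[of 0] norm_ge_zero order_trans by blast
  have add: "dist_of f (\<lambda>x. \<phi> x + \<psi> x) = dist_of f \<phi> + dist_of f \<psi>" if "\<phi> \<in> schwartz" "\<psi> \<in> schwartz" for \<phi> \<psi>
    using that i by (simp add: dist_of_def schwartz_add distrib_left)
  have mult: "dist_of f (\<lambda>x. c * \<phi> x) = c * dist_of f \<phi>" if "\<phi> \<in> schwartz" for c \<phi>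
    using that i by (simp add: dist_of_def schwartz_cmult mult.left_commute[of _ c])
  let ?J = "LINT x::real|lborel. 1 / (1 + x\<^sup>2)"
  have bound: "norm (dist_of f \<phi>) \<le> (M * ?J) * schwartz_norm 2 \<phi>" if \<phi>: "\<phi> \<in> schwartz" for \<phi>
  proof -
    let ?s = "\<lambda>m k. SUP x. \<bar>x\<bar> ^ m * norm (nderiv k \<phi> x)"
    have up: "\<bar>x\<bar> ^ m * norm (nderiv k \<phi> x) \<le> ?s m k" for m k x
    proof (rule cSUP_upper)
      obtain B where "\<And>x. \<bar>x\<bar> ^ m * norm (nderiv k \<phi> x) \<le> B" "0 \<le> B"
        by (rule schwartz_bounded[OF \<phi>, of m k]) blast
      then show "bdd_above (range (\<lambda>x. \<bar>x\<bar> ^ m * norm (nderiv k \<phi> x)))"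
        by (auto simp: bdd_above_def)
    qed simp
    have nonneg: "0 \<le> ?s m k" for m k
      using up[of 0 m k] by (rule order_trans[rotated]) simp
    have row: "?s m 0 \<le> (\<Sum>k\<le>2. ?s m k)" for m
      by (rule member_le_sum[where f = "?s m"]) (use nonneg in auto)
    have "?s 0 0 + ?s 2 0 \<le> (\<Sum>k\<le>2. ?s 0 k) + (\<Sum>k\<le>2. ?s 2 k)"
      using row[of 0] row[of 2] by linarith
    also have "\<dots> = (\<Sum>m\<in>{0, 2}. \<Sum>k\<le>2. ?s m k)"
      by simp
    also have "\<dots> \<le> schwartz_norm 2 \<phi>"
      unfolding schwartz_norm_def by (rule sum_mono2) (use nonneg in \<open>auto intro!: sum_nonneg\<close>)
    finally have N: "?s 0 0 + ?s 2 0 \<le> schwartz_norm 2 \<phi>" .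
    have "norm (\<phi> x) \<le> schwartz_norm 2 \<phi> * (1 / (1 + x\<^sup>2))" for x
    proof -
      have "norm (\<phi> x) * (1 + x\<^sup>2) \<le> schwartz_norm 2 \<phi>"
        using up[of x 0 0] up[of x 2 0] N by (simp add: algebra_simps)
      moreover have "1 + x\<^sup>2 > 0"
        by (rule add_pos_nonneg) auto
      ultimately show ?thesis
        by (simp add: pos_le_divide_eq)
    qed
    then have "(LINT x|lborel. norm (\<phi> x)) \<le> (LINT x|lborel. schwartz_norm 2 \<phi> * (1 / (1 + x\<^sup>2)))"
      by (intro integral_mono integrable_norm schwartz_integrable \<phi> integrable_mult_right integrable_1_over_1_plus_square)
    also have "\<dots> = schwartz_norm 2 \<phi> * ?J"
      by (rule integral_mult_right_zero)
    finally have "M * (LINT x|lborel. norm (\<phi> x)) \<le> M * (schwartz_norm 2 \<phi> * ?J)"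
      using M by (rule mult_left_mono)
    then show ?thesis
      using norm_integral_bounded_mult_le[OF f schwartz_integrable[OF \<phi>]] \<phi>
      by (simp add: dist_of_def mult_ac)
  qed
  have ext: "dist_of f \<in> extensional schwartz"
    by (simp add: dist_of_def)
  show ?thesis
    unfolding tempered_def using ext add mult bound by blast
qed

lemma X_iff:
  "f \<in> X chi s \<longleftrightarrow> continuous_on UNIV f \<and> bounded (range f) \<and> Xnorm chi s f < \<infinity>"
proof -
  have "dist_of f \<in> tempered" if c: "continuous_on UNIV f" and b: "bounded (range f)"
  proof -
    obtain M where "\<And>x. norm (f x) \<le> M"
      using b by (auto simp: bounded_iff)
    then show ?thesis
      using tempered_dist_of[OF borel_measurable_continuous_onI[OF c]] by blast
  qed
  then show ?thesis
    by (auto simp: X_def X_dist_def)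
qed

lemma X_bounded:
  assumes "f \<in> X chi s"
  obtains M where "\<And>x. norm (f x) \<le> M" "f \<in> borel_measurable borel"
  using assms by (auto simp: X_iff bounded_iff intro: borel_measurable_continuous_onI)

lemma X_translate_limit:
  assumes W: "window chi" and f: "f \<in> X chi s"
    and lim: "\<And>x. (\<lambda>n. translate (y n) f x) \<longlonglongrightarrow> g x" and g: "continuous_on UNIV g"
  shows "g \<in> X chi s" "Xnorm chi s g \<le> Xnorm chi s f"
proof -
  obtain M where M: "\<And>x. norm (f x) \<le> M" "f \<in> borel_measurable borel"
    using X_bounded[OF f] by blast
  show le: "Xnorm chi s g \<le> Xnorm chi s f"
    by (rule Xnorm_translate_limit_le[OF W M(2,1) lim])
  have "norm (g x) \<le> M" for x
    using tendsto_norm[OF lim[of x]] by (rule LIMSEQ_le_const2) (use M in \<open>auto simp: translate_def\<close>)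
  then have "bounded (range g)"
    by (auto simp: bounded_iff)
  then show "g \<in> X chi s"
    using f g le by (auto simp: X_iff intro: order.strict_trans1)
qed

section \<open>Embedding into five times differentiable functions\<close>

lemma inv_fourier_nderiv:
  assumes a: "a \<in> schwartz"
  shows "nderiv j (inv_fourier a) = inv_fourier (\<lambda>\<xi>. (\<i> * of_real \<xi>) ^ j * a \<xi>)"
proof -
  let ?a = "\<lambda>j \<xi>. (\<i> * of_real \<xi>) ^ j * a \<xi>"
  have S: "?a j \<in> schwartz" for j
    using schwartz_mult_power[OF a] .
  have d: "(inv_fourier (?a j) has_vector_derivative inv_fourier (?a (Suc j)) x) (at x)" for j x
    unfolding inv_fourier_eq_FT
    using FT_has_vector_derivative[OF S, of 1 j x]
    by (intro derivative_intros) (simp add: mult.assoc)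
  have "nderiv j (inv_fourier (?a 0)) = inv_fourier (?a j)"
    by (rule smoothI(2)[of "\<lambda>j. inv_fourier (?a j)", OF refl d])
  then show ?thesis
    by simp
qed

text \<open>A shift in frequency is a modulation, which leaves absolute values alone; kernels of
  shifted cutoffs have equal L1 norms.\<close>

lemma inv_fourier_shift: "inv_fourier (\<lambda>\<xi>. b (\<xi> - c)) x = exp (\<i> * of_real (x * c)) * inv_fourier b x"
proof -
  have "(LINT \<xi>|lborel. exp (\<i> * of_real (x * \<xi>)) * b (\<xi> - c))
      = (LINT \<xi>|lborel. exp (\<i> * of_real (x * (\<xi> + c))) * b \<xi>)"
    using lborel_integral_shift[of "\<lambda>\<xi>. exp (\<i> * of_real (x * (\<xi> + c))) * b \<xi>" c] by simp
  also have "\<dots> = (LINT \<xi>|lborel. exp (\<i> * of_real (x * c)) * (exp (\<i> * of_real (x * \<xi>)) * b \<xi>))"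
    by (intro Bochner_Integration.integral_cong refl) (simp add: exp_add[symmetric] algebra_simps)
  finally show ?thesis
    by (simp add: inv_fourier_def)
qed

lemma inv_fourier_add:
  assumes "integrable lborel a" "integrable lborel b"
  shows "inv_fourier (\<lambda>\<xi>. a \<xi> + b \<xi>) x = inv_fourier a x + inv_fourier b x"
  using integrable_exp_mult[OF assms(1), of 1 x] integrable_exp_mult[OF assms(2), of 1 x]
  by (simp add: inv_fourier_eq_FT FT_def distrib_left add_divide_distrib)

lemma inv_fourier_cmult: "inv_fourier (\<lambda>\<xi>. c * a \<xi>) x = c * inv_fourier a x"
  by (simp add: inv_fourier_def mult.left_commute[of _ c])

lemma inv_fourier_sum:
  assumes "\<And>i. i \<in> A \<Longrightarrow> integrable lborel (a i)" "finite A"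
  shows "inv_fourier (\<lambda>\<xi>. \<Sum>i\<in>A. a i \<xi>) x = (\<Sum>i\<in>A. inv_fourier (a i) x)"
  using assms(2,1)
proof (induction A)
  case empty
  then show ?case
    by (simp add: inv_fourier_def)
next
  case (insert i A)
  then have "inv_fourier (\<lambda>\<xi>. a i \<xi> + (\<Sum>i\<in>A. a i \<xi>)) x = inv_fourier (a i) x + inv_fourier (\<lambda>\<xi>. \<Sum>i\<in>A. a i \<xi>) x"
    by (intro inv_fourier_add Bochner_Integration.integrable_sum) auto
  then show ?case
    using insert by simp
qed

lemma inv_fourier_dilation:
  assumes "c > 0"
  shows "inv_fourier (\<lambda>\<xi>. a (\<xi> / c)) x = of_real c * inv_fourier a (c * x)"
  unfolding inv_fourier_def
  using lborel_integral_real_affine[of c "\<lambda>\<xi>. exp (\<i> * of_real (x * \<xi>)) * a (\<xi> / c)" 0] assms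
  by (simp add: scaleR_conv_of_real mult_ac)

text \<open>Multiplication by the fattened cutoff \<open>\<chi>\<^sub>k\<^sub>-\<^sub>1 + \<chi>\<^sub>k + \<chi>\<^sub>k\<^sub>+\<^sub>1\<close> fixes \<open>\<chi>\<^sub>k\<close>, so differentiating the
  \<open>k\<close>-th piece is convolution with a modulated kernel of integral norm linear in \<open>k\<close>.\<close>

definition fat_cutoff :: "(real \<Rightarrow> real) \<Rightarrow> int \<Rightarrow> real \<Rightarrow> complex" where
  "fat_cutoff chi k = (\<lambda>\<xi>. \<Sum>l\<in>{k - 1, k, k + 1}. freq_cutoff chi l \<xi>)"

text \<open>Two cutoffs overlap only if their indices differ by at most 1, so wherever the k-th one
  is nonzero the three neighbours already sum to 1.\<close>

lemma freq_cutoff_mult_fat: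
  assumes W: "window chi"
  shows "freq_cutoff chi k \<xi> * fat_cutoff chi k \<xi> = freq_cutoff chi k \<xi>"
proof (cases "\<bar>\<xi> - of_int k\<bar> < 1")
  case True
  have "(\<Sum>l\<in>{k - 1, k, k + 1}. chi (\<xi> - of_int l)) = 1"
  proof (rule window_sum[OF W])
    fix l :: int assume "\<bar>\<xi> - of_int l\<bar> < 1"
    then have "real_of_int \<bar>l - k\<bar> < 2"
      using True by linarith
    then have "\<bar>l - k\<bar> < 2"
      by linarith
    then show "l \<in> {k - 1, k, k + 1}"
      by auto
  qed simp
  then have "fat_cutoff chi k \<xi> = 1"
    unfolding fat_cutoff_def freq_cutoff_def by (metis of_real_1 of_real_sum)
  then show ?thesis
    by simp
next
  case False
  then show ?thesis
    using window_eq_0[OF W] by (simp add: freq_cutoff_def)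
qed

lemma fat_cutoff_schwartz:
  assumes "window chi"
  shows "fat_cutoff chi k \<in> schwartz"
proof -
  have "(\<lambda>\<xi>. freq_cutoff chi (k - 1) \<xi> + (freq_cutoff chi k \<xi> + freq_cutoff chi (k + 1) \<xi>)) \<in> schwartz"
    by (intro schwartz_add freq_cutoff_schwartz assms)
  then show ?thesis
    by (simp add: fat_cutoff_def add.assoc)
qed

text \<open>Writing \<xi> = (\<xi> - k) + k and shifting to frequency 0 leaves two fixed kernels,
  the second with coefficient k; the modulation drops out of the norm. The constant is 1 plus both
  kernel norms, the 1 ensuring \<open>1 \<le> C\<close>, so that powers of the bound increase with
  the exponent.\<close>

lemma bernstein_kernel_bound:
  assumes W: "window chi"
  obtains C where "1 \<le> C"
    "\<And>k. (LINT x|lborel. norm (inv_fourier (\<lambda>\<xi>. \<i> * of_real \<xi> * fat_cutoff chi k \<xi>) x)) \<le> C * (1 + \<bar>of_int k\<bar>)"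
proof -
  let ?a = "\<lambda>\<xi>. \<i> * of_real \<xi> * fat_cutoff chi 0 \<xi>" and ?b = "\<lambda>\<xi>. \<i> * fat_cutoff chi 0 \<xi>"
  have F: "fat_cutoff chi k \<in> schwartz" for k
    by (rule fat_cutoff_schwartz[OF W])
  have S: "(\<lambda>\<xi>. \<i> * of_real \<xi> * fat_cutoff chi k \<xi>) \<in> schwartz" "?b \<in> schwartz" for k
    using schwartz_mult_power[OF F, of \<i> 1] schwartz_cmult[OF F] by simp_all
  let ?A = "LINT x|lborel. norm (inv_fourier ?a x)" and ?B = "LINT x|lborel. norm (inv_fourier ?b x)"
  have AB: "0 \<le> ?A" "0 \<le> ?B"
    by (rule integral_nonneg_AE; simp)+
  have i: "integrable lborel (inv_fourier (\<lambda>\<xi>. \<i> * of_real \<xi> * fat_cutoff chi k \<xi>))" "integrable lborel (inv_fourier ?b)" for k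
    by (intro schwartz_integrable inv_fourier_schwartz S)+
  have "(LINT x|lborel. norm (inv_fourier (\<lambda>\<xi>. \<i> * of_real \<xi> * fat_cutoff chi k \<xi>) x)) \<le> (1 + ?A + ?B) * (1 + \<bar>of_int k\<bar>)" for k
  proof -
    have sh: "fat_cutoff chi k \<xi> = fat_cutoff chi 0 (\<xi> - of_int k)" for \<xi>
      by (simp add: fat_cutoff_def freq_cutoff_def algebra_simps)
    have "norm (inv_fourier (\<lambda>\<xi>. \<i> * of_real \<xi> * fat_cutoff chi k \<xi>) x)
        \<le> norm (inv_fourier ?a x) + \<bar>of_int k\<bar> * norm (inv_fourier ?b x)" for x
    proof -
      have "inv_fourier (\<lambda>\<xi>. \<i> * of_real \<xi> * fat_cutoff chi k \<xi>) x
          = inv_fourier (\<lambda>\<xi>. (\<lambda>\<eta>. ?a \<eta> + of_int k * ?b \<eta>) (\<xi> - of_int k)) x"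
        by (simp add: sh algebra_simps)
      also have "\<dots> = exp (\<i> * of_real (x * of_int k)) * inv_fourier (\<lambda>\<eta>. ?a \<eta> + of_int k * ?b \<eta>) x"
        by (rule inv_fourier_shift)
      also have "inv_fourier (\<lambda>\<eta>. ?a \<eta> + of_int k * ?b \<eta>) x = inv_fourier ?a x + inv_fourier (\<lambda>\<eta>. of_int k * ?b \<eta>) x"
        by (intro inv_fourier_add schwartz_integrable S schwartz_cmult[OF S(2)])
      also have "inv_fourier (\<lambda>\<eta>. of_int k * ?b \<eta>) x = of_int k * inv_fourier ?b x"
        by (rule inv_fourier_cmult)
      finally have "norm (inv_fourier (\<lambda>\<xi>. \<i> * of_real \<xi> * fat_cutoff chi k \<xi>) x)
          = norm (inv_fourier ?a x + of_int k * inv_fourier ?b x)"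
        by (simp only: norm_mult norm_exp_i_times mult_1)
      also have "\<dots> \<le> norm (inv_fourier ?a x) + norm (of_int k * inv_fourier ?b x)"
        by (rule norm_triangle_ineq)
      finally show ?thesis
        by (simp only: norm_mult norm_of_int)
    qed
    then have "(LINT x|lborel. norm (inv_fourier (\<lambda>\<xi>. \<i> * of_real \<xi> * fat_cutoff chi k \<xi>) x))
        \<le> (LINT x|lborel. norm (inv_fourier ?a x) + \<bar>of_int k\<bar> * norm (inv_fourier ?b x))"
      by (intro integral_mono integrable_norm i Bochner_Integration.integrable_add integrable_mult_right)
    also have "\<dots> = ?A + \<bar>of_int k\<bar> * ?B"
      by (subst Bochner_Integration.integral_add) (auto intro!: integrable_norm i integrable_mult_right)
    also have "\<dots> \<le> (1 + ?A + ?B) * (1 + \<bar>of_int k\<bar>)"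
      using AB by (simp add: algebra_simps)
    finally show ?thesis .
  qed
  with AB that[of "1 + ?A + ?B"] show ?thesis
    by simp
qed

lemma nderiv_conv_box:
  assumes W: "window chi" and f: "f \<in> borel_measurable borel" "\<And>x. norm (f x) \<le> M"
  shows "(conv f (nderiv j (box_kernel chi k)) has_vector_derivative conv f (nderiv (Suc j) (box_kernel chi k)) x) (at x)"
proof -
  have "nderiv (Suc 0) (nderiv j (box_kernel chi k)) = nderiv (Suc j) (box_kernel chi k)"
    by (simp add: nderiv_def)
  then show ?thesis
    using conv_has_vector_derivative[OF f schwartz_nderiv[OF box_kernel_schwartz[OF W]], of j k x] by simp
qed

text \<open>The multiplier of order j + 1 is that of order j times i \<xi> and the fattened cutoff,
  since the latter leaves the k-th cutoff unchanged. One more derivative is one more convolution and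
  costs one kernel norm.\<close>

lemma bernstein_step:
  assumes W: "window chi" and f: "f \<in> borel_measurable borel" "\<And>x. norm (f x) \<le> M"
    and C: "(LINT x|lborel. norm (inv_fourier (\<lambda>\<xi>. \<i> * of_real \<xi> * fat_cutoff chi k \<xi>) x)) \<le> C"
    and A: "\<And>x. norm (conv f (nderiv j (box_kernel chi k)) x) \<le> A"
  shows "norm (conv f (nderiv (Suc j) (box_kernel chi k)) x) \<le> A * C"
proof -
  let ?a = "\<lambda>\<xi>. (\<i> * of_real \<xi>) ^ j * freq_cutoff chi k \<xi>" and ?b = "\<lambda>\<xi>. \<i> * of_real \<xi> * fat_cutoff chi k \<xi>"
  have S: "?a \<in> schwartz" "?b \<in> schwartz"
    using schwartz_mult_power[OF freq_cutoff_schwartz[OF W]] schwartz_mult_power[OF fat_cutoff_schwartz[OF W], of \<i> 1]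
    by simp_all
  have a: "nderiv j (box_kernel chi k) = inv_fourier ?a"
    unfolding box_kernel_def by (rule inv_fourier_nderiv[OF freq_cutoff_schwartz[OF W]])
  have ab: "?a \<xi> * ?b \<xi> = (\<i> * of_real \<xi>) ^ Suc j * freq_cutoff chi k \<xi>" for \<xi>
  proof -
    have "?a \<xi> * ?b \<xi> = (\<i> * of_real \<xi>) ^ Suc j * (freq_cutoff chi k \<xi> * fat_cutoff chi k \<xi>)"
      by (simp only: power_Suc mult_ac)
    then show ?thesis
      unfolding freq_cutoff_mult_fat[OF W] .
  qed
  have "nderiv (Suc j) (box_kernel chi k) = inv_fourier (\<lambda>\<xi>. (\<i> * of_real \<xi>) ^ Suc j * freq_cutoff chi k \<xi>)"
    unfolding box_kernel_def by (rule inv_fourier_nderiv[OF freq_cutoff_schwartz[OF W]])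
  then have "norm (conv f (nderiv (Suc j) (box_kernel chi k)) x) = norm (conv (conv f (inv_fourier ?a)) (inv_fourier ?b) x)"
    unfolding conv_conv_inv_fourier[OF f S] ab by simp
  also have "\<dots> \<le> A * (LINT x|lborel. norm (inv_fourier ?b x))"
  proof (rule norm_conv_le)
    show "conv f (inv_fourier ?a) \<in> borel_measurable borel"
      by (intro borel_measurable_continuous_onI conv_continuous_on[OF f] inv_fourier_schwartz S)
    show "norm (conv f (inv_fourier ?a) x) \<le> A" for x
      using A unfolding a .
  qed (intro schwartz_integrable inv_fourier_schwartz S)
  also have "\<dots> \<le> A * C"
    using A[of 0] by (intro mult_left_mono C) (rule order_trans[OF norm_ge_zero])
  finally show ?thesis .
qed

text \<open>Trades the linear factor of Bernstein's inequality for the weight of the norm; the 2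
  enters the constant (2 C0)^5.\<close>

lemma weight_ge: "1 + \<bar>x\<bar> \<le> 2 * sqrt (1 + x\<^sup>2)" for x :: real
proof -
  have "1 \<le> sqrt (1 + x\<^sup>2)" "\<bar>x\<bar> \<le> sqrt (1 + x\<^sup>2)"
    by (rule real_le_rsqrt; simp)+
  then show ?thesis
    by linarith
qed

text \<open>The majorant is (2 C0)^5 <k>^5 times the supremum of the k-th piece, with
  \<open>k = int_decode i\<close>; enumerating the integers turns the unordered sum into a series
  fit for the Weierstrass test. As \<open>C\<close> does not depend on \<open>f\<close>, differences
  of time slices can be inserted later.\<close>

lemma X5_pieces:
  assumes W: "window chi"
  obtains C where "0 \<le> C" "\<And>f. f \<in> X chi 5 \<Longrightarrow> \<exists>b. (\<forall>i. 0 \<le> b i) \<and> summable b \<and>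
      suminf b \<le> C * enn2real (Xnorm chi 5 f) \<and>
      (\<forall>j\<le>5. \<forall>i x. norm (conv f (nderiv j (box_kernel chi (int_decode i))) x) \<le> b i)"
proof -
  obtain C0 where C0: "1 \<le> C0"
    "\<And>k. (LINT x|lborel. norm (inv_fourier (\<lambda>\<xi>. \<i> * of_real \<xi> * fat_cutoff chi k \<xi>) x)) \<le> C0 * (1 + \<bar>of_int k\<bar>)"
    by (rule bernstein_kernel_bound[OF W]) blast
  show ?thesis
  proof (rule that[of "(2 * C0) ^ 5"])
    fix f assume f: "f \<in> X chi 5"
    obtain M where M: "\<And>x. norm (f x) \<le> M" "f \<in> borel_measurable borel"
      by (rule X_bounded[OF f]) blast
    define S where "S k = (SUP x. ennreal (norm (conv f (box_kernel chi k) x)))" for k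
    define w where "w k = sqrt (1 + (real_of_int k)\<^sup>2) powr 5" for k
    define N where "N = enn2real (Xnorm chi 5 f)"
    have w: "1 \<le> w k" for k
      unfolding w_def by (intro ge_one_powr_ge_zero) auto
    have X: "Xnorm chi 5 f = (\<Sum>\<^sub>\<infinity>k. ennreal (w k) * S k)"
      unfolding S_def w_def by (rule Xnorm_eq[OF W M(2,1)])
    have fin: "Xnorm chi 5 f < \<infinity>"
      using f by (simp add: X_iff)
    then have N: "Xnorm chi 5 f = ennreal N"
      by (simp add: N_def)
    have part: "(\<Sum>k\<in>F. ennreal (w k) * S k) \<le> ennreal N" if "finite F" for F
      unfolding N[symmetric] X
      by (subst nonneg_infsum_complete) (use that in \<open>auto intro!: SUP_upper\<close>)
    have S: "S k < \<infinity>" for k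
    proof -
      have "1 * S k \<le> ennreal (w k) * S k"
        using ennreal_leI[OF w[of k]] by (intro mult_right_mono) simp_all
      also have "\<dots> \<le> ennreal N"
        using part[of "{k}"] by simp
      finally show ?thesis
        by (simp add: order.strict_trans1)
    qed
    define a where "a k = enn2real (S k)" for k
    have a: "0 \<le> a k" "S k = ennreal (a k)" for k
      using S[of k] by (auto simp: a_def)
    have conv_a: "norm (conv f (box_kernel chi k) x) \<le> a k" for k x
    proof -
      have "ennreal (norm (conv f (box_kernel chi k) x)) \<le> S k"
        unfolding S_def by (rule SUP_upper) simp
      then show ?thesis
        using a[of k] by simp
    qed
    have part_real: "(\<Sum>k\<in>F. w k * a k) \<le> N" if "finite F" for F
    proof -
      have "(\<Sum>k\<in>F. ennreal (w k) * S k) = ennreal (\<Sum>k\<in>F. w k * a k)"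
        using a w by (subst sum_ennreal[symmetric])
          (auto simp: ennreal_mult'' intro!: mult_nonneg_nonneg order_trans[OF zero_le_one w])
      then have "ennreal (\<Sum>k\<in>F. w k * a k) \<le> ennreal N"
        using part[OF that] by simp
      then show ?thesis
        by (simp add: N_def ennreal_le_iff)
    qed
    let ?b = "\<lambda>i. (2 * C0) ^ 5 * (w (int_decode i) * a (int_decode i))"
    have wa: "0 \<le> w k * a k" for k
      using w[of k] a(1)[of k] by (intro mult_nonneg_nonneg) auto
    have "(\<Sum>i<n. w (int_decode i) * a (int_decode i)) \<le> N" for n
      using part_real[of "int_decode ` {..<n}"] by (simp add: sum.reindex[OF inj_int_decode])
    then have summ: "summable (\<lambda>i. w (int_decode i) * a (int_decode i))"
      and sum_le: "(\<Sum>i. w (int_decode i) * a (int_decode i)) \<le> N"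
      using wa by (auto intro!: summableI_nonneg_bounded suminf_le_const)
    have bound: "norm (conv f (nderiv j (box_kernel chi k)) x) \<le> (2 * C0) ^ 5 * (w k * a k)" if "j \<le> 5" for j k x
    proof -
      let ?q = "C0 * (1 + \<bar>real_of_int k\<bar>)"
      have "1 * 1 \<le> ?q"
        using C0(1) by (intro mult_mono) auto
      have "norm (conv f (nderiv j (box_kernel chi k)) x) \<le> a k * ?q ^ j" for x
      proof (induction j arbitrary: x)
        case 0
        then show ?case
          using conv_a by simp
      next
        case (Suc j)
        then show ?case
          using bernstein_step[OF W M(2,1) C0(2), of j k "a k * ?q ^ j" x] by (simp add: mult_ac)
      qed
      \<comment> \<open>Since \<open>?q\<close> is at least 1, the fifth power serves all orders j
        <= 5 at once.\<close>
      also have "a k * ?q ^ j \<le> a k * ?q ^ 5"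
        using that a(1) \<open>1 * 1 \<le> ?q\<close> by (intro mult_left_mono power_increasing) auto
      also have "\<dots> \<le> a k * (C0 * (2 * sqrt (1 + (real_of_int k)\<^sup>2))) ^ 5"
        using a(1) C0(1) weight_ge by (intro mult_left_mono power_mono) auto
      also have "\<dots> = (2 * C0) ^ 5 * (w k * a k)"
      proof -
        have "w k = sqrt (1 + (real_of_int k)\<^sup>2) ^ 5"
          unfolding w_def using powr_realpow[of "sqrt (1 + (real_of_int k)\<^sup>2)" 5]
          by (simp add: add_pos_nonneg)
        then show ?thesis
          by (simp add: power_mult_distrib mult_ac)
      qed
      finally show ?thesis .
    qed
    have C: "0 \<le> (2 * C0) ^ 5"
      using C0(1) by simp
    have "suminf ?b = (2 * C0) ^ 5 * (\<Sum>i. w (int_decode i) * a (int_decode i))"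
      by (rule suminf_mult[OF summ])
    also have "\<dots> \<le> (2 * C0) ^ 5 * N"
      by (rule mult_left_mono[OF sum_le C])
    finally have "suminf ?b \<le> (2 * C0) ^ 5 * N" .
    moreover have "summable ?b"
      by (rule summable_mult[OF summ])
    moreover have "0 \<le> ?b i" for i
      by (rule mult_nonneg_nonneg[OF C wa])
    ultimately show "\<exists>b. (\<forall>i. 0 \<le> b i) \<and> summable b \<and>
      suminf b \<le> (2 * C0) ^ 5 * enn2real (Xnorm chi 5 f) \<and>
      (\<forall>j\<le>5. \<forall>i x. norm (conv f (nderiv j (box_kernel chi (int_decode i))) x) \<le> b i)"
      using bound unfolding N_def[symmetric] by (intro exI[of _ ?b] conjI allI impI) auto
  qed (use C0(1) in simp)
qed

text \<open>Both sides are convolved with the dilated kernels \<open>\<F>\<^sup>-\<^sup>1 (\<chi> (\<xi> / n))\<close>, an approximate identity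
  with compactly supported Fourier transform; against each of them the sum is finite.\<close>

lemma sum_conv_box_kernel:
  assumes W: "window chi" and f: "continuous_on UNIV f" "\<And>x. norm (f x) \<le> M"
    and h: "continuous_on UNIV h" "\<And>x. norm (h x) \<le> B"
    and S: "\<And>n x. norm (\<Sum>i<n. conv f (box_kernel chi (int_decode i)) x) \<le> B"
    and lim: "\<And>x. (\<lambda>n. \<Sum>i<n. conv f (box_kernel chi (int_decode i)) x) \<longlonglongrightarrow> h x"
  shows "f = h"
proof
  fix x
  have fm: "f \<in> borel_measurable borel"
    using f(1) by (rule borel_measurable_continuous_onI)
  let ?a = "\<lambda>n \<xi>. freq_cutoff chi 0 (\<xi> / real (Suc n))"
  have aS: "?a n \<in> schwartz" for n
    using window_affine_schwartz[OF W, of "1 / real (Suc n)" 0] by (simp add: freq_cutoff_def del: of_nat_Suc)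
  have K: "integrable lborel (box_kernel chi 0)"
    by (rule schwartz_integrable[OF box_kernel_schwartz[OF W]])
  have Kn: "inv_fourier (?a n) = (\<lambda>y. of_nat (Suc n) * box_kernel chi 0 (real (Suc n) * y))" for n
    unfolding box_kernel_def by (rule ext) (subst inv_fourier_dilation; simp del: of_nat_Suc)
  \<comment> \<open>The mass of the kernel is its Fourier transform at 0, which by inversion is the
    window at 0.\<close>
  have mean: "(LINT y|lborel. box_kernel chi 0 y) = 1"
  proof -
    have "(LINT y|lborel. box_kernel chi 0 y) = fourier (box_kernel chi 0) 0"
      by (simp add: fourier_def)
    also have "\<dots> = 1"
      unfolding box_kernel_def fourier_inv_fourier[OF freq_cutoff_schwartz[OF W]]
      by (simp add: freq_cutoff_def window_0[OF W])
    finally show ?thesis .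
  qed
  have eq: "conv f (inv_fourier (?a n)) x = conv h (inv_fourier (?a n)) x" for n
  proof -
    have ai: "integrable lborel (inv_fourier (?a n))"
      by (intro schwartz_integrable inv_fourier_schwartz aS)
    let ?S = "\<lambda>m x. \<Sum>i<m. conv f (box_kernel chi (int_decode i)) x"
    have piece: "continuous_on UNIV (conv f (box_kernel chi k))" for k
      by (rule conv_continuous_on[OF fm f(2) box_kernel_schwartz[OF W]])
    have "?S m \<in> borel_measurable borel" for m
      by (intro borel_measurable_continuous_onI continuous_on_sum piece)
    then have lim1: "(\<lambda>m. conv (?S m) (inv_fourier (?a n)) x) \<longlonglongrightarrow> conv h (inv_fourier (?a n)) x"
      by (rule conv_tendsto[OF _ S ai lim])
    have prodS: "(\<lambda>\<xi>. freq_cutoff chi k \<xi> * ?a n \<xi>) \<in> schwartz" for k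
      by (rule freq_cutoff_mult_schwartz[OF W aS])
    have S_eq: "conv (?S m) (inv_fourier (?a n)) x
        = conv f (inv_fourier (\<lambda>\<xi>. \<Sum>i<m. freq_cutoff chi (int_decode i) \<xi> * ?a n \<xi>)) x" for m
    proof -
      have "conv (?S m) (inv_fourier (?a n)) x = (\<Sum>i<m. conv (conv f (box_kernel chi (int_decode i))) (inv_fourier (?a n)) x)"
        unfolding conv_def[of _ "inv_fourier (?a n)"] sum_distrib_right
      proof (rule Bochner_Integration.integral_sum)
        fix i
        show "integrable lborel (\<lambda>y. conv f (box_kernel chi (int_decode i)) (x - y) * inv_fourier (?a n) y)"
        proof (rule integrable_bounded_mult[OF _ _ ai])
          show "(\<lambda>y. conv f (box_kernel chi (int_decode i)) (x - y)) \<in> borel_measurable borel"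
            by (intro borel_measurable_continuous_onI continuous_on_compose2[OF piece] continuous_intros) auto
          show "norm (conv f (box_kernel chi (int_decode i)) (x - y))
              \<le> M * (LINT x|lborel. norm (box_kernel chi (int_decode i) x))" for y
            by (rule norm_conv_le[OF fm f(2) schwartz_integrable[OF box_kernel_schwartz[OF W]]])
        qed
      qed
      also have "\<dots> = (\<Sum>i<m. conv f (inv_fourier (\<lambda>\<xi>. freq_cutoff chi (int_decode i) \<xi> * ?a n \<xi>)) x)"
        unfolding box_kernel_def
        by (intro sum.cong refl) (simp only: conv_conv_inv_fourier[OF fm f(2) freq_cutoff_schwartz[OF W] aS])
      also have "\<dots> = conv f (\<lambda>y. \<Sum>i<m. inv_fourier (\<lambda>\<xi>. freq_cutoff chi (int_decode i) \<xi> * ?a n \<xi>) y) x"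
        by (rule conv_sum_right[OF fm f(2), symmetric])
          (intro schwartz_integrable inv_fourier_schwartz prodS finite_lessThan)+
      also have "(\<lambda>y. \<Sum>i<m. inv_fourier (\<lambda>\<xi>. freq_cutoff chi (int_decode i) \<xi> * ?a n \<xi>) y)
          = inv_fourier (\<lambda>\<xi>. \<Sum>i<m. freq_cutoff chi (int_decode i) \<xi> * ?a n \<xi>)"
        by (rule ext, rule inv_fourier_sum[symmetric]) (intro schwartz_integrable prodS finite_lessThan)+
      finally show ?thesis .
    qed
    \<comment> \<open>|\<xi>| < n + 1 and |\<xi> - k| < 1 force |k| < n + 2. The index
      \<open>m0\<close> is chosen so that the enumeration has passed all such k.\<close>
    let ?F = "{k::int. \<bar>k\<bar> \<le> int n + 2}"
    have "finite ?F"
      by (rule finite_subset[of _ "{- (int n + 2)..int n + 2}"]) auto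
    then have "finite (int_encode ` ?F)"
      by simp
    then obtain m0 where m0: "\<And>k. k \<in> ?F \<Longrightarrow> int_encode k < m0"
      using finite_nat_set_iff_bounded[of "int_encode ` ?F"] by auto
    have "(\<Sum>i<m. freq_cutoff chi (int_decode i) \<xi> * ?a n \<xi>) = ?a n \<xi>" if "m0 \<le> m" for m \<xi>
    proof (cases "\<bar>\<xi>\<bar> < real (Suc n)")
      case True
      have "(\<Sum>k\<in>int_decode ` {..<m}. chi (\<xi> - of_int k)) = 1"
      proof (rule window_sum[OF W])
        fix k :: int assume "\<bar>\<xi> - of_int k\<bar> < 1"
        then have "real_of_int \<bar>k\<bar> < real_of_int (int n + 2)"
          using True by simp
        then have "\<bar>k\<bar> < int n + 2"
          by (simp only: of_int_less_iff)
        then have "k \<in> ?F"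
          by simp
        then have "int_encode k < m"
          using m0 that by fastforce
        then show "k \<in> int_decode ` {..<m}"
          by (metis imageI int_encode_inverse lessThan_iff)
      qed simp
      then have "(\<Sum>i<m. chi (\<xi> - of_int (int_decode i))) = 1"
        by (simp add: sum.reindex[OF inj_int_decode])
      then have "(\<Sum>i<m. freq_cutoff chi (int_decode i) \<xi>) = 1"
        unfolding freq_cutoff_def by (metis of_real_1 of_real_sum)
      then show ?thesis
        by (simp only: sum_distrib_right[symmetric] mult_1)
    next
      case False
      then have "1 \<le> \<bar>\<xi> / real (Suc n)\<bar>"
        by (simp only: abs_divide abs_of_nat) simp
      then have "?a n \<xi> = 0"
        using window_eq_0[OF W] by (simp add: freq_cutoff_def)
      then show ?thesis
        by simp
    qed
    then have "\<forall>\<^sub>F m in sequentially. conv (?S m) (inv_fourier (?a n)) x = conv f (inv_fourier (?a n)) x"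
      unfolding S_eq eventually_sequentially by (intro exI[of _ m0]) simp
    then have "(\<lambda>m. conv (?S m) (inv_fourier (?a n)) x) \<longlonglongrightarrow> conv f (inv_fourier (?a n)) x"
      by (rule tendsto_eventually)
    then show ?thesis
      using lim1 by (rule LIMSEQ_unique)
  qed
  have "(\<lambda>n. conv f (inv_fourier (?a n)) x) \<longlonglongrightarrow> f x"
    using conv_dilation_tendsto[OF f K, of x] unfolding Kn mean by simp
  moreover have "(\<lambda>n. conv f (inv_fourier (?a n)) x) \<longlonglongrightarrow> h x"
    unfolding eq using conv_dilation_tendsto[OF h K, of x] unfolding Kn mean by simp
  ultimately show "f x = h x"
    by (rule LIMSEQ_unique)
qed

text \<open>The Weierstrass test makes the differentiated series converge uniformly, and
  \<open>sum_conv_box_kernel\<close> identifies the undifferentiated sum with \<open>f\<close>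
  itself; so the derivatives of \<open>f\<close> are the sums of the differentiated pieces.\<close>

theorem X5_embedding:
  assumes W: "window chi"
  obtains C where "0 \<le> C" "\<And>f. f \<in> X chi 5 \<Longrightarrow> f \<in> Cn 5"
    "\<And>f j x. f \<in> X chi 5 \<Longrightarrow> j \<le> 5 \<Longrightarrow> norm (nderiv j f x) \<le> C * enn2real (Xnorm chi 5 f)"
proof -
  obtain C where C: "0 \<le> C" "\<And>f. f \<in> X chi 5 \<Longrightarrow> \<exists>b. (\<forall>i. 0 \<le> b i) \<and> summable b \<and>
      suminf b \<le> C * enn2real (Xnorm chi 5 f) \<and>
      (\<forall>j\<le>5. \<forall>i x. norm (conv f (nderiv j (box_kernel chi (int_decode i))) x) \<le> b i)"
    by (rule X5_pieces[OF W]) blast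
  have main: "f \<in> Cn 5 \<and> (\<forall>j\<le>5. \<forall>x. norm (nderiv j f x) \<le> C * enn2real (Xnorm chi 5 f))" if f: "f \<in> X chi 5" for f
  proof -
    obtain M where M: "\<And>x. norm (f x) \<le> M" "f \<in> borel_measurable borel"
      by (rule X_bounded[OF f]) blast
    obtain b where b: "\<And>i. 0 \<le> b i" "summable b" "suminf b \<le> C * enn2real (Xnorm chi 5 f)"
      "\<And>j i x. j \<le> 5 \<Longrightarrow> norm (conv f (nderiv j (box_kernel chi (int_decode i))) x) \<le> b i"
      using C(2)[OF f] by blast
    define S where "S j n x = (\<Sum>i<n. conv f (nderiv j (box_kernel chi (int_decode i))) x)" for j n x
    define G where "G j x = (\<Sum>i. conv f (nderiv j (box_kernel chi (int_decode i))) x)" for j x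
    have S_deriv: "(S j n has_vector_derivative S (Suc j) n x) (at x)" for j n x
      unfolding S_def[abs_def] by (intro has_vector_derivative_sum nderiv_conv_box[OF W M(2,1)])
    have S_Cn: "S 0 n \<in> Cn 5" "nderiv j (S 0 n) = S j n" for j n
      using smoothI[of "\<lambda>j. S j n" "S 0 n"] S_deriv by (auto simp: smooth_def)
    have unif: "uniform_limit A (\<lambda>n. S j n) (G j) sequentially" if "j \<le> 5" for j A
      unfolding S_def[abs_def] G_def[abs_def]
      by (rule Weierstrass_m_test[OF _ b(2)]) (use b(4)[OF that] in auto)
    have G: "G 0 \<in> Cn 5" "\<And>j. j \<le> 5 \<Longrightarrow> nderiv j (G 0) = G j"
      using Cn_sequential_limit[of "S 0" 5 G, OF S_Cn(1)] unif unfolding S_Cn(2) by blast+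
    have S_le: "norm (S j n x) \<le> suminf b" if "j \<le> 5" for j n x
    proof -
      have "norm (S j n x) \<le> (\<Sum>i<n. b i)"
        unfolding S_def by (rule sum_norm_le) (use b(4)[OF that] in auto)
      also have "\<dots> \<le> suminf b"
        using b(1,2) by (intro sum_le_suminf) auto
      finally show ?thesis .
    qed
    have S_lim: "(\<lambda>n. S j n x) \<longlonglongrightarrow> G j x" if "j \<le> 5" for j x
      using tendsto_uniform_limitI[OF unif[OF that, of UNIV]] by simp
    have G_le: "norm (G j x) \<le> suminf b" if "j \<le> 5" for j x
      using tendsto_norm[OF S_lim[OF that]] by (rule LIMSEQ_le_const2) (use S_le[OF that] in auto)
    have "f = G 0"
    proof (rule sum_conv_box_kernel[OF W _ M(1)])
      show "continuous_on UNIV f"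
        using f by (simp add: X_iff)
      show "continuous_on UNIV (G 0)"
        using Cn_continuous_on[OF G(1), of 0] by simp
      show "norm (G 0 x) \<le> suminf b" for x
        by (rule G_le) simp
      show "norm (\<Sum>i<n. conv f (box_kernel chi (int_decode i)) x) \<le> suminf b" for n x
        using S_le[of 0 n x] by (simp add: S_def)
      show "(\<lambda>n. \<Sum>i<n. conv f (box_kernel chi (int_decode i)) x) \<longlonglongrightarrow> G 0 x" for x
        using S_lim[of 0 x] by (simp add: S_def)
    qed
    then show ?thesis
      using G G_le b(3) by (metis order_trans)
  qed
  show ?thesis
    by (rule that[OF C(1)]) (use main in auto)
qed

section \<open>A metric for local convergence of derivatives\<close>

text \<open>The preimage in S of a closed set equals S intersected with its closure: a point of that
  closure is a sequential limit, to which the hypothesis applies. Only sequences inside S are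
  tested, since the flow is controlled along the hull alone.\<close>

lemma (in Metric_space) continuous_map_sequentiallyI:
  assumes "S \<subseteq> M" "F \<in> S \<rightarrow> M"
    and "\<And>\<sigma> l. \<lbrakk>range \<sigma> \<subseteq> S; l \<in> S; limitin mtopology \<sigma> l sequentially\<rbrakk>
      \<Longrightarrow> limitin mtopology (F \<circ> \<sigma>) (F l) sequentially"
  shows "continuous_map (subtopology mtopology S) mtopology F"
  unfolding continuous_map_closedin
proof (intro conjI allI impI)
  show "F \<in> topspace (subtopology mtopology S) \<rightarrow> topspace mtopology"
    using assms by auto
  fix C assume C: "closedin mtopology C"
  let ?D = "{x \<in> S. F x \<in> C}"
  have "S \<inter> mtopology closure_of ?D \<subseteq> ?D"
  proof
    fix x assume x: "x \<in> S \<inter> mtopology closure_of ?D"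
    then obtain \<sigma> where \<sigma>: "range \<sigma> \<subseteq> ?D \<inter> M" "limitin mtopology \<sigma> x sequentially"
      unfolding closure_of_sequentially by blast
    then have "limitin mtopology (F \<circ> \<sigma>) (F x) sequentially"
      using x by (intro assms(3)) auto
    moreover have "range (F \<circ> \<sigma>) \<subseteq> C"
      using \<sigma>(1) by auto
    ultimately have "F x \<in> C"
      using C unfolding metric_closedin_iff_sequentially_closed by blast
    then show "x \<in> ?D"
      using x by auto
  qed
  moreover have "?D \<subseteq> S \<inter> mtopology closure_of ?D"
    using assms(1) closure_of_subset[of ?D mtopology] by auto
  ultimately have "?D = S \<inter> mtopology closure_of ?D"
    by auto
  then show "closedin (subtopology mtopology S) {x \<in> topspace (subtopology mtopology S). F x \<in> C}"
    using assms(1) closedin_closure_of[of mtopology ?D]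
    by (auto simp: closedin_subtopology Int_absorb1 Int_commute intro!: exI[of _ "mtopology closure_of ?D"])
qed

text \<open>If the sequence were at distance at least \<epsilon> from \<open>l\<close> infinitely
  often, those indices would form a subsequence none of whose subsequences tends to
  \<open>l\<close>.\<close>

lemma (in Metric_space) limitin_if_subsequences:
  assumes l: "l \<in> M" and \<sigma>: "range \<sigma> \<subseteq> M"
    and sub: "\<And>r :: nat \<Rightarrow> nat. strict_mono r \<Longrightarrow> \<exists>s. strict_mono s \<and> limitin mtopology (\<sigma> \<circ> r \<circ> s) l sequentially"
  shows "limitin mtopology \<sigma> l sequentially"
proof (rule ccontr)
  assume "\<not> ?thesis"
  then obtain \<epsilon> where \<epsilon>: "0 < \<epsilon>" "\<And>N. \<exists>n\<ge>N. \<epsilon> \<le> d (\<sigma> n) l"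
    unfolding limit_metric_sequentially using l \<sigma> by (force simp: not_less)
  have "infinite {n. \<epsilon> \<le> d (\<sigma> n) l}"
    unfolding infinite_nat_iff_unbounded_le using \<epsilon>(2) by auto
  then obtain r :: "nat \<Rightarrow> nat" where r: "strict_mono r" "\<And>n. \<epsilon> \<le> d (\<sigma> (r n)) l"
    using infinite_enumerate by blast
  obtain s where s: "strict_mono s" "limitin mtopology (\<sigma> \<circ> r \<circ> s) l sequentially"
    using sub[OF r(1)] by blast
  then obtain n where "d (\<sigma> (r (s n))) l < \<epsilon>"
    unfolding limit_metric_sequentially using \<epsilon>(1) by (metis comp_apply order_refl)
  then show False
    using r(2)[of "s n"] by simp
qed

text \<open>The condition \<open>\<bar>x\<bar> * e \<le> 1\<close> describes the interval of radius \<open>1 / e\<close>, so a small distance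
  means closeness on a large interval. Admitting every \<open>e \<ge> 1\<close> keeps the infimum meaningful.\<close>

definition Cn_close :: "nat \<Rightarrow> (real \<Rightarrow> 'a::real_normed_vector) \<Rightarrow> (real \<Rightarrow> 'a) \<Rightarrow> real \<Rightarrow> bool" where
  "Cn_close n f g e \<longleftrightarrow> (\<forall>j\<le>n. \<forall>x. \<bar>x\<bar> * e \<le> 1 \<longrightarrow> norm (nderiv j f x - nderiv j g x) \<le> e)"

definition Cn_dist :: "nat \<Rightarrow> (real \<Rightarrow> 'a::real_normed_vector) \<Rightarrow> (real \<Rightarrow> 'a) \<Rightarrow> real" where
  "Cn_dist n f g = Inf {e. 0 < e \<and> (1 \<le> e \<or> Cn_close n f g e)}"

text \<open>Enlarging e relaxes the tolerance and at the same time shrinks the interval on which it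
  is tested.\<close>

lemma Cn_close_mono:
  assumes "Cn_close n f g e" "e \<le> e'"
  shows "Cn_close n f g e'"
  unfolding Cn_close_def
proof (intro allI impI)
  fix j x assume "j \<le> n" "\<bar>x\<bar> * e' \<le> 1"
  moreover have "\<bar>x\<bar> * e \<le> \<bar>x\<bar> * e'"
    using assms(2) by (intro mult_left_mono) auto
  ultimately have "norm (nderiv j f x - nderiv j g x) \<le> e"
    using assms(1) unfolding Cn_close_def by (meson order_trans)
  then show "norm (nderiv j f x - nderiv j g x) \<le> e'"
    using assms(2) by simp
qed

lemma Cn_dist_less_iff: "Cn_dist n f g < e \<longleftrightarrow> (\<exists>e'<e. 0 < e' \<and> (1 \<le> e' \<or> Cn_close n f g e'))"
proof -
  have "{e. 0 < e \<and> (1 \<le> e \<or> Cn_close n f g e)} \<noteq> {}"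
    using zero_less_one by (metis (mono_tags) empty_iff mem_Collect_eq order_refl)
  moreover have "bdd_below {e. 0 < e \<and> (1 \<le> e \<or> Cn_close n f g e)}"
    by (auto simp: bdd_below_def intro!: exI[of _ 0])
  ultimately show ?thesis
    unfolding Cn_dist_def by (subst cInf_less_iff) auto
qed

lemma Cn_dist_nonneg: "0 \<le> Cn_dist n f g"
proof (rule ccontr)
  assume "\<not> 0 \<le> Cn_dist n f g"
  then show False
    using Cn_dist_less_iff[of n f g 0] by auto
qed

text \<open>For e <= 1 the trivial alternative in the definition of the distance is excluded, so a
  small distance is genuine closeness.\<close>

lemma Cn_closeD:
  assumes "Cn_dist n f g < e" "e \<le> 1"
  shows "Cn_close n f g e"
proof -
  obtain e' where "e' < e" "1 \<le> e' \<or> Cn_close n f g e'"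
    using assms(1) unfolding Cn_dist_less_iff by blast
  then show ?thesis
    using assms(2) Cn_close_mono[of n f g e' e] by auto
qed

lemma Cn_dist_le:
  assumes "Cn_close n f g e" "0 < e"
  shows "Cn_dist n f g \<le> e"
proof (rule dense_ge)
  fix e' assume "e < e'"
  then have "Cn_dist n f g < e'"
    unfolding Cn_dist_less_iff using assms by blast
  then show "Cn_dist n f g \<le> e'"
    by simp
qed

lemma Cn_close_commute: "Cn_close n f g = Cn_close n g f"
  by (simp add: Cn_close_def fun_eq_iff norm_minus_commute)

lemma Cn_dist_metric: "Metric_space (Cn n) (Cn_dist n)"
proof
  show "0 \<le> Cn_dist n f g" for f g :: "real \<Rightarrow> 'a"
    by (rule Cn_dist_nonneg)
  show "Cn_dist n f g = Cn_dist n g f" for f g :: "real \<Rightarrow> 'a"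
    unfolding Cn_dist_def Cn_close_commute[of n f g] ..
  show "Cn_dist n f g = 0 \<longleftrightarrow> f = g" for f g :: "real \<Rightarrow> 'a"
  proof
    assume 0: "Cn_dist n f g = 0"
    show "f = g"
    proof
      fix x
      have "norm (f x - g x) \<le> e" if "e > 0" for e
      proof -
        \<comment> \<open>The bounds by e and 1 give the tolerance and access to
          \<open>Cn_closeD\<close>; the last one keeps \<open>x\<close> inside the interval of
          radius 1 / e'.\<close>
        define e' where "e' = min (min e 1) (1 / (\<bar>x\<bar> + 1))"
        have e': "0 < e'" "e' \<le> 1" "e' \<le> e" "e' \<le> 1 / (\<bar>x\<bar> + 1)"
          using that by (auto simp: e'_def)
        have "\<bar>x\<bar> * e' \<le> \<bar>x\<bar> * (1 / (\<bar>x\<bar> + 1))"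
          using e'(4) by (rule mult_left_mono) simp
        also have "\<dots> \<le> 1"
          by simp
        finally have "\<bar>x\<bar> * e' \<le> 1" .
        moreover have "Cn_close n f g e'"
          using 0 e' by (intro Cn_closeD) auto
        ultimately have "norm (nderiv 0 f x - nderiv 0 g x) \<le> e'"
          unfolding Cn_close_def by blast
        then show ?thesis
          using e' by simp
      qed
      then have "norm (f x - g x) \<le> 0"
        by (rule field_le_epsilon) simp
      then show "f x = g x"
        by simp
    qed
  next
    assume "f = g"
    then have "Cn_dist n f g \<le> e" if "e > 0" for e
      using that by (intro Cn_dist_le) (auto simp: Cn_close_def)
    then have "Cn_dist n f g \<le> 0"
      by (rule dense_ge)
    then show "Cn_dist n f g = 0"
      using Cn_dist_nonneg[of n f g] by simp
  qed
  show "Cn_dist n f h \<le> Cn_dist n f g + Cn_dist n g h" for f g h :: "real \<Rightarrow> 'a"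
  proof (rule dense_ge)
    fix e assume "Cn_dist n f g + Cn_dist n g h < e"
    then obtain a b where ab: "Cn_dist n f g < a" "Cn_dist n g h < b" "e = a + b"
      by (metis add.commute add_diff_cancel_left' dense diff_add_cancel less_diff_eq)
    then obtain a' b' where a': "a' < a" "0 < a'" "1 \<le> a' \<or> Cn_close n f g a'"
      and b': "b' < b" "0 < b'" "1 \<le> b' \<or> Cn_close n g h b'"
      unfolding Cn_dist_less_iff by blast
    \<comment> \<open>The interval belonging to a' + b' lies in those belonging to a' and to b', so
      both estimates hold there and add up.\<close>
    have "Cn_close n f h (a' + b')" if "Cn_close n f g a'" "Cn_close n g h b'"
      unfolding Cn_close_def
    proof (intro allI impI)
      fix j x assume j: "j \<le> n" and x: "\<bar>x\<bar> * (a' + b') \<le> 1"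
      have "\<bar>x\<bar> * a' \<le> \<bar>x\<bar> * (a' + b')" "\<bar>x\<bar> * b' \<le> \<bar>x\<bar> * (a' + b')"
        using a' b' by (auto intro!: mult_left_mono)
      then have "norm (nderiv j f x - nderiv j g x) \<le> a'" "norm (nderiv j g x - nderiv j h x) \<le> b'"
        using that j x unfolding Cn_close_def by (meson order_trans)+
      then show "norm (nderiv j f x - nderiv j h x) \<le> a' + b'"
        using norm_triangle_le[of "nderiv j f x - nderiv j g x" "nderiv j g x - nderiv j h x"] by simp
    qed
    then have "Cn_dist n f h < e"
      unfolding Cn_dist_less_iff using a' b' ab(3) by (intro exI[of _ "a' + b'"]) auto
    then show "Cn_dist n f h \<le> e"
      by simp
  qed
qed

interpretation Cn: Metric_space "Cn n" "Cn_dist n" for n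
  by (rule Cn_dist_metric)

section \<open>The metric induces the topology of local convergence\<close>

lemma Cn_loc_nhd_mono:
  assumes "R \<le> R'" "e' \<le> e"
  shows "Cn_loc_nhd n f R' e' \<subseteq> Cn_loc_nhd n f R e"
proof
  fix g assume g: "g \<in> Cn_loc_nhd n f R' e'"
  have "norm (nderiv j g x - nderiv j f x) < e" if "j \<le> n" "x \<in> {-R..R}" for j x
  proof -
    have "x \<in> {-R'..R'}"
      using that assms(1) by auto
    then have "norm (nderiv j g x - nderiv j f x) < e'"
      using g that(1) by (simp add: Cn_loc_nhd_def)
    then show ?thesis
      using assms(2) by simp
  qed
  then show "g \<in> Cn_loc_nhd n f R e"
    using g by (simp add: Cn_loc_nhd_def)
qed

lemma openin_Cn_loc_nhd:
  assumes "f \<in> Cn n" "0 < e"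
  shows "openin (Cn_loc n) (Cn_loc_nhd n f R e)"
  unfolding Cn_loc_def by (rule topology_generated_by_Basis) (use assms in blast)

text \<open>A strict bound on a continuous function over a compact interval leaves a positive gap,
  and this gap is the room for moving the centre from \<open>f\<close> to \<open>g\<close>. So
  subbasic sets are neighbourhoods of all their points.\<close>

lemma Cn_loc_nhd_inner:
  assumes f: "f \<in> Cn n" and g: "g \<in> Cn_loc_nhd n f R e"
  shows "\<exists>e'>0. Cn_loc_nhd n g R e' \<subseteq> Cn_loc_nhd n f R e"
proof -
  have gC: "g \<in> Cn n"
    using g by (simp add: Cn_loc_nhd_def)
  have "\<exists>m<e. \<forall>x\<in>{-R..R}. norm (nderiv j g x - nderiv j f x) \<le> m" if "j \<le> n" for j
  proof (cases "{-R..R} = {}")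
    \<comment> \<open>A negative \<open>R\<close> gives an empty interval; there is no maximum to
      attain, and any number below e will do.\<close>
    case True
    then show ?thesis
      using lt_ex by blast
  next
    case False
    have "continuous_on {-R..R} (\<lambda>x. norm (nderiv j g x - nderiv j f x))"
      by (intro continuous_intros Cn_continuous_on[OF f that] Cn_continuous_on[OF gC that])
    then obtain x where "x \<in> {-R..R}" "\<forall>y\<in>{-R..R}. norm (nderiv j g y - nderiv j f y) \<le> norm (nderiv j g x - nderiv j f x)"
      using continuous_attains_sup[of "{-R..R}"] False by blast
    then show ?thesis
      using g that unfolding Cn_loc_nhd_def by blast
  qed
  then obtain m where m: "\<And>j. j \<le> n \<Longrightarrow> m j < e"
    "\<And>j x. j \<le> n \<Longrightarrow> x \<in> {-R..R} \<Longrightarrow> norm (nderiv j g x - nderiv j f x) \<le> m j"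
    by metis
  define e' where "e' = e - Max (m ` {..n})"
  have Max: "Max (m ` {..n}) < e" "\<And>j. j \<le> n \<Longrightarrow> m j \<le> Max (m ` {..n})"
    using m(1) by (auto simp: Max_less_iff)
  have "Cn_loc_nhd n g R e' \<subseteq> Cn_loc_nhd n f R e"
  proof
    fix h assume h: "h \<in> Cn_loc_nhd n g R e'"
    have "norm (nderiv j h x - nderiv j f x) < e" if "j \<le> n" "x \<in> {-R..R}" for j x
    proof -
      have "norm (nderiv j h x - nderiv j g x) < e'"
        using h that by (simp add: Cn_loc_nhd_def)
      moreover have "norm (nderiv j g x - nderiv j f x) \<le> Max (m ` {..n})"
        using m(2)[OF that] Max(2)[OF that(1)] by simp
      ultimately show ?thesis
        using norm_triangle_ineq[of "nderiv j h x - nderiv j g x" "nderiv j g x - nderiv j f x"]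
        by (simp add: e'_def)
    qed
    then show "h \<in> Cn_loc_nhd n f R e"
      using h by (auto simp: Cn_loc_nhd_def)
  qed
  then show ?thesis
    using Max(1) by (intro exI[of _ e']) (simp add: e'_def)
qed

text \<open>Sets with a common centre are directed, by larger radius and smaller tolerance, so
  finite intersections of subbasic sets contain another one and the subbase acts as a neighbourhood
  base.\<close>

lemma openin_Cn_loc_iff:
  "openin (Cn_loc n) U \<longleftrightarrow> U \<subseteq> Cn n \<and> (\<forall>f\<in>U. \<exists>R e. 0 < e \<and> Cn_loc_nhd n f R e \<subseteq> U)"
proof
  assume U: "openin (Cn_loc n) U"
  then have "generate_topology_on {Cn_loc_nhd n f R e | f R e. f \<in> Cn n \<and> 0 < e} U"
    by (simp add: Cn_loc_def openin_topology_generated_by_iff)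
  then have "\<forall>f\<in>U. \<exists>R e. 0 < e \<and> Cn_loc_nhd n f R e \<subseteq> U"
  proof induction
    case (Int a b)
    show ?case
    proof
      fix f assume f: "f \<in> a \<inter> b"
      then obtain R1 e1 R2 e2 where 1: "0 < e1" "Cn_loc_nhd n f R1 e1 \<subseteq> a" "0 < e2" "Cn_loc_nhd n f R2 e2 \<subseteq> b"
        using Int.IH by (metis IntD1 IntD2)
      have "Cn_loc_nhd n f (max R1 R2) (min e1 e2) \<subseteq> Cn_loc_nhd n f R1 e1 \<inter> Cn_loc_nhd n f R2 e2"
        by (intro Int_greatest Cn_loc_nhd_mono) auto
      then show "\<exists>R e. 0 < e \<and> Cn_loc_nhd n f R e \<subseteq> a \<inter> b"
        using 1 by (intro exI[of _ "max R1 R2"] exI[of _ "min e1 e2"]) auto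
    qed
  next
    case (UN K)
    then show ?case
      by (meson Sup_upper UnionE order_trans)
  next
    case (Basis s)
    then show ?case
      using Cn_loc_nhd_inner by fastforce
  qed simp
  then show "U \<subseteq> Cn n \<and> (\<forall>f\<in>U. \<exists>R e. 0 < e \<and> Cn_loc_nhd n f R e \<subseteq> U)"
    using openin_subset[OF U] by (simp add: topspace_Cn_loc)
next
  assume U: "U \<subseteq> Cn n \<and> (\<forall>f\<in>U. \<exists>R e. 0 < e \<and> Cn_loc_nhd n f R e \<subseteq> U)"
  have "\<exists>V. openin (Cn_loc n) V \<and> f \<in> V \<and> V \<subseteq> U" if fU: "f \<in> U" for f
  proof -
    have "f \<in> Cn n"
      using U fU by blast
    obtain R e where Re: "0 < e" "Cn_loc_nhd n f R e \<subseteq> U"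
      using bspec[OF conjunct2[OF U] fU] by blast
    have "openin (Cn_loc n) (Cn_loc_nhd n f R e)"
      using \<open>f \<in> Cn n\<close> Re(1) by (rule openin_Cn_loc_nhd)
    moreover have "f \<in> Cn_loc_nhd n f R e"
      using Re U that by (auto simp: Cn_loc_nhd_def)
    ultimately show ?thesis
      using Re by blast
  qed
  then show "openin (Cn_loc n) U"
    by (subst openin_subopen) blast
qed

text \<open>Metrizability makes closure and compactness sequential, which is the language of limits
  of translates. Tolerance e / 2 on radius 2 / e fits into the ball of radius e; halving is needed
  because \<open>Cn_dist_le\<close> gives a weak inequality.\<close>

lemma mtopology_Cn: "Cn.mtopology n = Cn_loc n"
proof (rule topology_eq[THEN iffD2], rule allI)
  fix U :: "(real \<Rightarrow> 'a) set"
  have 1: "\<exists>R e'. 0 < e' \<and> Cn_loc_nhd n f R e' \<subseteq> Cn.mball n f e" if f: "f \<in> Cn n" and e: "0 < e" for f :: "real \<Rightarrow> 'a" and e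
  proof -
    define e' where "e' = e / 2"
    have "Cn_loc_nhd n f (1 / e') e' \<subseteq> Cn.mball n f e"
    proof
      fix g assume g: "g \<in> Cn_loc_nhd n f (1 / e') e'"
      have "Cn_close n f g e'"
        unfolding Cn_close_def
      proof (intro allI impI)
        fix j x assume "j \<le> n" "\<bar>x\<bar> * e' \<le> 1"
        then have "\<bar>x\<bar> \<le> 1 / e'"
          using e by (simp add: e'_def pos_le_divide_eq)
        then have "x \<in> {- (1 / e')..1 / e'}"
          by auto
        then have "norm (nderiv j g x - nderiv j f x) < e'"
          using g \<open>j \<le> n\<close> by (simp add: Cn_loc_nhd_def)
        then show "norm (nderiv j f x - nderiv j g x) \<le> e'"
          by (simp add: norm_minus_commute)
      qed
      then have "Cn_dist n f g \<le> e'"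
        using e by (intro Cn_dist_le) (auto simp: e'_def)
      then have "Cn_dist n f g < e"
        using e by (simp add: e'_def)
      then show "g \<in> Cn.mball n f e"
        using f g by (simp add: Cn.in_mball Cn_loc_nhd_def)
    qed
    then show ?thesis
      using e by (intro exI[of _ "1 / e'"] exI[of _ e']) (auto simp: e'_def)
  qed
  have 2: "\<exists>r>0. Cn.mball n f r \<subseteq> Cn_loc_nhd n f R e" if f: "f \<in> Cn n" and e: "0 < e" for f :: "real \<Rightarrow> 'a" and R e
  proof -
    define r where "r = min (min e 1) (1 / (\<bar>R\<bar> + 1))"
    have r: "0 < r" "r \<le> e" "r \<le> 1" "r \<le> 1 / (\<bar>R\<bar> + 1)"
      using e by (auto simp: r_def)
    have "Cn.mball n f r \<subseteq> Cn_loc_nhd n f R e"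
    proof
      fix g assume "g \<in> Cn.mball n f r"
      then have g: "g \<in> Cn n" "Cn_dist n f g < r"
        by auto
      then obtain e' where e': "e' < r" "0 < e'" "Cn_close n f g e'"
        unfolding Cn_dist_less_iff using r(3) by fastforce
      have "norm (nderiv j g x - nderiv j f x) < e" if "j \<le> n" "x \<in> {-R..R}" for j x
      proof -
        have "\<bar>x\<bar> * e' \<le> \<bar>R\<bar> * (1 / (\<bar>R\<bar> + 1))"
          using that(2) e' r(4) by (intro mult_mono) auto
        also have "\<dots> \<le> 1"
          by simp
        finally have "norm (nderiv j f x - nderiv j g x) \<le> e'"
          using e'(3) that(1) by (simp add: Cn_close_def)
        then show ?thesis
          using e'(1) r(2) by (simp add: norm_minus_commute)
      qed
      then show "g \<in> Cn_loc_nhd n f R e"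
        using g(1) by (simp add: Cn_loc_nhd_def)
    qed
    then show ?thesis
      using r(1) by blast
  qed
  show "openin (Cn.mtopology n) U \<longleftrightarrow> openin (Cn_loc n) U"
    unfolding Cn.openin_mtopology openin_Cn_loc_iff
    using 1 2 by (meson order_trans subsetD)
qed

lemma limitin_Cn_loc_iff:
  assumes \<sigma>: "\<And>k. \<sigma> k \<in> Cn n" and l: "l \<in> Cn n"
  shows "limitin (Cn_loc n) \<sigma> l sequentially \<longleftrightarrow>
    (\<forall>j\<le>n. \<forall>r. uniform_limit {-r..r} (\<lambda>k. nderiv j (\<sigma> k)) (nderiv j l) sequentially)"
proof
  assume L: "limitin (Cn_loc n) \<sigma> l sequentially"
  show "\<forall>j\<le>n. \<forall>r. uniform_limit {-r..r} (\<lambda>k. nderiv j (\<sigma> k)) (nderiv j l) sequentially"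
  proof (intro allI impI uniform_limitI)
    fix j r and e :: real assume "j \<le> n" "0 < e"
    have "openin (Cn_loc n) (Cn_loc_nhd n l r e)"
      using l \<open>0 < e\<close> by (rule openin_Cn_loc_nhd)
    moreover have "l \<in> Cn_loc_nhd n l r e"
      using l \<open>0 < e\<close> by (simp add: Cn_loc_nhd_def)
    ultimately have "\<forall>\<^sub>F k in sequentially. \<sigma> k \<in> Cn_loc_nhd n l r e"
      using L by (simp add: limitin_def)
    then show "\<forall>\<^sub>F k in sequentially. \<forall>x\<in>{-r..r}. dist (nderiv j (\<sigma> k) x) (nderiv j l x) < e"
      by eventually_elim (use \<open>j \<le> n\<close> in \<open>auto simp: Cn_loc_nhd_def dist_norm\<close>)
  qed
next
  assume U: "\<forall>j\<le>n. \<forall>r. uniform_limit {-r..r} (\<lambda>k. nderiv j (\<sigma> k)) (nderiv j l) sequentially"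
  show "limitin (Cn_loc n) \<sigma> l sequentially"
    unfolding limitin_def topspace_Cn_loc
  proof (intro conjI allI impI l)
    fix V assume "openin (Cn_loc n) V \<and> l \<in> V"
    then obtain R e where Re: "0 < e" "Cn_loc_nhd n l R e \<subseteq> V"
      unfolding openin_Cn_loc_iff by blast
    have "\<forall>\<^sub>F k in sequentially. \<forall>j\<in>{..n}. \<forall>x\<in>{-R..R}. dist (nderiv j (\<sigma> k) x) (nderiv j l x) < e"
      using U Re(1) by (auto simp: eventually_ball_finite_distrib dest: uniform_limitD)
    then show "\<forall>\<^sub>F k in sequentially. \<sigma> k \<in> V"
    proof eventually_elim
      case (elim k)
      then have "\<sigma> k \<in> Cn_loc_nhd n l R e"
        using \<sigma>[of k] by (auto simp: Cn_loc_nhd_def dist_norm)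
      then show ?case
        using Re(2) by blast
    qed
  qed
qed

section \<open>Bounds for solutions\<close>

text \<open>Arzela-Ascoli is applied on each ball and to each member of the family; coding the pairs
  (j, m) by one natural number lets a single diagonal sequence serve them all.\<close>

lemma Arzela_Ascoli_diagonal:
  fixes F :: "nat \<Rightarrow> nat \<Rightarrow> 'a::euclidean_space \<Rightarrow> 'b::{real_normed_vector, heine_borel}"
  assumes bound: "\<And>j m. \<exists>M. \<forall>n. \<forall>p\<in>cball 0 (real m). norm (F j n p) \<le> M"
    and equi: "\<And>j p e. 0 < e \<Longrightarrow> \<exists>d>0. \<forall>n p'. norm (p - p') < d \<longrightarrow> norm (F j n p - F j n p') < e"
  shows "\<exists>r G. strict_mono (r :: nat \<Rightarrow> nat) \<and>
    (\<forall>j m. uniform_limit (cball 0 (real m)) (\<lambda>n. F j (r n)) (G j) sequentially) \<and>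
    (\<forall>j. continuous_on UNIV (G j))"
proof -
  define P where "P k s \<longleftrightarrow> (\<exists>g. uniform_limit (cball 0 (real (snd (prod_decode k))))
    (\<lambda>n. F (fst (prod_decode k)) (s n)) g sequentially)" for k and s :: "nat \<Rightarrow> nat"
  interpret subseqs P
  proof
    fix k and s :: "nat \<Rightarrow> nat" assume "strict_mono s"
    obtain j m where jm: "prod_decode k = (j, m)"
      by (cases "prod_decode k")
    obtain M where M: "\<And>n p. p \<in> cball 0 (real m) \<Longrightarrow> norm (F j n p) \<le> M"
      using bound[of m j] by blast
    obtain g r where "continuous_on (cball 0 (real m)) g" and r: "strict_mono (r :: nat \<Rightarrow> nat)"
      "\<And>e. 0 < e \<Longrightarrow> \<exists>N. \<forall>n p. N \<le> n \<and> p \<in> cball 0 (real m) \<longrightarrow> norm (F j (s (r n)) p - g p) < e"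
    proof (rule Arzela_Ascoli[of "cball 0 (real m)" "\<lambda>n. F j (s n)" M])
      fix p and e :: real assume "0 < e"
      then obtain d where "0 < d" "\<forall>n p'. norm (p - p') < d \<longrightarrow> norm (F j n p - F j n p') < e"
        using equi[of e p j] by auto
      then show "\<exists>d>0. \<forall>n y. y \<in> cball 0 (real m) \<and> norm (p - y) < d \<longrightarrow> norm (F j (s n) p - F j (s n) y) < e"
        by (intro exI[of _ d]) simp
    qed (use M in auto)
    have "uniform_limit (cball 0 (real m)) (\<lambda>n. F j (s (r n))) g sequentially"
      unfolding uniform_limit_iff eventually_sequentially dist_norm using r(2) by blast
    then show "\<exists>r. strict_mono r \<and> P k (s \<circ> r)"
      using r(1) by (auto simp: P_def jm)
  qed
  let ?r = "diagseq"
  \<comment> \<open>Defined by pointwise limits, so that it does not depend on the ball.\<close>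
  define G where "G j p = lim (\<lambda>n. F j (?r n) p)" for j p
  have unif: "uniform_limit (cball 0 (real m)) (\<lambda>n. F j (?r n)) (G j) sequentially" for j m
  proof -
    \<comment> \<open>The diagonal sequence is controlled by the k-th selection only from index k +
      1 on. The shift is removed below, because uniform limits ignore initial terms.\<close>
    have "P (prod_encode (j, m)) (diagseq \<circ> (+) (Suc (prod_encode (j, m))))"
    proof (rule diagseq_holds)
      fix r s :: "nat \<Rightarrow> nat" and n assume r: "strict_mono r" and "P n s"
      then obtain g where g: "uniform_limit (cball 0 (real (snd (prod_decode n))))
          (\<lambda>k. F (fst (prod_decode n)) (s k)) g sequentially"
        by (auto simp: P_def)
      show "P n (s \<circ> r)"
        unfolding P_def uniform_limit_iff comp_apply
        using eventually_subseq[OF r uniform_limitD[OF g]] by blast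
    qed
    then obtain g where "uniform_limit (cball 0 (real m)) (\<lambda>n. F j (diagseq (n + Suc (prod_encode (j, m))))) g sequentially"
      by (auto simp: P_def add.commute)
    then have g: "uniform_limit (cball 0 (real m)) (\<lambda>n. F j (diagseq n)) g sequentially"
      unfolding uniform_limit_iff
      using eventually_sequentially_seg[of "\<lambda>n. \<forall>x\<in>cball 0 (real m). dist (F j (diagseq n) x) (g x) < _" "Suc (prod_encode (j, m))"]
      by blast
    have "G j p = g p" if "p \<in> cball 0 (real m)" for p
      unfolding G_def using tendsto_uniform_limitI[OF g that] by (rule limI)
    then show ?thesis
      using g uniform_limit_cong'[of "cball 0 (real m)" "\<lambda>n. F j (diagseq n)" "\<lambda>n. F j (diagseq n)" g "G j"] by simp
  qed
  have F_cont: "continuous_on UNIV (F j n)" for j n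
    unfolding continuous_on_iff
  proof (intro ballI allI impI)
    fix p and e :: real assume "0 < e"
    then obtain d where "0 < d" "\<forall>n p'. norm (p - p') < d \<longrightarrow> norm (F j n p - F j n p') < e"
      using equi by blast
    then show "\<exists>d>0. \<forall>p'\<in>UNIV. dist p' p < d \<longrightarrow> dist (F j n p') (F j n p) < e"
      by (auto simp: dist_norm norm_minus_commute)
  qed
  have "continuous_on UNIV (G j)" for j
  proof (rule continuous_at_imp_continuous_on, rule ballI)
    fix p :: 'a
    obtain m where m: "norm p < real m"
      using reals_Archimedean2 by blast
    have "continuous_on (cball 0 (real m)) (G j)"
      by (rule uniform_limit_theorem[OF _ unif]) (auto intro!: always_eventually continuous_on_subset[OF F_cont])
    then show "isCont (G j) p"
      by (rule continuous_on_interior) (use m in auto)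
  qed
  then show ?thesis
    using subseq_diagseq unif by blast
qed

text \<open>Compactness is available in time only: each local bound is already uniform in x, and
  bisection glues them together.\<close>

lemma bounded_on_compact_interval:
  fixes w :: "real \<Rightarrow> 'a \<Rightarrow> 'b::real_normed_vector"
  assumes loc: "\<And>t. \<exists>d>0. \<exists>B. \<forall>\<tau>. \<bar>\<tau> - t\<bar> < d \<longrightarrow> (\<forall>x. norm (w \<tau> x) \<le> B)"
  shows "\<exists>B. \<forall>t\<in>{a..b}. \<forall>x. norm (w t x) \<le> B"
proof (cases "a \<le> b")
  case True
  then show ?thesis
  proof (induction rule: Bolzano)
    case (trans a b c)
    then obtain A B where "\<forall>t\<in>{a..b}. \<forall>x. norm (w t x) \<le> A" "\<forall>t\<in>{b..c}. \<forall>x. norm (w t x) \<le> B"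
      by blast
    then have "\<forall>t\<in>{a..c}. \<forall>x. norm (w t x) \<le> max A B"
      by (metis atLeastAtMost_iff le_max_iff_disj linear)
    then show ?case
      by blast
  next
    case (local t)
    obtain d B where d: "d > 0" "\<And>\<tau> x. \<bar>\<tau> - t\<bar> < d \<Longrightarrow> norm (w \<tau> x) \<le> B"
      using loc[of t] by blast
    have "\<exists>B. \<forall>\<tau>\<in>{a..b}. \<forall>x. norm (w \<tau> x) \<le> B" if "a \<le> t \<and> t \<le> b \<and> b - a < d" for a b
      using that by (intro exI[of _ B] ballI allI d(2)) auto
    then show ?case
      using d(1) by blast
  qed
qed auto

text \<open>The embedding is applied to the difference of two time slices, whose norm is small. The
  bound holds for all x at once and therefore survives every translation.\<close>

lemma C0_X_nderiv_continuous:
  assumes W: "window chi" and q: "q \<in> C0_X chi 5" and "j \<le> 5" "0 < e"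
  shows "\<exists>d>0. \<forall>\<tau>. \<bar>\<tau> - t\<bar> < d \<longrightarrow> (\<forall>x. norm (nderiv j (q \<tau>) x - nderiv j (q t) x) < e)"
proof -
  obtain C where C: "0 \<le> C" "\<And>f. f \<in> X chi 5 \<Longrightarrow> f \<in> Cn 5"
    "\<And>f j x. f \<in> X chi 5 \<Longrightarrow> j \<le> 5 \<Longrightarrow> norm (nderiv j f x) \<le> C * enn2real (Xnorm chi 5 f)"
    by (rule X5_embedding[OF W]) blast
  have qX: "q \<tau> \<in> X chi 5" for \<tau>
    using q by (simp add: C0_X_def)
  \<comment> \<open>The + 1 covers the case C = 0 and makes C \<eta> < e strict.\<close>
  define \<eta> where "\<eta> = e / (C + 1)"
  have \<eta>: "0 < \<eta>" "C * \<eta> < e"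
    using C(1) \<open>0 < e\<close> by (auto simp: \<eta>_def field_simps)
  have "((\<lambda>\<tau>. Xnorm chi 5 (\<lambda>x. q \<tau> x - q t x)) \<longlongrightarrow> 0) (at t)"
    using q by (simp add: C0_X_def)
  then have "\<forall>\<^sub>F \<tau> in at t. Xnorm chi 5 (\<lambda>x. q \<tau> x - q t x) < ennreal \<eta>"
    by (rule order_tendstoD(2)) (use \<eta> in simp)
  then obtain d where d: "d > 0" "\<And>\<tau>. \<tau> \<noteq> t \<Longrightarrow> dist \<tau> t < d \<Longrightarrow> Xnorm chi 5 (\<lambda>x. q \<tau> x - q t x) < ennreal \<eta>"
    unfolding eventually_at by blast
  have "norm (nderiv j (q \<tau>) x - nderiv j (q t) x) < e" if "\<bar>\<tau> - t\<bar> < d" for \<tau> x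
  proof (cases "\<tau> = t")
    case False
    let ?w = "\<lambda>x. q \<tau> x - q t x"
    have small: "Xnorm chi 5 ?w < ennreal \<eta>"
      using d(2)[OF False] that by (simp add: dist_real_def)
    have "continuous_on UNIV ?w" "bounded (range ?w)"
      using qX[of \<tau>] qX[of t] by (auto simp: X_iff intro!: continuous_intros bounded_minus_comp)
    then have "?w \<in> X chi 5"
      using small by (auto simp: X_iff intro: order.strict_trans)
    then have "norm (nderiv j ?w x) \<le> C * enn2real (Xnorm chi 5 ?w)"
      using C(3) \<open>j \<le> 5\<close> by blast
    also have "enn2real (Xnorm chi 5 ?w) \<le> \<eta>"
      using small \<eta>(1) by (intro enn2real_leI) auto
    then have "C * enn2real (Xnorm chi 5 ?w) \<le> C * \<eta>"
      using C(1) by (rule mult_left_mono)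
    finally have "norm (nderiv j ?w x) < e"
      using \<eta>(2) by simp
    then show ?thesis
      using Cn_diff(2)[OF C(2)[OF qX] C(2)[OF qX] \<open>j \<le> 5\<close>, of \<tau> t] by simp
  qed (use \<open>0 < e\<close> in simp)
  then show ?thesis
    using d(1) by blast
qed

lemma X5_nderiv_bounded:
  assumes W: "window chi" and f: "f \<in> X chi 5"
  obtains B where "\<And>j x. j \<le> 5 \<Longrightarrow> norm (nderiv j f x) \<le> B" "0 \<le> B"
proof -
  obtain C where C: "0 \<le> C" "\<And>f. f \<in> X chi 5 \<Longrightarrow> f \<in> Cn 5"
    "\<And>f j x. f \<in> X chi 5 \<Longrightarrow> j \<le> 5 \<Longrightarrow> norm (nderiv j f x) \<le> C * enn2real (Xnorm chi 5 f)"
    by (rule X5_embedding[OF W]) blast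
  show ?thesis
    by (rule that[of "C * enn2real (Xnorm chi 5 f)"]) (use C f in auto)
qed

lemma X5_Cn:
  assumes "window chi" "f \<in> X chi 5" "n \<le> 5"
  shows "f \<in> Cn n"
proof -
  obtain C where "\<And>f. f \<in> X chi 5 \<Longrightarrow> f \<in> Cn 5"
    by (rule X5_embedding[OF assms(1)]) blast
  then show ?thesis
    using assms Cn_mono by blast
qed

text \<open>Here the fifth derivative is spent: the common bound on orders 1 to 5 is a Lipschitz
  constant for orders 0 to 4.\<close>

lemma X5_nderiv_lipschitz:
  assumes W: "window chi" and f: "f \<in> X chi 5"
  obtains B where "0 \<le> B" "\<And>j x y. j \<le> 4 \<Longrightarrow> norm (nderiv j f x - nderiv j f y) \<le> B * \<bar>x - y\<bar>"
proof -
  obtain B where B: "\<And>j x. j \<le> 5 \<Longrightarrow> norm (nderiv j f x) \<le> B" "0 \<le> B"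
    by (rule X5_nderiv_bounded[OF assms]) blast
  have "norm (nderiv j f x - nderiv j f y) \<le> B * norm (x - y)" if "j \<le> 4" for j x y
  proof (rule differentiable_bound[where S = UNIV and f = "nderiv j f" and f' = "\<lambda>t y. y *\<^sub>R nderiv (Suc j) f t"])
    fix t :: real
    show "(nderiv j f has_derivative (\<lambda>y. y *\<^sub>R nderiv (Suc j) f t)) (at t within UNIV)"
      using Cn_has_vector_derivative[OF X5_Cn[OF assms, of 5], of j t] that
      by (simp add: has_vector_derivative_def)
    have "onorm (\<lambda>y. y *\<^sub>R nderiv (Suc j) f t) = norm (nderiv (Suc j) f t)"
      using onorm_scaleR_left[of "\<lambda>y. y" "nderiv (Suc j) f t"] by (simp add: onorm_id)
    then show "onorm (\<lambda>y. y *\<^sub>R nderiv (Suc j) f t) \<le> B"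
      using B(1)[of "Suc j" t] that by simp
  qed auto
  then show ?thesis
    using that B(2) by auto
qed

lemma C0_X_strip_bounded:
  assumes W: "window chi" and q: "q \<in> C0_X chi 5" and "j \<le> 5"
  shows "\<exists>B. \<forall>t\<in>{-T..T}. \<forall>x. norm (nderiv j (q t) x) \<le> B"
proof (rule bounded_on_compact_interval)
  fix t
  have qX: "q t \<in> X chi 5"
    using q by (simp add: C0_X_def)
  obtain d where d: "d > 0" "\<And>\<tau> x. \<bar>\<tau> - t\<bar> < d \<Longrightarrow> norm (nderiv j (q \<tau>) x - nderiv j (q t) x) < 1"
    using C0_X_nderiv_continuous[OF W q \<open>j \<le> 5\<close>, of 1 t] by auto
  obtain B where B: "\<And>j x. j \<le> 5 \<Longrightarrow> norm (nderiv j (q t) x) \<le> B" "0 \<le> B"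
    by (rule X5_nderiv_bounded[OF W qX]) blast
  have "norm (nderiv j (q \<tau>) x) \<le> B + 1" if "\<bar>\<tau> - t\<bar> < d" for \<tau> x
    using d(2)[OF that, of x] B(1)[OF \<open>j \<le> 5\<close>, of x] norm_triangle_sub[of "nderiv j (q \<tau>) x" "nderiv j (q t) x"]
    by simp
  then show "\<exists>d>0. \<exists>B. \<forall>\<tau>. \<bar>\<tau> - t\<bar> < d \<longrightarrow> (\<forall>x. norm (nderiv j (q \<tau>) x) \<le> B)"
    using d(1) by blast
qed

section \<open>Classical solutions and their time shifts\<close>

lemma strip_bounded_iff: "strip_bounded w \<longleftrightarrow> (\<forall>T. \<exists>B. \<forall>t\<in>{-T..T}. \<forall>x. norm (w t x) \<le> B)"
  unfolding strip_bounded_def bounded_iff by (auto simp: image_iff)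

text \<open>Solved for the time derivative, and with the cubic term written as v * cnj v * v, the
  right-hand side is assembled from linear maps and products and so passes to uniform
  limits.\<close>

lemma classical_solution_dt:
  assumes "classical_solution \<kappa> v"
  shows "((\<lambda>\<tau>. v \<tau> x) has_vector_derivative dt v t x) (at t)"
    and "dt v t x = \<i> / 2 * nderiv 2 (v t) x - \<i> * of_real \<kappa> * (v t x * cnj (v t x) * v t x)"
proof -
  show "((\<lambda>\<tau>. v \<tau> x) has_vector_derivative dt v t x) (at t)"
    using assms unfolding classical_solution_def dt_def by (simp add: vector_derivative_works)
  have "\<i> * dt v t x = - (1 / 2) * nderiv 2 (v t) x + of_real (\<kappa> * (norm (v t x))\<^sup>2) * v t x"
    using assms unfolding classical_solution_def by blast
  then have "- \<i> * (\<i> * dt v t x) = - \<i> * (- (1 / 2) * nderiv 2 (v t) x + of_real (\<kappa> * (norm (v t x))\<^sup>2) * v t x)"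
    by simp
  moreover have "of_real (\<kappa> * (norm (v t x))\<^sup>2) = complex_of_real \<kappa> * (v t x * cnj (v t x))"
    by (simp only: of_real_mult complex_norm_square)
  ultimately show "dt v t x = \<i> / 2 * nderiv 2 (v t) x - \<i> * of_real \<kappa> * (v t x * cnj (v t x) * v t x)"
    by (simp only:) (simp add: algebra_simps)
qed

text \<open>The equation expresses the time derivative through v and its second space derivative, so
  continuity of the former follows from that of the latter two.\<close>

lemma classical_solutionI:
  assumes v: "\<And>t x. ((\<lambda>\<tau>. v \<tau> x) has_vector_derivative
      \<i> / 2 * nderiv 2 (v t) x - \<i> * of_real \<kappa> * (v t x * cnj (v t x) * v t x)) (at t)"
    and "\<And>t. v t \<in> Cn 2"
    and cont: "\<And>j. j \<le> 2 \<Longrightarrow> continuous_on UNIV (\<lambda>(t, x). nderiv j (v t) x)"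
  shows "classical_solution \<kappa> v"
proof -
  have d: "dt v t x = \<i> / 2 * nderiv 2 (v t) x - \<i> * of_real \<kappa> * (v t x * cnj (v t x) * v t x)" for t x
    unfolding dt_def by (rule vector_derivative_at[OF v])
  have "continuous_on UNIV (\<lambda>(t, x). dt v t x)"
    unfolding d case_prod_beta' using cont[of 0] cont[of 2]
    by (intro continuous_intros) (auto simp: case_prod_beta')
  moreover have "\<i> * dt v t x = - (1 / 2) * nderiv 2 (v t) x + of_real (\<kappa> * (norm (v t x))\<^sup>2) * v t x" for t x
    unfolding d of_real_mult complex_norm_square by (simp add: algebra_simps)
  ultimately show ?thesis
    unfolding classical_solution_def using assms(2,3) differentiableI_vector[OF v] by blast
qed

lemma classical_solution_time_shift:
  assumes "classical_solution \<kappa> v"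
  shows "classical_solution \<kappa> (\<lambda>\<tau>. v (\<tau> + s))"
proof (rule classical_solutionI)
  fix t x
  have "((\<lambda>\<tau>. \<tau> + s) has_vector_derivative 1) (at t)"
    by (auto intro!: derivative_eq_intros)
  from vector_diff_chain_at[OF this classical_solution_dt(1)[OF assms, of x]]
  show "((\<lambda>\<tau>. v (\<tau> + s) x) has_vector_derivative
      \<i> / 2 * nderiv 2 (v (t + s)) x - \<i> * of_real \<kappa> * (v (t + s) x * cnj (v (t + s) x) * v (t + s) x)) (at t)"
    by (simp add: o_def classical_solution_dt(2)[OF assms])
  show "v (t + s) \<in> Cn 2"
    using assms by (simp add: classical_solution_def)
next
  fix j :: nat assume "j \<le> 2"
  then have "continuous_on UNIV (\<lambda>(t, x). nderiv j (v t) x)"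
    using assms by (simp add: classical_solution_def)
  from continuous_on_compose2[OF this, of UNIV "\<lambda>(t, x). (t + s, x)"]
  have "continuous_on UNIV (\<lambda>x :: real \<times> real. (fst x + s, snd x)) \<Longrightarrow>
      continuous_on UNIV (\<lambda>(t, x). nderiv j (v (t + s)) x)"
    by (simp add: case_prod_beta')
  moreover have "continuous_on UNIV (\<lambda>x :: real \<times> real. (fst x + s, snd x))"
    by (intro continuous_intros)
  ultimately show "continuous_on UNIV (\<lambda>(t, x). nderiv j (v (t + s)) x)"
    by blast
qed

lemma nls_flowD:
  assumes "nls_flow chi \<kappa> \<Phi>" "f \<in> X chi 5"
  shows "classical_solution \<kappa> (\<lambda>t. \<Phi> t f)" "(\<lambda>t. \<Phi> t f) \<in> C0_X chi 5" "\<Phi> t f \<in> X chi 5" "\<Phi> 0 f = f"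
    "\<And>v. classical_solution \<kappa> v \<Longrightarrow> strip_bounded v \<Longrightarrow> strip_bounded (\<lambda>t. nderiv 1 (v t)) \<Longrightarrow> v 0 = f
      \<Longrightarrow> v t = \<Phi> t f"
proof -
  note flow = bspec[OF assms(1)[unfolded nls_flow_def] assms(2)]
  have F: "classical_solution \<kappa> (\<lambda>t. \<Phi> t f)" "(\<lambda>t. \<Phi> t f) \<in> C0_X chi 5" "\<Phi> 0 f = f"
    using flow by simp_all
  have U: "\<forall>v. classical_solution \<kappa> v \<and> strip_bounded v \<and> strip_bounded (\<lambda>t. nderiv 1 (v t)) \<and>
        v 0 = f \<longrightarrow> (\<forall>t. v t = \<Phi> t f)"
    by (rule flow[THEN conjunct2, THEN conjunct2, THEN conjunct2])
  show "classical_solution \<kappa> (\<lambda>t. \<Phi> t f)" "(\<lambda>t. \<Phi> t f) \<in> C0_X chi 5" "\<Phi> 0 f = f"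
    by fact+
  show "\<Phi> t f \<in> X chi 5"
    using F(2) by (simp add: C0_X_def)
  show "v t = \<Phi> t f" if "classical_solution \<kappa> v" "strip_bounded v" "strip_bounded (\<lambda>t. nderiv 1 (v t))" "v 0 = f" for v
    using U that by blast
qed

text \<open>The solution shifted by t starts at \<open>\<Phi> t f\<close> and stays in the
  uniqueness class, so it is the flow of \<open>\<Phi> t f\<close>; at time -t it is back at
  \<open>f\<close>.\<close>

lemma flow_inverse:
  assumes W: "window chi" and P: "nls_flow chi \<kappa> \<Phi>" and f: "f \<in> X chi 5"
  shows "\<Phi> (- t) (\<Phi> t f) = f"
proof -
  note F = nls_flowD[OF P f]
  have sb: "strip_bounded (\<lambda>\<tau>. nderiv j (\<Phi> (\<tau> + t) f))" if j: "j \<le> 5" for j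
    unfolding strip_bounded_iff
  proof
    fix T
    obtain B where B: "\<And>\<tau> x. \<tau> \<in> {- (\<bar>T\<bar> + \<bar>t\<bar>)..\<bar>T\<bar> + \<bar>t\<bar>} \<Longrightarrow> norm (nderiv j (\<Phi> \<tau> f) x) \<le> B"
      using C0_X_strip_bounded[OF W F(2) j] by blast
    have "\<tau> + t \<in> {- (\<bar>T\<bar> + \<bar>t\<bar>)..\<bar>T\<bar> + \<bar>t\<bar>}" if "\<tau> \<in> {-T..T}" for \<tau>
      using that by auto
    then show "\<exists>B. \<forall>\<tau>\<in>{-T..T}. \<forall>x. norm (nderiv j (\<Phi> (\<tau> + t) f) x) \<le> B"
      using B by blast
  qed
  have "(\<lambda>\<tau>. \<Phi> (\<tau> + t) f) (- t) = \<Phi> (- t) (\<Phi> t f)"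
    by (rule nls_flowD(5)[OF P F(3)])
      (use sb[of 0] sb[of 1] in \<open>auto intro: classical_solution_time_shift F(1)\<close>)
  then show ?thesis
    by (simp add: F(4))
qed

section \<open>Limits of translated solutions\<close>

text \<open>Compactness is applied in space-time, so one subsequence serves all times. Strip bounds
  of the solution carry over to the limit and place it in the uniqueness class; membership in X_5
  has to be shown for its slice at time 0 only.\<close>

lemma flow_translate_subsequence:
  assumes W: "window chi" and P: "nls_flow chi \<kappa> \<Phi>" and f: "f \<in> X chi 5"
  obtains r g where "strict_mono (r :: nat \<Rightarrow> nat)" "g \<in> X chi 5"
    "\<And>t. limitin (Cn_loc 4) (\<lambda>n. translate (y (r n)) (\<Phi> t f)) (\<Phi> t g) sequentially"
proof -
  note flow = nls_flowD[OF P f]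
  \<comment> \<open>Capping the order at 4 gives a family indexed by all natural numbers, as the
    diagonal argument expects, within the range where Lipschitz bounds hold.\<close>
  define F where "F j n p = nderiv (min j 4) (\<Phi> (fst p) f) (snd p + y n)" for j n and p :: "real \<times> real"
  have C: "\<Phi> t f \<in> Cn n" if "n \<le> 5" for t n
    by (rule X5_Cn[OF W flow(3) that])
  have j4: "min j 4 \<le> 4" and j5: "min j 4 \<le> 5" for j :: nat
    by auto
  have F_eq: "nderiv j (translate (y n) (\<Phi> t f)) x = F j n (t, x)" if "j \<le> 4" for j n t x
    using Cn_translate(2)[OF C[of 4 t] that, of "y n"] that by (simp add: F_def translate_def)
  have bound: "\<exists>B. \<forall>n. \<forall>p. \<bar>fst p\<bar> \<le> T \<longrightarrow> norm (F j n p) \<le> B" for j T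
  proof -
    obtain B where B: "\<And>t x. t \<in> {-T..T} \<Longrightarrow> norm (nderiv (min j 4) (\<Phi> t f) x) \<le> B"
      using C0_X_strip_bounded[OF W flow(2) j5[of j], of T] by blast
    have "norm (F j n p) \<le> B" if "\<bar>fst p\<bar> \<le> T" for n p
      unfolding F_def using that by (intro B) auto
    then show ?thesis
      by blast
  qed
  have bound_ball: "\<exists>M. \<forall>n. \<forall>p\<in>cball 0 (real m). norm (F j n p) \<le> M" for j m
  proof -
    obtain B where B: "\<And>n p. \<bar>fst p\<bar> \<le> real m \<Longrightarrow> norm (F j n p) \<le> B"
      using bound[of "real m" j] by blast
    have "norm (F j n p) \<le> B" if "p \<in> cball 0 (real m)" for n p
      using that norm_fst_le[of "fst p" "snd p"] by (intro B) simp
    then show ?thesis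
      by blast
  qed
  have equi: "\<exists>d>0. \<forall>n p'. norm (p - p') < d \<longrightarrow> norm (F j n p - F j n p') < e" if e: "0 < e" for j p e
  proof -
    obtain t x where p: "p = (t, x)"
      by (cases p)
    obtain d where d: "d > 0" "\<And>\<tau> x. \<bar>\<tau> - t\<bar> < d \<Longrightarrow>
        norm (nderiv (min j 4) (\<Phi> \<tau> f) x - nderiv (min j 4) (\<Phi> t f) x) < e / 2"
      using C0_X_nderiv_continuous[OF W flow(2) j5[of j], of "e / 2" t] e unfolding half_gt_zero_iff by blast
    obtain B where B: "0 \<le> B"
      "\<And>j x y. j \<le> 4 \<Longrightarrow> norm (nderiv j (\<Phi> t f) x - nderiv j (\<Phi> t f) y) \<le> B * \<bar>x - y\<bar>"
      by (rule X5_nderiv_lipschitz[OF W flow(3)]) blast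
    \<comment> \<open>Half of e pays for the change of time, half for the change of position;
      neither estimate involves the translation \<open>y n\<close>.\<close>
    define d' where "d' = min d (e / (2 * (B + 1)))"
    have d': "0 < d'" "d' \<le> d" "d' \<le> e / (2 * (B + 1))"
      using d(1) e B(1) by (auto simp: d'_def)
    have "norm (F j n p - F j n p') < e" if "norm (p - p') < d'" for n p'
    proof -
      obtain \<tau> z where p': "p' = (\<tau>, z)"
        by (cases p')
      have tz: "\<bar>\<tau> - t\<bar> < d'" "\<bar>x - z\<bar> < d'"
        using that norm_fst_le[of "t - \<tau>" "x - z"] norm_snd_le[of "x - z" "t - \<tau>"]
        by (auto simp: p p' abs_minus_commute)
      have "B * \<bar>x - z\<bar> \<le> B * (e / (2 * (B + 1)))"
        using tz d' B(1) by (intro mult_left_mono) auto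
      also have "\<dots> \<le> e / 2"
        using B(1) e by (simp add: field_simps)
      finally have "norm (nderiv (min j 4) (\<Phi> t f) (x + y n) - nderiv (min j 4) (\<Phi> t f) (z + y n)) \<le> e / 2"
        using B(2)[OF j4[of j], of "x + y n" "z + y n"] by simp
      moreover have "norm (nderiv (min j 4) (\<Phi> \<tau> f) (z + y n) - nderiv (min j 4) (\<Phi> t f) (z + y n)) < e / 2"
        using tz d' by (intro d(2)) auto
      ultimately have "norm ((nderiv (min j 4) (\<Phi> t f) (x + y n) - nderiv (min j 4) (\<Phi> t f) (z + y n))
          - (nderiv (min j 4) (\<Phi> \<tau> f) (z + y n) - nderiv (min j 4) (\<Phi> t f) (z + y n))) < e"
        using norm_triangle_ineq4[of "nderiv (min j 4) (\<Phi> t f) (x + y n) - nderiv (min j 4) (\<Phi> t f) (z + y n)"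
          "nderiv (min j 4) (\<Phi> \<tau> f) (z + y n) - nderiv (min j 4) (\<Phi> t f) (z + y n)"] by linarith
      then show ?thesis
        by (simp add: F_def p p')
    qed
    then show ?thesis
      using d'(1) by blast
  qed
  obtain r G where r: "strict_mono (r :: nat \<Rightarrow> nat)"
    and unif: "\<And>j m. uniform_limit (cball 0 (real m)) (\<lambda>n. F j (r n)) (G j) sequentially"
    and G: "\<And>j. continuous_on UNIV (G j)"
    using Arzela_Ascoli_diagonal[of F, OF bound_ball equi] by blast
  have unif_A: "uniform_limit A (\<lambda>n z. F j (r n) (h z)) (\<lambda>z. G j (h z)) sequentially"
    if h: "\<And>z. z \<in> A \<Longrightarrow> norm (h z) \<le> R" for j h and A :: "real set" and R
  proof -
    obtain m where "R \<le> real m"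
      using real_arch_simple by blast
    then have "h z \<in> cball 0 (real m)" if "z \<in> A" for z
      using h[OF that] by simp
    then show ?thesis
      using unif[of j m] unfolding uniform_limit_iff by (force elim!: eventually_mono)
  qed
  have lim: "(\<lambda>n. F j (r n) p) \<longlonglongrightarrow> G j p" for j p
    using tendsto_uniform_limitI[OF unif_A[of "{0}" "\<lambda>_. p" "norm p" j], of 0] by simp
  define v where "v t x = G 0 (t, x)" for t x
  have space: "uniform_limit {-\<rho>..\<rho>} (\<lambda>n. nderiv j (translate (y (r n)) (\<Phi> t f))) (\<lambda>x. G j (t, x)) sequentially"
    if "j \<le> 4" for j t \<rho>
  proof -
    have "norm (t, x) \<le> \<bar>t\<bar> + \<bar>\<rho>\<bar>" if "x \<in> {-\<rho>..\<rho>}" for x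
      using that norm_Pair_le[of t x] by auto
    from unif_A[where h = "\<lambda>x. (t, x)" and A = "{-\<rho>..\<rho>}" and j = j, OF this]
    have "uniform_limit {-\<rho>..\<rho>} (\<lambda>n x. F j (r n) (t, x)) (\<lambda>x. G j (t, x)) sequentially" .
    moreover have "nderiv j (translate (y (r n)) (\<Phi> t f)) = (\<lambda>x. F j (r n) (t, x))" for n
      using F_eq[OF that] by blast
    ultimately show ?thesis
      by simp
  qed
  have tC: "translate z (\<Phi> t f) \<in> Cn 4" for z t
    by (rule Cn_translate(1)[OF C]) simp
  have v: "v t \<in> Cn 4" "\<And>j. j \<le> 4 \<Longrightarrow> nderiv j (v t) = (\<lambda>x. G j (t, x))" for t
    using Cn_sequential_limit[of "\<lambda>n. translate (y (r n)) (\<Phi> t f)" 4 "\<lambda>j x. G j (t, x)", OF tC space]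
    by (simp_all add: v_def[abs_def])
  have limit: "limitin (Cn_loc 4) (\<lambda>n. translate (y (r n)) (\<Phi> t f)) (v t) sequentially" for t
    unfolding limitin_Cn_loc_iff[OF tC v(1)] using space v(2) by simp
  have dt_v: "((\<lambda>\<tau>. v \<tau> x) has_vector_derivative
      \<i> / 2 * nderiv 2 (v t) x - \<i> * of_real \<kappa> * (v t x * cnj (v t x) * v t x)) (at t)" for t x
  proof -
    \<comment> \<open>The right-hand side of the equation as a function of the second space
      derivative \<open>a\<close> and the value \<open>b\<close>. For fixed x, both converge
      uniformly in time on compact intervals, which allows differentiating the limit in
      time.\<close>
    let ?N = "\<lambda>a b. \<i> / 2 * a - \<i> * of_real \<kappa> * (b * cnj b * b)"
    have "((\<lambda>\<tau>. G 0 (\<tau>, x)) has_vector_derivative ?N (G 2 (t, x)) (G 0 (t, x))) (at t)"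
    proof (rule has_vector_derivative_sequential_limit[where f = "\<lambda>n \<tau>. F 0 (r n) (\<tau>, x)"
          and f' = "\<lambda>n \<tau>. ?N (F 2 (r n) (\<tau>, x)) (F 0 (r n) (\<tau>, x))"])
      show "((\<lambda>\<tau>. F 0 (r n) (\<tau>, x)) has_vector_derivative ?N (F 2 (r n) (\<tau>, x)) (F 0 (r n) (\<tau>, x))) (at \<tau>)" for n \<tau>
        using classical_solution_dt(1)[OF flow(1), of "x + y (r n)" \<tau>]
        unfolding classical_solution_dt(2)[OF flow(1)] by (simp add: F_def)
      show "(\<lambda>n. F 0 (r n) (\<tau>, x)) \<longlonglongrightarrow> G 0 (\<tau>, x)" for \<tau>
        by (rule lim)
      fix \<rho>
      have u: "uniform_limit {-\<rho>..\<rho>} (\<lambda>n \<tau>. F j (r n) (\<tau>, x)) (\<lambda>\<tau>. G j (\<tau>, x)) sequentially" for j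
      proof (rule unif_A)
        show "norm (\<tau>, x) \<le> \<bar>\<rho>\<bar> + \<bar>x\<bar>" if "\<tau> \<in> {-\<rho>..\<rho>}" for \<tau>
          using that norm_Pair_le[of \<tau> x] by auto
      qed
      have c: "continuous_on {-\<rho>..\<rho>} (\<lambda>\<tau>. G 0 (\<tau>, x))"
        by (intro continuous_on_compose2[OF G] continuous_intros) auto
      \<comment> \<open>\<open>uniform_lim_mult\<close> asks for bounded limits; continuity on a
        compact time interval provides them, including for the intermediate product.\<close>
      have b: "bounded ((\<lambda>\<tau>. G 0 (\<tau>, x)) ` {-\<rho>..\<rho>})" "bounded ((\<lambda>\<tau>. cnj (G 0 (\<tau>, x))) ` {-\<rho>..\<rho>})"
        "bounded ((\<lambda>\<tau>. G 0 (\<tau>, x) * cnj (G 0 (\<tau>, x))) ` {-\<rho>..\<rho>})"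
        by (intro compact_imp_bounded compact_continuous_image continuous_intros c; simp)+
      have const: "uniform_limit {-\<rho>..\<rho>} (\<lambda>n \<tau>. k * w n \<tau>) (\<lambda>\<tau>. k * w' \<tau>) sequentially"
        if "uniform_limit {-\<rho>..\<rho>} w w' sequentially" for k :: complex and w w'
        using bounded_linear.uniform_limit[OF bounded_linear_mult_right[of k] that] .
      have "uniform_limit {-\<rho>..\<rho>} (\<lambda>n \<tau>. cnj (F 0 (r n) (\<tau>, x))) (\<lambda>\<tau>. cnj (G 0 (\<tau>, x))) sequentially"
        by (rule bounded_linear.uniform_limit[OF bounded_linear_cnj u])
      then show "uniform_limit {-\<rho>..\<rho>} (\<lambda>n \<tau>. ?N (F 2 (r n) (\<tau>, x)) (F 0 (r n) (\<tau>, x)))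
          (\<lambda>\<tau>. ?N (G 2 (\<tau>, x)) (G 0 (\<tau>, x))) sequentially"
        by (intro uniform_limit_minus const uniform_lim_mult u b)
    qed
    then show ?thesis
      using v(2)[of 2 t] by (simp add: v_def[abs_def])
  qed
  have sol: "classical_solution \<kappa> v"
  proof (rule classical_solutionI[OF dt_v])
    show "v t \<in> Cn 2" for t
      by (rule Cn_mono[OF v(1)]) simp
    show "continuous_on UNIV (\<lambda>(t, x). nderiv j (v t) x)" if "j \<le> 2" for j
      using v(2)[of j] that G[of j] by (simp add: case_prod_beta')
  qed
  have sb: "strip_bounded (\<lambda>t. nderiv j (v t))" if "j \<le> 4" for j
    unfolding strip_bounded_iff
  proof
    fix T
    obtain B where B: "\<And>n p. \<bar>fst p\<bar> \<le> T \<Longrightarrow> norm (F j n p) \<le> B"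
      using bound[of T j] by blast
    have "norm (nderiv j (v t) x) \<le> B" if "t \<in> {-T..T}" for t x
      unfolding v(2)[OF \<open>j \<le> 4\<close>] using tendsto_norm[OF lim[of j "(t, x)"]]
      by (rule LIMSEQ_le_const2) (use that in \<open>auto intro!: B\<close>)
    then show "\<exists>B. \<forall>t\<in>{-T..T}. \<forall>x. norm (nderiv j (v t) x) \<le> B"
      by blast
  qed
  have v0: "v 0 \<in> X chi 5"
  proof (rule X_translate_limit(1)[OF W f])
    show "(\<lambda>n. translate (y (r n)) f x) \<longlonglongrightarrow> v 0 x" for x
      using lim[of 0 "(0, x)"] by (simp add: F_def v_def translate_def flow(4))
    show "continuous_on UNIV (v 0)"
      using Cn_continuous_on[OF v(1), of 0] by simp
  qed
  have "strip_bounded v" "strip_bounded (\<lambda>t. nderiv 1 (v t))"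
    using sb[of 0] sb[of 1] by simp_all
  then have "v t = \<Phi> t (v 0)" for t
    by (rule nls_flowD(5)[OF P v0 sol _ _ refl])
  then show ?thesis
    using that[OF r v0] limit by metis
qed

lemma limitin_Cn_loc_pointwise:
  assumes "limitin (Cn_loc n) \<sigma> l sequentially" "\<And>k. \<sigma> k \<in> Cn n"
  shows "(\<lambda>k. \<sigma> k x) \<longlonglongrightarrow> l x"
proof -
  have "l \<in> Cn n"
    using assms(1) by (simp add: limitin_def topspace_Cn_loc)
  then have "uniform_limit {-\<bar>x\<bar>..\<bar>x\<bar>} (\<lambda>k. nderiv 0 (\<sigma> k)) (nderiv 0 l) sequentially"
    using assms limitin_Cn_loc_iff by blast
  from tendsto_uniform_limitI[OF this, of x] show ?thesis
    using abs_le_iff[of x "\<bar>x\<bar>"] by simp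
qed

text \<open>Compactness gives limits only along subsequences, with an initial value
  \<open>g'\<close> that might depend on the subsequence. At time 0 pointwise limits force
  \<open>g' = g\<close>, and the subsequence principle then yields convergence of the whole
  sequence.\<close>

lemma translate_flow_limit:
  assumes W: "window chi" and P: "nls_flow chi \<kappa> \<Phi>" and f: "f \<in> X chi 5"
    and lim: "limitin (Cn_loc 4) (\<lambda>n. translate (y n) f) g sequentially"
  shows "g \<in> X chi 5" "Xnorm chi 5 g \<le> Xnorm chi 5 f"
    and "limitin (Cn_loc 4) (\<lambda>n. translate (y n) (\<Phi> t f)) (\<Phi> t g) sequentially"
proof -
  have tC: "translate z h \<in> Cn 4" if "h \<in> X chi 5" for z h
    by (rule Cn_translate(1)[OF X5_Cn[OF W that]]) simp
  have pw: "(\<lambda>n. translate (y n) f x) \<longlonglongrightarrow> g x" for x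
    by (rule limitin_Cn_loc_pointwise[OF lim tC[OF f]])
  have "g \<in> Cn 4"
    using lim by (simp add: limitin_def topspace_Cn_loc)
  then have "continuous_on UNIV g"
    using Cn_continuous_on[of g 4 0] by simp
  from X_translate_limit[OF W f pw this] show g: "g \<in> X chi 5" "Xnorm chi 5 g \<le> Xnorm chi 5 f" .
  show "limitin (Cn_loc 4) (\<lambda>n. translate (y n) (\<Phi> t f)) (\<Phi> t g) sequentially"
    unfolding mtopology_Cn[symmetric]
  proof (rule Cn.limitin_if_subsequences)
    show "\<Phi> t g \<in> Cn 4"
      by (rule X5_Cn[OF W nls_flowD(3)[OF P g(1)]]) simp
    show "range (\<lambda>n. translate (y n) (\<Phi> t f)) \<subseteq> Cn 4"
      using tC nls_flowD(3)[OF P f] by blast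
    fix r :: "nat \<Rightarrow> nat" assume r: "strict_mono r"
    obtain s g' where s: "strict_mono (s :: nat \<Rightarrow> nat)" "g' \<in> X chi 5"
      "\<And>t. limitin (Cn_loc 4) (\<lambda>n. translate (y (r (s n))) (\<Phi> t f)) (\<Phi> t g') sequentially"
      by (rule flow_translate_subsequence[OF W P f, of "\<lambda>n. y (r n)"]) blast
    have "g' x = g x" for x
    proof (rule LIMSEQ_unique)
      have "limitin (Cn_loc 4) (\<lambda>n. translate (y (r (s n))) f) g' sequentially"
        using s(3)[of 0] by (simp add: nls_flowD(4)[OF P f] nls_flowD(4)[OF P s(2)])
      then show "(\<lambda>n. translate (y (r (s n))) f x) \<longlonglongrightarrow> g' x"
        by (rule limitin_Cn_loc_pointwise) (rule tC[OF f])
      show "(\<lambda>n. translate (y (r (s n))) f x) \<longlonglongrightarrow> g x"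
        using LIMSEQ_subseq_LIMSEQ[OF LIMSEQ_subseq_LIMSEQ[OF pw r] s(1)] by (simp add: o_def)
    qed
    then have "g' = g"
      by blast
    then show "\<exists>s. strict_mono s \<and> limitin (Cn.mtopology 4) ((\<lambda>n. translate (y n) (\<Phi> t f)) \<circ> r \<circ> s) (\<Phi> t g) sequentially"
      using s by (auto simp: o_def mtopology_Cn)
  qed
qed

text \<open>The limit theorem is applied to a constant sequence: the translates of
  \<open>\<Phi> t f\<close> by the fixed \<open>y\<close> converge to
  \<open>\<Phi> t (translate y f)\<close> and are constant, so the two agree.\<close>

lemma flow_translate:
  assumes W: "window chi" and P: "nls_flow chi \<kappa> \<Phi>" and f: "f \<in> X chi 5"
  shows "\<Phi> t (translate y f) = translate y (\<Phi> t f)"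
proof
  fix x
  have tC: "translate y h \<in> Cn 4" if "h \<in> X chi 5" for h
    by (rule Cn_translate(1)[OF X5_Cn[OF W that]]) simp
  have "limitin (Cn_loc 4) (\<lambda>n::nat. translate y f) (translate y f) sequentially"
    using tC[OF f] by (simp add: topspace_Cn_loc)
  then have "limitin (Cn_loc 4) (\<lambda>n::nat. translate y (\<Phi> t f)) (\<Phi> t (translate y f)) sequentially"
    by (rule translate_flow_limit(3)[OF W P f])
  then have "(\<lambda>n::nat. translate y (\<Phi> t f) x) \<longlonglongrightarrow> \<Phi> t (translate y f) x"
    by (rule limitin_Cn_loc_pointwise) (rule tC[OF nls_flowD(3)[OF P f]])
  then show "\<Phi> t (translate y f) x = translate y (\<Phi> t f) x"
    by (simp add: LIMSEQ_const_iff)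
qed

section \<open>The hull and the flow on it\<close>

lemma Hloc_iff:
  assumes W: "window chi" and f: "f \<in> X chi 5"
  shows "g \<in> Hloc f \<longleftrightarrow> (\<exists>y. limitin (Cn_loc 4) (\<lambda>n. translate (y n) f) g sequentially)"
proof
  have tC: "translate z f \<in> Cn 4" for z
    by (rule Cn_translate(1)[OF X5_Cn[OF W f]]) simp
  {
    assume "g \<in> Hloc f"
    then obtain \<sigma> where \<sigma>: "range \<sigma> \<subseteq> range (\<lambda>y. translate y f)" "limitin (Cn_loc 4) \<sigma> g sequentially"
      unfolding Hloc_def mtopology_Cn[symmetric] Cn.closure_of_sequentially by blast
    then have "\<forall>n. \<exists>y. \<sigma> n = translate y f"
      by blast
    then obtain y where "\<And>n. \<sigma> n = translate (y n) f"
      by metis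
    then have "\<sigma> = (\<lambda>n. translate (y n) f)"
      by blast
    then show "\<exists>y. limitin (Cn_loc 4) (\<lambda>n. translate (y n) f) g sequentially"
      using \<sigma>(2) by blast
  next
    assume "\<exists>y. limitin (Cn_loc 4) (\<lambda>n. translate (y n) f) g sequentially"
    then obtain y where y: "limitin (Cn_loc 4) (\<lambda>n. translate (y n) f) g sequentially"
      by blast
    then have "g \<in> Cn 4"
      by (simp add: limitin_def topspace_Cn_loc)
    then show "g \<in> Hloc f"
      unfolding Hloc_def mtopology_Cn[symmetric] Cn.closure_of_sequentially
      using y tC by (auto simp: mtopology_Cn intro!: exI[of _ "\<lambda>n. translate (y n) f"])
  }
qed

lemma Hloc_X:
  assumes W: "window chi" and P: "nls_flow chi \<kappa> \<Phi>" and f: "f \<in> X chi 5" and g: "g \<in> Hloc f"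
  shows "g \<in> X chi 5" "Xnorm chi 5 g \<le> Xnorm chi 5 f" "\<Phi> t g \<in> Hloc (\<Phi> t f)"
proof -
  obtain y where y: "limitin (Cn_loc 4) (\<lambda>n. translate (y n) f) g sequentially"
    using g Hloc_iff[OF W f] by blast
  show "g \<in> X chi 5" "Xnorm chi 5 g \<le> Xnorm chi 5 f"
    using translate_flow_limit[OF W P f y] by blast+
  show "\<Phi> t g \<in> Hloc (\<Phi> t f)"
    unfolding Hloc_iff[OF W nls_flowD(3)[OF P f]] using translate_flow_limit(3)[OF W P f y] by blast
qed

text \<open>Both limits run along the same sequence of translations, so a single \<open>y\<close>
  approximates the point and its image. This coupling is what transfers results from translates to
  the whole hull.\<close>

lemma Hloc_approx:
  assumes W: "window chi" and P: "nls_flow chi \<kappa> \<Phi>" and f: "f \<in> X chi 5" and g: "g \<in> Hloc f" and "0 < e"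
  shows "\<exists>y. Cn_dist 4 (translate y f) g < e \<and> Cn_dist 4 (translate y (\<Phi> t f)) (\<Phi> t g) < e"
proof -
  obtain y where y: "limitin (Cn_loc 4) (\<lambda>n. translate (y n) f) g sequentially"
    using g Hloc_iff[OF W f] by blast
  from y translate_flow_limit(3)[OF W P f y, of t]
  have "(\<lambda>n. Cn_dist 4 (translate (y n) f) g) \<longlonglongrightarrow> 0"
    "(\<lambda>n. Cn_dist 4 (translate (y n) (\<Phi> t f)) (\<Phi> t g)) \<longlonglongrightarrow> 0"
    unfolding mtopology_Cn[symmetric] Cn.limitin_metric_dist_null by blast+
  then have "\<forall>\<^sub>F n in sequentially. Cn_dist 4 (translate (y n) f) g < e"
    "\<forall>\<^sub>F n in sequentially. Cn_dist 4 (translate (y n) (\<Phi> t f)) (\<Phi> t g) < e"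
    using \<open>0 < e\<close> order_tendstoD(2) by blast+
  then have "\<forall>\<^sub>F n in sequentially. Cn_dist 4 (translate (y n) f) g < e
      \<and> Cn_dist 4 (translate (y n) (\<Phi> t f)) (\<Phi> t g) < e"
    by eventually_elim simp
  then show ?thesis
    using eventually_happens'[OF sequentially_bot] by blast
qed

lemma (in Metric_space) limitin_close:
  assumes a: "limitin mtopology a l sequentially" and ab: "\<And>n. a n \<in> M" "\<And>n. b n \<in> M"
    and "(\<lambda>n. d (a n) (b n)) \<longlonglongrightarrow> 0"
  shows "limitin mtopology b l sequentially"
  unfolding limitin_metric_dist_null
proof (intro conjI)
  show l: "l \<in> M"
    using a by (simp add: limitin_metric_dist_null)
  show "\<forall>\<^sub>F n in sequentially. b n \<in> M"
    using ab by simp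
  have "(\<lambda>n. d (a n) (b n) + d (a n) l) \<longlonglongrightarrow> 0"
    using a assms(4) by (intro tendsto_add_zero) (auto simp: limitin_metric_dist_null)
  moreover have "\<forall>\<^sub>F n in sequentially. norm (d (b n) l) \<le> d (a n) (b n) + d (a n) l"
    using triangle[OF ab(2) ab(1) l] commute by auto
  ultimately show "(\<lambda>n. d (b n) l) \<longlonglongrightarrow> 0"
    by (rule Lim_null_comparison[rotated])
qed

lemma Hloc_approx_sequence:
  assumes W: "window chi" and P: "nls_flow chi \<kappa> \<Phi>" and f: "f \<in> X chi 5" and \<sigma>: "range \<sigma> \<subseteq> Hloc f"
  obtains y where "(\<lambda>n. Cn_dist 4 (translate (y n) f) (\<sigma> n)) \<longlonglongrightarrow> 0"
    "(\<lambda>n. Cn_dist 4 (translate (y n) (\<Phi> t f)) (\<Phi> t (\<sigma> n))) \<longlonglongrightarrow> 0"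
proof -
  have "\<forall>n. \<exists>y. Cn_dist 4 (translate y f) (\<sigma> n) < 1 / real (Suc n) \<and>
      Cn_dist 4 (translate y (\<Phi> t f)) (\<Phi> t (\<sigma> n)) < 1 / real (Suc n)"
    using \<sigma> by (intro allI Hloc_approx[OF W P f]) auto
  then obtain y where y: "\<And>n. Cn_dist 4 (translate (y n) f) (\<sigma> n) < 1 / real (Suc n)"
    "\<And>n. Cn_dist 4 (translate (y n) (\<Phi> t f)) (\<Phi> t (\<sigma> n)) < 1 / real (Suc n)"
    by metis
  have inv: "(\<lambda>n. 1 / real (Suc n)) \<longlonglongrightarrow> 0"
    by real_asymp
  show ?thesis
  proof (rule that[of y])
    show "(\<lambda>n. Cn_dist 4 (translate (y n) f) (\<sigma> n)) \<longlonglongrightarrow> 0"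
      by (rule Lim_null_comparison[OF _ inv]) (use y(1) in \<open>auto simp: less_imp_le simp del: of_nat_Suc\<close>)
    show "(\<lambda>n. Cn_dist 4 (translate (y n) (\<Phi> t f)) (\<Phi> t (\<sigma> n))) \<longlonglongrightarrow> 0"
      by (rule Lim_null_comparison[OF _ inv]) (use y(2) in \<open>auto simp: less_imp_le simp del: of_nat_Suc\<close>)
  qed
qed

text \<open>A sequence in the hull is shadowed by translates of \<open>f\<close> at distances
  tending to 0, and a convergent subsequence of the translates carries the original one
  along.\<close>

lemma compactin_Hloc:
  assumes W: "window chi" and P: "nls_flow chi \<kappa> \<Phi>" and f: "f \<in> X chi 5"
  shows "compactin (Cn_loc 4) (Hloc f)"
  unfolding mtopology_Cn[symmetric] Cn.compactin_sequentially
proof (intro conjI allI impI)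
  have HC: "h \<in> Cn 4" if "h \<in> Hloc f" for h
    by (rule X5_Cn[OF W Hloc_X(1)[OF W P f that]]) simp
  then show "Hloc f \<subseteq> Cn 4"
    by blast
  have tC: "translate z f \<in> Cn 4" for z
    by (rule Cn_translate(1)[OF X5_Cn[OF W f]]) simp
  fix \<sigma> :: "nat \<Rightarrow> _" assume \<sigma>: "range \<sigma> \<subseteq> Hloc f"
  obtain y where y: "(\<lambda>n. Cn_dist 4 (translate (y n) f) (\<sigma> n)) \<longlonglongrightarrow> 0"
    by (rule Hloc_approx_sequence[OF W P f \<sigma>, of 0]) blast
  obtain r g where r: "strict_mono (r :: nat \<Rightarrow> nat)" and g: "g \<in> X chi 5"
    "\<And>t. limitin (Cn_loc 4) (\<lambda>n. translate (y (r n)) (\<Phi> t f)) (\<Phi> t g) sequentially"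
    by (rule flow_translate_subsequence[OF W P f, of y]) blast
  \<comment> \<open>The convergence holds at all times; at time 0 the flow is the identity.\<close>
  have lim: "limitin (Cn_loc 4) (\<lambda>n. translate (y (r n)) f) g sequentially"
    using g(2)[of 0] by (simp add: nls_flowD(4)[OF P f] nls_flowD(4)[OF P g(1)])
  have "g \<in> Hloc f"
    unfolding Hloc_iff[OF W f] by (rule exI, rule lim)
  moreover have "limitin (Cn.mtopology 4) (\<sigma> \<circ> r) g sequentially"
  proof (rule Cn.limitin_close)
    show "limitin (Cn.mtopology 4) (\<lambda>n. translate (y (r n)) f) g sequentially"
      unfolding mtopology_Cn by (rule lim)
    show "(\<sigma> \<circ> r) n \<in> Cn 4" for n
      using \<sigma> HC by auto
    show "(\<lambda>n. Cn_dist 4 (translate (y (r n)) f) ((\<sigma> \<circ> r) n)) \<longlonglongrightarrow> 0"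
      using LIMSEQ_subseq_LIMSEQ[OF y r] by (simp add: o_def)
  qed (rule tC)
  ultimately show "\<exists>l r. l \<in> Hloc f \<and> strict_mono r \<and> limitin (Cn.mtopology 4) (\<sigma> \<circ> r) l sequentially"
    using r by blast
qed

text \<open>Shadowing replaces \<open>\<sigma> n\<close> by translates of \<open>f\<close> and, with
  the same \<open>y n\<close>, \<open>\<Phi> t (\<sigma> n)\<close> by translates of
  \<open>\<Phi> t f\<close>; \<open>translate_flow_limit\<close> connects the two sequences of
  translates.\<close>

lemma continuous_map_flow_Hloc:
  assumes W: "window chi" and P: "nls_flow chi \<kappa> \<Phi>" and f: "f \<in> X chi 5"
  shows "continuous_map (subtopology (Cn_loc 4) (Hloc f)) (subtopology (Cn_loc 4) (Hloc (\<Phi> t f))) (\<Phi> t)"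
proof -
  have HX: "h \<in> X chi 5" if "h \<in> Hloc f" for h
    by (rule Hloc_X(1)[OF W P f that])
  have HC: "h \<in> Cn 4" "\<Phi> t h \<in> Cn 4" if "h \<in> Hloc f" for h
    by (rule X5_Cn[OF W HX[OF that]], simp, rule X5_Cn[OF W nls_flowD(3)[OF P HX[OF that]]], simp)
  have tC: "translate z h \<in> Cn 4" if "h \<in> X chi 5" for z h
    by (rule Cn_translate(1)[OF X5_Cn[OF W that]]) simp
  have "continuous_map (subtopology (Cn.mtopology 4) (Hloc f)) (Cn.mtopology 4) (\<Phi> t)"
  proof (rule Cn.continuous_map_sequentiallyI)
    fix \<sigma> l assume \<sigma>: "range \<sigma> \<subseteq> Hloc f" and l: "l \<in> Hloc f" "limitin (Cn.mtopology 4) \<sigma> l sequentially"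
    have \<sigma>H: "\<sigma> n \<in> Hloc f" for n
      using \<sigma> by blast
    obtain y where y: "(\<lambda>n. Cn_dist 4 (translate (y n) f) (\<sigma> n)) \<longlonglongrightarrow> 0"
      "(\<lambda>n. Cn_dist 4 (translate (y n) (\<Phi> t f)) (\<Phi> t (\<sigma> n))) \<longlonglongrightarrow> 0"
      by (rule Hloc_approx_sequence[OF W P f \<sigma>, of t]) blast
    have "limitin (Cn.mtopology 4) (\<lambda>n. translate (y n) f) l sequentially"
      by (rule Cn.limitin_close[OF l(2) HC(1)[OF \<sigma>H] tC[OF f]]) (use y(1) in \<open>simp add: Cn.commute\<close>)
    then have "limitin (Cn.mtopology 4) (\<lambda>n. translate (y n) (\<Phi> t f)) (\<Phi> t l) sequentially"
      unfolding mtopology_Cn by (rule translate_flow_limit(3)[OF W P f])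
    then have "limitin (Cn.mtopology 4) (\<lambda>n. \<Phi> t (\<sigma> n)) (\<Phi> t l) sequentially"
      by (rule Cn.limitin_close[OF _ tC[OF nls_flowD(3)[OF P f]] HC(2)[OF \<sigma>H] y(2)])
    then show "limitin (Cn.mtopology 4) (\<Phi> t \<circ> \<sigma>) (\<Phi> t l) sequentially"
      by (simp add: o_def)
  qed (use HC in auto)
  then show ?thesis
    unfolding mtopology_Cn continuous_map_in_subtopology using Hloc_X(3)[OF W P f] by auto
qed

theorem proposition48:
  fixes chi :: "real \<Rightarrow> real" and \<kappa> :: real
    and \<Phi> :: "real \<Rightarrow> (real \<Rightarrow> complex) \<Rightarrow> real \<Rightarrow> complex"
    and f :: "real \<Rightarrow> complex"
  assumes "window chi"
    and "\<kappa> \<in> {1, -1}"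
    and "nls_flow chi \<kappa> \<Phi>"
    and "f \<in> X chi 5"
  shows "compactin (Cn_loc 4) (Hloc f) \<and>
    Hloc f \<subseteq> {g \<in> X chi 5. Xnorm chi 5 g \<le> Xnorm chi 5 f} \<and>
    (\<forall>t. homeomorphic_map (subtopology (Cn_loc 4) (Hloc f))
           (subtopology (Cn_loc 4) (Hloc (\<Phi> t f))) (\<Phi> t)) \<and>
    (\<forall>t y. \<forall>g \<in> X chi 5. \<Phi> t (translate y g) = translate y (\<Phi> t g))"
proof (intro conjI allI ballI)
  note WP = assms(1,3)
  show "compactin (Cn_loc 4) (Hloc f)"
    by (rule compactin_Hloc[OF WP assms(4)])
  show "Hloc f \<subseteq> {g \<in> X chi 5. Xnorm chi 5 g \<le> Xnorm chi 5 f}"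
    using Hloc_X(1,2)[OF WP assms(4)] by blast
  show "\<Phi> t (translate y g) = translate y (\<Phi> t g)" if "g \<in> X chi 5" for t y g
    by (rule flow_translate[OF WP that])
  fix t
  have ft: "\<Phi> t f \<in> X chi 5"
    by (rule nls_flowD(3)[OF assms(3,4)])
  have inv: "\<Phi> (- t) (\<Phi> t g) = g" "\<Phi> t (\<Phi> (- t) g) = g" if "g \<in> X chi 5" for g
    using flow_inverse[OF WP that, of t] flow_inverse[OF WP that, of "- t"] by simp_all
  \<comment> \<open>The backward flow maps the hull of \<open>\<Phi> t f\<close> into that of
    \<open>\<Phi> (- t) (\<Phi> t f)\<close>, which is \<open>f\<close>. The same continuity lemma,
    used at \<open>f\<close> and at \<open>\<Phi> t f\<close>, thus gives both directions.\<close>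
  have "homeomorphic_maps (subtopology (Cn_loc 4) (Hloc f)) (subtopology (Cn_loc 4) (Hloc (\<Phi> t f))) (\<Phi> t) (\<Phi> (- t))"
    unfolding homeomorphic_maps_def
    using continuous_map_flow_Hloc[OF WP assms(4), of t] continuous_map_flow_Hloc[OF WP ft, of "- t"]
      inv Hloc_X(1)[OF WP assms(4)] Hloc_X(1)[OF WP ft]
    by (simp add: inv(1)[OF assms(4)])
  then show "homeomorphic_map (subtopology (Cn_loc 4) (Hloc f)) (subtopology (Cn_loc 4) (Hloc (\<Phi> t f))) (\<Phi> t)"
    by (rule homeomorphic_maps_map[THEN iffD1, THEN conjunct1])
qed

end
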